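(* For any $D$-invariant subspace $W\subset\mathcal U_a$, there exists its residual interval $I_W$, and it equals $[c_{\mathcal J};d_{\mathcal J}]\cap(-a;a)$, where $\mathcal J=\mathcal F(W^0)$.
   Context: Weight. $\omega:[0;\infty)\to[0;\infty)$ is a non-decreasing continuous function such that: $\varphi_\omega(t):=\omega(e^t)$ is convex on $[0;\infty)$; $\omega(x)=o(x)$ and $\ln x=o(\omega(x))$ as $x\to\infty$; for every $\sigma>1$ there is $C>0$ with $\omega(x+y)\le\sigma(\omega(x)+\omega(y))+C$ for all $x,y\ge0$; $\int_1^\infty\omega(x)x^{-2}\,dx<\infty$. Fix $0<a\le+\infty$, a sequence $0<c_k\nearrow a$ such that $\{[-c_k;c_k]\}$ is an increasing sequence of closed intervals exhausting $(-a;a)$, and a sequence $0<r_k\nearrow1$. Ultradifferentiable functions. Put $\varphi_\omega^*(s)=\sup_t(st-\varphi_\omega(t))$ and, for $f\in C^\infty(-a;a)$, $q\in(0;1)$, $k\in\mathbb N$, $\|f\|_{\omega,q,k}=\sup_{j\in\mathbb N_0}\sup_{|x|\le c_k}|f^{(j)}(x)|e^{-q\varphi_\omega^*(j/q)}$. $\mathcal U_a$ is the space of all $f\in C^\infty(-a;a)$ with $\|f\|_{\omega,q,k}<\infty$ for all $q\in(0;1)$, $k\in\mathbb N$, with the locally convex topology given by these semi-norms; $\mathcal U_a'$ is its strong dual. $D=d/dx$. A $D$-invariant subspace is a closed subspace $W\subset\mathcal U_a$ with $D(W)\subset W$. $W^0=\{S\in\mathcal U_a': S(f)=0\ \forall f\in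 W\}$. Residual interval. For an interval $I\subset(-a;a)$ relatively closed in $(-a;a)$ put $W_I=\{f\in\mathcal U_a: f=0\text{ on }I\}$. The residual interval $I_W$ of $W$ is defined by the requirements: $I_W$ is relatively closed in $(-a;a)$, $W_{I_W}\subset W$, and $W_I\setminus W\ne\emptyset$ for every relatively closed interval $I\subsetneq I_W$. Module. $P_k$ is the Banach space of entire functions $\varphi$ with $\|\varphi\|_k=\sup_{z\in\mathbb C}|\varphi(z)|e^{-r_k\omega(|z|)-c_k|\mathrm{Im}\,z|}<\infty$, and $\mathcal P_a$ is the locally convex inductive limit of the $P_k$. The Fourier-Laplace transform $\mathcal F(S)(z)=S(e^{-\mathrm itz})$ is a linear topological isomorphism of $\mathcal U_a'$ onto $\mathcal P_a$, and $\mathcal F(W^0)$ is a closed submodule of $\mathcal P_a$ over $\mathbb C[z]$. For $\varphi\in\mathcal P_a$, $h_\varphi(\theta)=\limsup_{r\to\infty}r^{-1}\ln|\varphi(re^{\mathrm i\theta})|$ is its indicator function. The indicator segment of a closed submodule $\mathcal J\subset\mathcal P_a$ is $[c_{\mathcal J};d_{\mathcal J}]\subset\overline{\mathbb R}$, where $c_{\mathcal J}=-\sup_{\varphi\in\mathcal J}h_\varphi(-\pi/2)$ and $d_{\mathcal J}=\sup_{\varphi\in\mathcal J}h_\varphi(\pi/2)$.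
   Formalization: For a one-point interval I={p}, W_I is taken as the functions vanishing at p with all derivatives (with only f(p)=0 the claim fails for W={f flat at p}); the empty set counts as an interval, as needed for W=U_a. *)

theory Defs
  imports
    "HOL-Complex_Analysis.Complex_Analysis"
    "HOL-Library.Landau_Symbols"
begin

section \<open>Weights and the fixed data\<close>

definition weight :: "(real \<Rightarrow> real) \<Rightarrow> bool" where
  "weight \<omega> \<longleftrightarrow>
     (\<forall>x\<ge>0. 0 \<le> \<omega> x) \<and>
     mono_on {0..} \<omega> \<and>
     continuous_on {0..} \<omega> \<and>
     convex_on {0..} (\<lambda>t. \<omega> (exp t)) \<and>
     \<omega> \<in> o(\<lambda>x. x) \<and>
     ln \<in> o(\<omega>) \<and>
     (\<forall>\<sigma>>1. \<exists>C>0. \<forall>x\<ge>0. \<forall>y\<ge>0. \<omega> (x + y) \<le> \<sigma> * (\<omega> x + \<omega> y) + C) \<and>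
     set_integrable lborel {1..} (\<lambda>x. \<omega> x / x\<^sup>2)"

definition sym_interval :: "ereal \<Rightarrow> real set" where
  "sym_interval a = {x. - a < ereal x \<and> ereal x < a}"

text \<open>
  Monotone rather than strictly monotone sequences are allowed; the conditions
  still force \<open>c k < a\<close> (the closed intervals lie in the open one) and \<open>r k < 1\<close>.
\<close>

definition ultradiff_setting ::
    "(real \<Rightarrow> real) \<Rightarrow> ereal \<Rightarrow> (nat \<Rightarrow> real) \<Rightarrow> (nat \<Rightarrow> real) \<Rightarrow> bool" where
  "ultradiff_setting \<omega> a c r \<longleftrightarrow>
     weight \<omega> \<and> 0 < a \<and>
     (\<forall>k. 0 < c k) \<and> incseq c \<and> (\<lambda>k. ereal (c k)) \<longlonglongrightarrow> a \<and>
     (\<Union>k. {- c k..c k}) = sym_interval a \<and>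
     (\<forall>k. 0 < r k \<and> r k < 1) \<and> incseq r \<and> r \<longlonglongrightarrow> 1"


section \<open>The space of ultradifferentiable functions\<close>

text \<open>
  The variable of \<open>\<phi>\<^sub>\<omega>\<close> ranges over \<open>[0;\<infinity>)\<close>.  For a weight and \<open>s \<ge> 0\<close> the
  supremum is over a set that is bounded above, since \<open>ln x = o(\<omega> x)\<close>.
\<close>

definition young_conj :: "(real \<Rightarrow> real) \<Rightarrow> real \<Rightarrow> real" where
  "young_conj \<omega> s = (SUP t\<in>{0..}. s * t - \<omega> (exp t))"

text \<open>
  A function on \<open>(-a;a)\<close> is represented by its extension by zero to the real
  line, so that equality of representatives is equality on \<open>(-a;a)\<close>.
\<close>

definition D_op :: "ereal \<Rightarrow> (real \<Rightarrow> complex) \<Rightarrow> real \<Rightarrow> complex" where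
  "D_op a f = (\<lambda>x. if x \<in> sym_interval a then vector_derivative f (at x) else 0)"

definition smooth_functions :: "ereal \<Rightarrow> (real \<Rightarrow> complex) set" where
  "smooth_functions a =
     {f. (\<forall>x. x \<notin> sym_interval a \<longrightarrow> f x = 0) \<and>
         (\<forall>j. \<forall>x\<in>sym_interval a. ((D_op a ^^ j) f) differentiable (at x))}"

definition U_seminorm ::
    "(real \<Rightarrow> real) \<Rightarrow> ereal \<Rightarrow> (nat \<Rightarrow> real) \<Rightarrow> real \<Rightarrow> nat \<Rightarrow> (real \<Rightarrow> complex) \<Rightarrow> ereal" where
  "U_seminorm \<omega> a c q k f =
     (SUP j. SUP x\<in>{- c k..c k}.
        ereal (norm ((D_op a ^^ j) f x) * exp (- q * young_conj \<omega> (real j / q))))"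

definition U_space :: "(real \<Rightarrow> real) \<Rightarrow> ereal \<Rightarrow> (nat \<Rightarrow> real) \<Rightarrow> (real \<Rightarrow> complex) set" where
  "U_space \<omega> a c =
     {f \<in> smooth_functions a. \<forall>q\<in>{0<..<1}. \<forall>k. U_seminorm \<omega> a c q k f < \<infinity>}"

definition U_topology ::
    "(real \<Rightarrow> real) \<Rightarrow> ereal \<Rightarrow> (nat \<Rightarrow> real) \<Rightarrow> (real \<Rightarrow> complex) topology" where
  "U_topology \<omega> a c = topology_generated_by
     {{g \<in> U_space \<omega> a c. U_seminorm \<omega> a c q k (\<lambda>x. g x - f x) < ereal \<epsilon>} | f q k \<epsilon>.
        f \<in> U_space \<omega> a c \<and> q \<in> {0<..<1} \<and> 0 < \<epsilon>}"

text \<open>The strong topology of the dual is not needed, only its elements.\<close>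

definition U_dual ::
    "(real \<Rightarrow> real) \<Rightarrow> ereal \<Rightarrow> (nat \<Rightarrow> real) \<Rightarrow> ((real \<Rightarrow> complex) \<Rightarrow> complex) set" where
  "U_dual \<omega> a c =
     {S \<in> extensional (U_space \<omega> a c).
        (\<forall>f\<in>U_space \<omega> a c. \<forall>g\<in>U_space \<omega> a c. S (\<lambda>x. f x + g x) = S f + S g) \<and>
        (\<forall>f\<in>U_space \<omega> a c. \<forall>\<alpha>. S (\<lambda>x. \<alpha> * f x) = \<alpha> * S f) \<and>
        continuous_map (U_topology \<omega> a c) euclidean S}"


section \<open>Invariant subspaces and residual intervals\<close>

definition D_invariant_subspace ::
    "(real \<Rightarrow> real) \<Rightarrow> ereal \<Rightarrow> (nat \<Rightarrow> real) \<Rightarrow> (real \<Rightarrow> complex) set \<Rightarrow> bool" where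
  "D_invariant_subspace \<omega> a c W \<longleftrightarrow>
     W \<subseteq> U_space \<omega> a c \<and>
     (\<lambda>x. 0) \<in> W \<and>
     (\<forall>f\<in>W. \<forall>g\<in>W. (\<lambda>x. f x + g x) \<in> W) \<and>
     (\<forall>f\<in>W. \<forall>\<alpha>. (\<lambda>x. \<alpha> * f x) \<in> W) \<and>
     closedin (U_topology \<omega> a c) W \<and>
     D_op a ` W \<subseteq> W"

definition annihilator ::
    "(real \<Rightarrow> real) \<Rightarrow> ereal \<Rightarrow> (nat \<Rightarrow> real) \<Rightarrow> (real \<Rightarrow> complex) set
       \<Rightarrow> ((real \<Rightarrow> complex) \<Rightarrow> complex) set" where
  "annihilator \<omega> a c W = {S \<in> U_dual \<omega> a c. \<forall>f\<in>W. S f = 0}"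

text \<open>The empty set counts as an interval; it is the residual interval of the whole space.\<close>

definition rel_closed_interval :: "ereal \<Rightarrow> real set \<Rightarrow> bool" where
  "rel_closed_interval a I \<longleftrightarrow>
     I \<subseteq> sym_interval a \<and> is_interval I \<and> closedin (top_of_set (sym_interval a)) I"

text \<open>
  On a degenerate interval \<open>{p}\<close>, vanishing is understood as vanishing to infinite
  order, the usual convention for residual intervals; on longer intervals this is
  automatic.  If \<open>W_interval\<close> of \<open>{p}\<close> were \<open>{f. f p = 0}\<close>, then the closed invariant
  subspace of all functions flat at \<open>p\<close> would not contain it, but it would
  contain the functions vanishing on \<open>{p..p + \<epsilon>}\<close> for every small \<open>\<epsilon> > 0\<close>, so it
  would have no residual interval at all.
\<close>

definition W_interval ::
    "(real \<Rightarrow> real) \<Rightarrow> ereal \<Rightarrow> (nat \<Rightarrow> real) \<Rightarrow> real set \<Rightarrow> (real \<Rightarrow> complex) set" where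
  "W_interval \<omega> a c I =
     {f \<in> U_space \<omega> a c. (\<forall>x\<in>I. f x = 0) \<and>
        (\<forall>p. I = {p} \<longrightarrow> (\<forall>j. (D_op a ^^ j) f p = 0))}"

definition is_residual_interval ::
    "(real \<Rightarrow> real) \<Rightarrow> ereal \<Rightarrow> (nat \<Rightarrow> real) \<Rightarrow> (real \<Rightarrow> complex) set \<Rightarrow> real set \<Rightarrow> bool" where
  "is_residual_interval \<omega> a c W R \<longleftrightarrow>
     rel_closed_interval a R \<and>
     W_interval \<omega> a c R \<subseteq> W \<and>
     (\<forall>I. rel_closed_interval a I \<and> I \<subset> R \<longrightarrow> W_interval \<omega> a c I - W \<noteq> {})"


section \<open>The Fourier-Laplace transform and the indicator segment\<close>

definition fourier_laplace ::
    "ereal \<Rightarrow> ((real \<Rightarrow> complex) \<Rightarrow> complex) \<Rightarrow> complex \<Rightarrow> complex" where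
  "fourier_laplace a S z =
     S (\<lambda>t. if t \<in> sym_interval a then exp (- \<i> * complex_of_real t * z) else 0)"

definition P_norm ::
    "(real \<Rightarrow> real) \<Rightarrow> (nat \<Rightarrow> real) \<Rightarrow> (nat \<Rightarrow> real) \<Rightarrow> nat \<Rightarrow> (complex \<Rightarrow> complex) \<Rightarrow> ereal" where
  "P_norm \<omega> c r k \<phi> =
     (SUP z. ereal (norm (\<phi> z) * exp (- r k * \<omega> (norm z) - c k * \<bar>Im z\<bar>)))"

text \<open>
  The underlying set of the inductive limit, onto which \<open>fourier_laplace a\<close> maps
  the dual.  The indicator segment of a submodule involves neither its topology
  nor its module structure.
\<close>

definition P_space ::
    "(real \<Rightarrow> real) \<Rightarrow> (nat \<Rightarrow> real) \<Rightarrow> (nat \<Rightarrow> real) \<Rightarrow> (complex \<Rightarrow> complex) set" where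
  "P_space \<omega> c r = (\<Union>k. {\<phi>. \<phi> holomorphic_on UNIV \<and> P_norm \<omega> c r k \<phi> < \<infinity>})"

text \<open>With \<open>ln 0 = -\<infinity>\<close>; in particular the zero function has indicator \<open>-\<infinity>\<close>.\<close>

definition ln_ext :: "real \<Rightarrow> ereal" where
  "ln_ext x = (if x = 0 then - \<infinity> else ereal (ln x))"

definition indicator_fun :: "(complex \<Rightarrow> complex) \<Rightarrow> real \<Rightarrow> ereal" where
  "indicator_fun \<phi> \<theta> =
     Limsup at_top (\<lambda>\<rho>::real. ln_ext (norm (\<phi> (complex_of_real \<rho> * cis \<theta>))) / ereal \<rho>)"

definition seg_lower :: "(complex \<Rightarrow> complex) set \<Rightarrow> ereal" where
  "seg_lower J = - (SUP \<phi>\<in>J. indicator_fun \<phi> (- pi / 2))"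

definition seg_upper :: "(complex \<Rightarrow> complex) set \<Rightarrow> ereal" where
  "seg_upper J = (SUP \<phi>\<in>J. indicator_fun \<phi> (pi / 2))"

definition indicator_segment :: "(complex \<Rightarrow> complex) set \<Rightarrow> ereal set" where
  "indicator_segment J = {seg_lower J..seg_upper J}"

end

theory Submission imports Defs begin

text \<open>
  Write \<open>S\<close> for a functional in \<open>annihilator \<omega> a c W\<close>, \<open>\<phi>\<close> for its transform and \<open>e\<^sub>y(t) = exp (y t)\<close>,
  so that \<open>\<phi> (\<i> y) = S e\<^sub>y\<close>.  The indicators of \<open>\<phi>\<close> at \<open>\<pm> pi / 2\<close> measure the exponential growth of
  \<open>S e\<^sub>y\<close> as \<open>y \<longlongrightarrow> \<pm> \<infinity>\<close>.  The theorem says that this growth finds the convex hull of the support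
  of \<open>S\<close>, together with duality: \<open>W_interval I\<close> lies in \<open>W\<close> exactly if every \<open>S\<close> vanishes on it,
  because a closed subspace is the common kernel of its annihilator (\<open>annihilator_separates\<close>).

  One direction (\<open>upper_type_le_of_annihilation\<close>): if \<open>S\<close> vanishes on functions supported to the right
  of \<open>\<alpha>\<close>, then \<open>S e\<^sub>y = S (\<kappa> e\<^sub>y)\<close> for a step \<open>\<kappa>\<close> that falls from 1 to 0 between \<open>\<alpha>\<close> and \<open>\<beta>\<close>, and
  continuity of \<open>S\<close> gives \<open>S e\<^sub>y = O(exp (\<beta> y + \<omega> y))\<close>, where \<open>\<omega> y = o(y)\<close>.  Such steps exist in the
  space because the integral of \<open>\<omega> x / x\<^sup>2\<close> converges (\<open>weight_levels\<close>, \<open>weight_step\<close>): an infinite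
  composition of running averages whose widths are summable turns a ramp into a smooth function
  with derivatives controlled by the widths (\<open>smooth_step_exists\<close>).

  The converse (\<open>annihilates_compactly_supported\<close>) is the Paley-Wiener direction, proved here by a
  real-variable inversion of the Laplace transform.  Suppose \<open>S e\<^sub>m = O(exp ((b + \<delta>) m))\<close> for every
  \<open>\<delta> > 0\<close> and let \<open>f\<close> have compact support to the right of \<open>b\<close>.  Convolution of \<open>f\<close> with \<open>e\<^sub>m\<close> gives
  \<open>L\<^sub>m e\<^sub>m\<close>, where \<open>L\<^sub>m = \<integral> f(u) exp (- m u) du = O(exp (- b m))\<close>.  The Gumbel kernel
  \<open>n X exp (- X)\<close>, \<open>X = exp (n (s - \<tau>))\<close>, is an approximate unit mass at \<open>\<tau>\<close> and also a power series
  in \<open>exp (n s)\<close>.  Hence its convolution with \<open>f\<close>, which is close to \<open>f\<close> in every semi-norm when \<open>n\<close> is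
  large and \<open>\<tau>\<close> small, is approximated by combinations \<open>\<Sum> \<gamma>\<^sub>i L\<^sub>m e\<^sub>m\<close> with \<open>m = (i + 1) n\<close>.  The
  coefficients contain \<open>exp (- m \<tau>)\<close>, which beats the error \<open>exp (\<delta> m)\<close>, so \<open>S\<close> of these
  combinations tends to 0 and \<open>S f = 0\<close>.

  Cutting a function that vanishes on the interval at an endpoint separates its left and right
  parts, and \<open>types_ordered\<close> ensures that a nonzero \<open>S\<close> really has a nonempty interval between its
  two types.  So all \<open>S\<close> vanish on \<open>W_interval\<close> of the indicator segment
  (\<open>segment_W_interval_subset\<close>), and any interval \<open>I\<close> with \<open>W_interval I \<subseteq> W\<close> contains the segment
  (\<open>segment_subset_of_W_interval_subset\<close>).  Minimality and uniqueness of the residual interval are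
  formal consequences of these two statements.
\<close>

section \<open>Iterated derivatives on a symmetric interval\<close>

lemma open_sym_interval: "open (sym_interval a)"
proof -
  have "sym_interval a = ereal -` {-a<..<a}" by (auto simp: sym_interval_def)
  moreover have "open (ereal -` {-a<..<a})"
    by (intro open_vimage continuous_intros)
  ultimately show ?thesis by simp
qed

lemma sym_interval_between:
  assumes "x \<in> sym_interval a" "z \<in> sym_interval a" "x \<le> y" "y \<le> z"
  shows "y \<in> sym_interval a"
proof -
  have "- a < ereal x" "ereal z < a" "ereal x \<le> ereal y" "ereal y \<le> ereal z"
    using assms by (auto simp: sym_interval_def)
  then show ?thesis unfolding sym_interval_def using less_le_trans le_less_trans by blast
qed

lemma sym_interval_uminus: "x \<in> sym_interval a \<Longrightarrow> - x \<in> sym_interval a"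
  by (auto simp: sym_interval_def ereal_uminus_less_reorder ereal_less_uminus_reorder simp flip: uminus_ereal.simps(1))

lemma D_op_inside: "x \<in> sym_interval a \<Longrightarrow> D_op a f x = vector_derivative f (at x)"
  and D_op_outside: "x \<notin> sym_interval a \<Longrightarrow> D_op a f x = 0"
  by (simp_all add: D_op_def)

text \<open>
  All smoothness proofs below use this form: a sequence of functions that vanish outside the
  interval and of which each is the derivative of its predecessor must be the sequence of iterated
  derivatives.
\<close>
lemma D_op_criterion:
  assumes "F 0 = f" "\<And>j x. x \<notin> sym_interval a \<Longrightarrow> F j x = 0"
    and der: "\<And>j x. x \<in> sym_interval a \<Longrightarrow> (F j has_vector_derivative F (Suc j) x) (at x)"
  shows D_op_criterion_power: "(D_op a ^^ j) f = F j"
    and D_op_criterion_smooth: "f \<in> smooth_functions a"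
proof -
  show *: "(D_op a ^^ j) f = F j" for j
  proof (induction j)
    case (Suc j)
    then show ?case using assms(2)[of _ "Suc j"] der[of _ j]
      by (intro ext, rename_tac x, case_tac "x \<in> sym_interval a")
         (simp_all add: D_op_inside D_op_outside vector_derivative_at)
  qed (simp add: assms(1))
  have "((D_op a ^^ j) f) differentiable (at x)" if "x \<in> sym_interval a" for x j
    unfolding * using der[OF that, of j] by (auto intro: differentiableI_vector)
  then show "f \<in> smooth_functions a"
    using assms(1) assms(2)[of _ 0] by (auto simp: smooth_functions_def)
qed

lemma D_op_power_derivative:
  assumes "f \<in> smooth_functions a" "x \<in> sym_interval a"
  shows "((D_op a ^^ j) f has_vector_derivative (D_op a ^^ Suc j) f x) (at x)"
proof -
  have "((D_op a ^^ j) f) differentiable (at x)" using assms by (auto simp: smooth_functions_def)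
  then show ?thesis using assms(2) by (simp add: D_op_inside D_op_outside vector_derivative_works)
qed

lemma D_op_power_outside:
  assumes "f \<in> smooth_functions a" "x \<notin> sym_interval a"
  shows "(D_op a ^^ j) f x = 0"
  using assms by (cases j) (auto simp: smooth_functions_def D_op_inside D_op_outside)

lemma D_op_power_local:
  assumes "open V" "\<And>x. x \<in> V \<Longrightarrow> f x = g x" "x \<in> V"
  shows "(D_op a ^^ j) f x = (D_op a ^^ j) g x"
  using assms(3)
proof (induction j arbitrary: x)
  case (Suc j)
  have "eventually (\<lambda>y. (D_op a ^^ j) f y = (D_op a ^^ j) g y) (nhds x)"
    using Suc.IH Suc.prems assms(1) unfolding eventually_nhds by blast
  then have "vector_derivative ((D_op a ^^ j) f) (at x) = vector_derivative ((D_op a ^^ j) g) (at x)"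
    by (intro vector_derivative_cong_eq) auto
  then show ?case by (cases "x \<in> sym_interval a") (simp_all add: D_op_inside D_op_outside)
qed (use assms in auto)

lemma D_op_power_eq_0:
  assumes "open V" "\<And>x. x \<in> V \<Longrightarrow> f x = 0" "x \<in> V"
  shows "(D_op a ^^ j) f x = 0"
proof -
  have "(D_op a ^^ j) (\<lambda>x. 0) = (\<lambda>x. 0)"
    by (rule D_op_criterion_power[where F = "\<lambda>j x. 0"]) auto
  then show ?thesis using D_op_power_local[of V f "\<lambda>x. 0" x j a] assms by simp
qed

lemma D_op_power_add:
  assumes "f \<in> smooth_functions a" "g \<in> smooth_functions a"
  shows "(D_op a ^^ j) (\<lambda>x. f x + g x) = (\<lambda>x. (D_op a ^^ j) f x + (D_op a ^^ j) g x)"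
    and "(\<lambda>x. f x + g x) \<in> smooth_functions a"
proof -
  note crit = D_op_criterion[where F = "\<lambda>j x. (D_op a ^^ j) f x + (D_op a ^^ j) g x"
      and f = "\<lambda>x. f x + g x" and a = a]
  have 1: "((\<lambda>x. (D_op a ^^ j) f x + (D_op a ^^ j) g x) has_vector_derivative
       (D_op a ^^ Suc j) f x + (D_op a ^^ Suc j) g x) (at x)" if "x \<in> sym_interval a" for j x
    by (intro has_vector_derivative_add D_op_power_derivative assms that)
  show "(D_op a ^^ j) (\<lambda>x. f x + g x) = (\<lambda>x. (D_op a ^^ j) f x + (D_op a ^^ j) g x)"
    by (rule crit(1)) (use 1 D_op_power_outside assms in auto)
  show "(\<lambda>x. f x + g x) \<in> smooth_functions a"
    by (rule crit(2)) (use 1 D_op_power_outside assms in auto)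
qed

lemma D_op_power_scale:
  assumes "f \<in> smooth_functions a"
  shows "(D_op a ^^ j) (\<lambda>x. \<alpha> * f x) = (\<lambda>x. \<alpha> * (D_op a ^^ j) f x)"
    and "(\<lambda>x. \<alpha> * f x) \<in> smooth_functions a"
proof -
  note crit = D_op_criterion[where F = "\<lambda>j x. \<alpha> * (D_op a ^^ j) f x"
      and f = "\<lambda>x. \<alpha> * f x" and a = a]
  have 1: "((\<lambda>x. \<alpha> * (D_op a ^^ j) f x) has_vector_derivative \<alpha> * (D_op a ^^ Suc j) f x) (at x)"
    if "x \<in> sym_interval a" for j x
    by (intro has_vector_derivative_mult_right D_op_power_derivative assms that)
  show "(D_op a ^^ j) (\<lambda>x. \<alpha> * f x) = (\<lambda>x. \<alpha> * (D_op a ^^ j) f x)"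
    by (rule crit(1)) (use 1 D_op_power_outside assms in auto)
  show "(\<lambda>x. \<alpha> * f x) \<in> smooth_functions a"
    by (rule crit(2)) (use 1 D_op_power_outside assms in auto)
qed

text \<open>
  Pascal's rule, in the form of the induction step of the Leibniz formula.
\<close>
lemma leibniz_sum:
  fixes f g :: "nat \<Rightarrow> complex"
  shows "(\<Sum>i\<le>j. of_nat (j choose i) * (f (Suc i) * g (j - i) + f i * g (Suc j - i)))
      = (\<Sum>i\<le>Suc j. of_nat (Suc j choose i) * (f i * g (Suc j - i)))"
proof -
  have "(\<Sum>i\<le>Suc j. of_nat (Suc j choose i) * (f i * g (Suc j - i)))
      = f 0 * g (Suc j) + (\<Sum>i\<le>j. of_nat (Suc j choose Suc i) * (f (Suc i) * g (j - i)))"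
    by (subst sum.atMost_Suc_shift) simp
  also have "\<dots> = (\<Sum>i\<le>j. of_nat (j choose i) * (f (Suc i) * g (j - i)))
      + (f 0 * g (Suc j) + (\<Sum>i\<le>j. of_nat (j choose Suc i) * (f (Suc i) * g (j - i))))"
    by (simp add: algebra_simps sum.distrib)
  also have "f 0 * g (Suc j) + (\<Sum>i\<le>j. of_nat (j choose Suc i) * (f (Suc i) * g (j - i)))
      = (\<Sum>i\<le>Suc j. of_nat (j choose i) * (f i * g (Suc j - i)))"
    by (subst sum.atMost_Suc_shift) simp
  also have "\<dots> = (\<Sum>i\<le>j. of_nat (j choose i) * (f i * g (Suc j - i)))" by simp
  finally show ?thesis by (simp add: algebra_simps sum.distrib)
qed

lemma D_op_power_mult:
  assumes "f \<in> smooth_functions a" "g \<in> smooth_functions a"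
  shows "(D_op a ^^ j) (\<lambda>x. f x * g x)
      = (\<lambda>x. \<Sum>i\<le>j. of_nat (j choose i) * ((D_op a ^^ i) f x * (D_op a ^^ (j - i)) g x))"
    and "(\<lambda>x. f x * g x) \<in> smooth_functions a"
proof -
  define F where "F = (\<lambda>j x. \<Sum>i\<le>j. of_nat (j choose i) * ((D_op a ^^ i) f x * (D_op a ^^ (j - i)) g x))"
  note crit = D_op_criterion[where F = F and f = "\<lambda>x. f x * g x" and a = a]
  have 0: "F 0 = (\<lambda>x. f x * g x)" by (simp add: F_def)
  have 1: "(F j has_vector_derivative F (Suc j) x) (at x)" if x: "x \<in> sym_interval a" for j x
  proof -
    have "(F j has_vector_derivative
       (\<Sum>i\<le>j. of_nat (j choose i) * ((D_op a ^^ i) f x * (D_op a ^^ Suc (j - i)) g x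
           + (D_op a ^^ Suc i) f x * (D_op a ^^ (j - i)) g x))) (at x)"
      unfolding F_def
      by (intro has_vector_derivative_sum has_vector_derivative_mult_right has_vector_derivative_mult
          D_op_power_derivative assms x)
    also have "(\<Sum>i\<le>j. of_nat (j choose i) * ((D_op a ^^ i) f x * (D_op a ^^ Suc (j - i)) g x
           + (D_op a ^^ Suc i) f x * (D_op a ^^ (j - i)) g x))
        = (\<Sum>i\<le>j. of_nat (j choose i) * ((D_op a ^^ Suc i) f x * (D_op a ^^ (j - i)) g x
           + (D_op a ^^ i) f x * (D_op a ^^ (Suc j - i)) g x))"
      by (intro sum.cong refl) (simp add: Suc_diff_le add.commute del: funpow.simps)
    also have "\<dots> = F (Suc j) x"
      unfolding F_def by (rule leibniz_sum[where f = "\<lambda>i. (D_op a ^^ i) f x" and g = "\<lambda>i. (D_op a ^^ i) g x"])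
    finally show ?thesis .
  qed
  have 2: "F j x = 0" if "x \<notin> sym_interval a" for j x
    using that assms by (simp add: F_def D_op_power_outside)
  show "(D_op a ^^ j) (\<lambda>x. f x * g x)
      = (\<lambda>x. \<Sum>i\<le>j. of_nat (j choose i) * ((D_op a ^^ i) f x * (D_op a ^^ (j - i)) g x))"
    using crit(1)[OF 0 2 1] by (simp add: F_def)
  show "(\<lambda>x. f x * g x) \<in> smooth_functions a"
    by (rule crit(2)[OF 0 2 1])
qed

text \<open>
  At \<open>p\<close> the cut derivative is dominated by the uncut one, whose difference quotient tends to the
  next derivative, that is to 0; so flatness at \<open>p\<close> passes to the cut function at every order.
\<close>
lemma D_op_power_cut:
  assumes f: "f \<in> smooth_functions a" and flat: "\<And>j. (D_op a ^^ j) f p = 0"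
  shows "(D_op a ^^ j) (\<lambda>x. if p < x then f x else 0) = (\<lambda>x. if p < x then (D_op a ^^ j) f x else 0)"
    and "(\<lambda>x. if p < x then f x else 0) \<in> smooth_functions a"
proof -
  define F where "F = (\<lambda>j x. if p < x then (D_op a ^^ j) f x else 0)"
  note crit = D_op_criterion[where F = F and f = "\<lambda>x. if p < x then f x else 0" and a = a]
  have 1: "(F j has_vector_derivative F (Suc j) x) (at x)" if x: "x \<in> sym_interval a" for j x
  proof -
    let ?g = "(D_op a ^^ j) f" and ?g' = "(D_op a ^^ Suc j) f"
    have g: "(?g has_vector_derivative ?g' x) (at x)" by (rule D_op_power_derivative[OF f x])
    consider "x < p" | "p < x" | "x = p" by linarith
    then show ?thesis
    proof cases
      case 1
      have "((\<lambda>_. 0) has_vector_derivative 0) (at x)" by simp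
      then have "(F j has_vector_derivative 0) (at x)"
        by (rule has_vector_derivative_transform_within_open[of _ _ _ "{..<p}"]) (use 1 in \<open>auto simp: F_def\<close>)
      then show ?thesis using 1 by (simp add: F_def)
    next
      case 2
      have "(F j has_vector_derivative ?g' x) (at x)"
        by (rule has_vector_derivative_transform_within_open[OF g, of "{p<..}"]) (use 2 in \<open>auto simp: F_def\<close>)
      then show ?thesis using 2 by (simp add: F_def del: funpow.simps)
    next
      case 3
      have z: "?g x = 0" "?g' x = 0" using flat[of j] flat[of "Suc j"] 3 by (simp_all del: funpow.simps)
      then have "(?g has_derivative (\<lambda>h. 0)) (at x)"
        using g by (simp add: has_vector_derivative_def del: funpow.simps)
      then have "(\<lambda>h. norm (?g (x + h)) / norm h) \<midarrow>0\<rightarrow> 0"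
        by (simp add: has_derivative_at z(1))
      then have "(\<lambda>h. norm (F j (x + h)) / norm h) \<midarrow>0\<rightarrow> 0"
        by (rule Lim_null_comparison[rotated]) (auto simp: F_def intro!: always_eventually divide_right_mono)
      then have "(F j has_derivative (\<lambda>h. 0)) (at x)"
        using 3 by (simp add: has_derivative_at F_def)
      then have "(F j has_vector_derivative 0) (at x)"
        by (simp add: has_vector_derivative_def)
      then show ?thesis using 3 by (simp add: F_def)
    qed
  qed
  have 2: "F j x = 0" if "x \<notin> sym_interval a" for j x
    using that f by (simp add: F_def D_op_power_outside)
  have 0: "F 0 = (\<lambda>x. if p < x then f x else 0)" by (auto simp: F_def)
  show "(D_op a ^^ j) (\<lambda>x. if p < x then f x else 0) = (\<lambda>x. if p < x then (D_op a ^^ j) f x else 0)"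
    using crit(1)[OF 0 2 1] by (simp add: F_def)
  show "(\<lambda>x. if p < x then f x else 0) \<in> smooth_functions a"
    by (rule crit(2)[OF 0 2 1])
qed

lemma D_op_power_reflect:
  assumes f: "f \<in> smooth_functions a"
  shows "(D_op a ^^ j) (\<lambda>x. f (- x)) = (\<lambda>x. (- 1) ^ j * (D_op a ^^ j) f (- x))"
    and "(\<lambda>x. f (- x)) \<in> smooth_functions a"
proof -
  define F where "F = (\<lambda>j x. (- 1) ^ j * (D_op a ^^ j) f (- x))"
  note crit = D_op_criterion[where F = F and f = "\<lambda>x. f (- x)" and a = a]
  have 1: "(F j has_vector_derivative F (Suc j) x) (at x)" if x: "x \<in> sym_interval a" for j x
  proof -
    have "((D_op a ^^ j) f has_vector_derivative (D_op a ^^ Suc j) f (- x)) (at (- x))"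
      by (intro D_op_power_derivative f sym_interval_uminus x)
    then have "((D_op a ^^ j) f \<circ> uminus has_vector_derivative (- 1) *\<^sub>R (D_op a ^^ Suc j) f (- x)) (at x)"
      by (intro vector_diff_chain_at) (auto intro!: derivative_eq_intros)
    then have "((\<lambda>x. (- 1) ^ j * ((D_op a ^^ j) f \<circ> uminus) x) has_vector_derivative
        (- 1) ^ j * ((- 1) *\<^sub>R (D_op a ^^ Suc j) f (- x))) (at x)"
      by (rule has_vector_derivative_mult_right)
    then show ?thesis by (simp add: F_def o_def)
  qed
  have 2: "F j x = 0" if "x \<notin> sym_interval a" for j x
    using that f sym_interval_uminus[of "- x" a] D_op_power_outside[OF f, of "- x"] by (auto simp add: F_def)
  have 0: "F 0 = (\<lambda>x. f (- x))" by (simp add: F_def)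
  show "(D_op a ^^ j) (\<lambda>x. f (- x)) = (\<lambda>x. (- 1) ^ j * (D_op a ^^ j) f (- x))"
    using crit(1)[OF 0 2 1] by (simp add: F_def)
  show "(\<lambda>x. f (- x)) \<in> smooth_functions a"
    by (rule crit(2)[OF 0 2 1])
qed

text \<open>
  On an interval with more than one point a derivative can be computed from within the interval.
\<close>
lemma flat_on_interval:
  assumes f: "f \<in> smooth_functions a" and I: "is_interval I" "I \<subseteq> sym_interval a" "\<And>p. I \<noteq> {p}"
    and van: "\<And>x. x \<in> I \<Longrightarrow> f x = 0" and x: "x \<in> I"
  shows "(D_op a ^^ j) f x = 0"
  using x
proof (induction j arbitrary: x)
  case (Suc j)
  have conn: "connected I" using I by (simp add: is_interval_connected_1)
  have lim: "at x within I \<noteq> bot"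
    using connected_imp_perfect[OF conn, of x] I(3) Suc.prems
    by (auto simp: trivial_limit_within)
  have "((D_op a ^^ j) f has_vector_derivative (D_op a ^^ Suc j) f x) (at x within I)"
    using D_op_power_derivative[OF f] Suc.prems I(2) has_vector_derivative_at_within by blast
  moreover have "((D_op a ^^ j) f has_vector_derivative 0) (at x within I)"
    by (rule has_vector_derivative_transform[of x I _ "\<lambda>_. 0"]) (use Suc in auto)
  ultimately show ?case using vector_derivative_unique_within[OF lim] by blast
qed (use van in auto)

section \<open>Smooth steps from iterated averages\<close>

text \<open>
  The mean of \<open>u\<close> over \<open>{t - w..t}\<close>.  The substitution to the unit interval makes pointwise
  estimates of \<open>u\<close> carry over without reference to \<open>w\<close>.
\<close>
definition run_avg :: "real \<Rightarrow> (real \<Rightarrow> real) \<Rightarrow> real \<Rightarrow> real" where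
  "run_avg w u t = integral {0..1} (\<lambda>s. u (t - w * s))"

lemma continuous_along: "continuous_on UNIV (u :: real \<Rightarrow> real) \<Longrightarrow> continuous_on S (\<lambda>s. u (t - w * s))"
  by (rule continuous_on_compose2[of UNIV u]) (assumption, intro continuous_intros, simp)

lemma run_avg_diff_le:
  assumes "continuous_on UNIV u" "continuous_on UNIV v"
    and "\<And>s. 0 \<le> s \<Longrightarrow> s \<le> 1 \<Longrightarrow> \<bar>u (t - w * s) - v (t' - w * s)\<bar> \<le> B"
  shows "\<bar>run_avg w u t - run_avg w v t'\<bar> \<le> B"
proof -
  have c: "continuous_on {0..1} (\<lambda>s. u (t - w * s))" "continuous_on {0..1} (\<lambda>s. v (t' - w * s))"
    using assms(1,2) by (auto intro: continuous_along)
  have "run_avg w u t - run_avg w v t' = integral {0..1} (\<lambda>s. u (t - w * s) - v (t' - w * s))"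
    unfolding run_avg_def using c by (intro integral_diff[symmetric] integrable_continuous_interval)
  also have "norm \<dots> \<le> B * (1 - 0)"
    using c assms(3) by (intro integral_bound continuous_on_diff) auto
  finally show ?thesis by simp
qed

lemma run_avg_const: "run_avg w (\<lambda>_. k) t = k"
  by (simp add: run_avg_def)

text \<open>
  Averaging gains one derivative, and the new derivative is a difference quotient: it costs a
  factor \<open>2 / w\<close> and not a derivative of \<open>u\<close>.
\<close>
lemma run_avg_derivative:
  assumes u: "continuous_on UNIV u" and w: "0 < w"
  shows "(run_avg w u has_real_derivative (u t - u (t - w)) / w) (at t)"
proof -
  obtain P where P: "\<And>x. x \<in> {t - w - 1..t + 1} \<Longrightarrow>
      (P has_vector_derivative u x) (at x within {t - w - 1..t + 1})"
    using antiderivative_continuous[OF continuous_on_subset[OF u subset_UNIV], of "t - w - 1" "t + 1"] by metis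
  have P': "(P has_real_derivative u x) (at x)" if "x \<in> {t - w - 1<..<t + 1}" for x
  proof -
    have "(P has_vector_derivative u x) (at x within {t - w - 1<..<t + 1})"
      by (rule has_vector_derivative_within_subset[OF P[of x]]) (use that in auto)
    then have "(P has_vector_derivative u x) (at x)"
      using at_within_open[OF that] by simp
    then show ?thesis by (simp only: has_real_derivative_iff_has_vector_derivative)
  qed
  have eq: "run_avg w u t' = (P t' - P (t' - w)) / w" if t': "t' \<in> {t - 1<..<t + 1}" for t'
  proof -
    have "((\<lambda>s. u (t' - w * s)) has_integral (- P (t' - w * 1) / w - (- P (t' - w * 0) / w))) {0..1}"
    proof (rule fundamental_theorem_of_calculus)
      fix s :: real assume s: "s \<in> {0..1}"
      have "w * s \<le> w" "0 \<le> w * s" using s w by (auto simp: mult_left_le)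
      then have "t' - w * s \<in> {t - w - 1<..<t + 1}" using t' by auto
      moreover have "((\<lambda>s. t' - w * s) has_real_derivative - w) (at s)"
        by (auto intro!: derivative_eq_intros)
      ultimately have "((\<lambda>s. P (t' - w * s)) has_real_derivative u (t' - w * s) * - w) (at s)"
        by (intro DERIV_chain2[OF P'])
      from DERIV_cdivide[OF DERIV_minus[OF this], of w]
      have "((\<lambda>s. - P (t' - w * s) / w) has_real_derivative u (t' - w * s)) (at s)"
        using w by simp
      then show "((\<lambda>s. - P (t' - w * s) / w) has_vector_derivative u (t' - w * s)) (at s within {0..1})"
        by (simp add: has_real_derivative_iff_has_vector_derivative has_vector_derivative_at_within)
    qed simp
    then show ?thesis
      unfolding run_avg_def by (simp add: integral_unique diff_divide_distrib)
  qed
  have "((\<lambda>t'. (P t' - P (t' - w)) / w) has_real_derivative (u t - u (t - w)) / w) (at t)"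
  proof (intro DERIV_cdivide DERIV_diff P')
    have "((\<lambda>t'. t' - w) has_real_derivative 1) (at t)" by (auto intro!: derivative_eq_intros)
    from DERIV_chain2[OF P' this] show "((\<lambda>t'. P (t' - w)) has_real_derivative u (t - w)) (at t)"
      using w by simp
  qed (use w in simp)
  then show ?thesis
    by (rule has_field_derivative_transform_within_open[where S = "{t - 1<..<t + 1}"]) (use eq in auto)
qed

text \<open>
  The averages of widths \<open>w m, \<dots>, w (m + n - 1)\<close>, applied to \<open>u\<close> from the last width to the first.
  Keeping the first index \<open>m\<close> as a parameter gives a limit for every tail of the width sequence.
\<close>
fun iter_avg :: "(nat \<Rightarrow> real) \<Rightarrow> (real \<Rightarrow> real) \<Rightarrow> nat \<Rightarrow> nat \<Rightarrow> real \<Rightarrow> real" where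
  "iter_avg w u 0 m = u"
| "iter_avg w u (Suc n) m = run_avg (w m) (iter_avg w u n (Suc m))"

fun iter_quot :: "(nat \<Rightarrow> real) \<Rightarrow> nat \<Rightarrow> (real \<Rightarrow> real) \<Rightarrow> real \<Rightarrow> real" where
  "iter_quot w 0 u = u"
| "iter_quot w (Suc j) u = iter_quot w j (\<lambda>t. (u t - u (t - w j)) / w j)"

lemma iter_quot_derivative:
  assumes "\<And>t. (u has_real_derivative u' t) (at t)"
  shows "(iter_quot w j u has_real_derivative iter_quot w j u' t) (at t)"
  using assms
proof (induction j arbitrary: u u')
  case (Suc j)
  have "((\<lambda>t. (u t - u (t - w j)) / w j) has_real_derivative (u' t - u' (t - w j)) / w j) (at t)" for t
  proof -
    have "((\<lambda>t. t - w j) has_real_derivative 1) (at t)" by (auto intro!: derivative_eq_intros)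
    from DERIV_chain2[OF Suc.prems this]
    have "((\<lambda>t. u (t - w j)) has_real_derivative u' (t - w j)) (at t)" by simp
    then show ?thesis by (intro DERIV_cdivide DERIV_diff Suc.prems)
  qed
  then show ?case using Suc.IH by simp
qed simp

lemma iter_quot_bound:
  assumes "\<And>t. \<bar>u t\<bar> \<le> B" "\<And>i. 0 < w i"
  shows "\<bar>iter_quot w j u t\<bar> \<le> B * (\<Prod>i<j. 2 / w i)"
  using assms(1)
proof (induction j arbitrary: u B)
  case (Suc j)
  have "\<bar>(u t - u (t - w j)) / w j\<bar> \<le> B * (2 / w j)" for t
  proof -
    have "\<bar>u t - u (t - w j)\<bar> \<le> 2 * B" using Suc.prems[of t] Suc.prems[of "t - w j"] by linarith
    then show ?thesis using assms(2)[of j] by (simp add: field_simps abs_mult)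
  qed
  from Suc.IH[OF this] show ?case by (simp add: mult_ac)
qed simp

text \<open>
  Let \<open>U m\<close> be the limit of all averages of widths \<open>w m, w (m + 1), \<dots>\<close>, applied to a ramp with
  Lipschitz constant \<open>L\<close>.  It exists because averages keep the Lipschitz constant and an average of
  width \<open>w\<close> moves such a function by at most \<open>L w\<close>, which is summable.  Then \<open>U m\<close> is the average of
  \<open>U (m + 1)\<close>, so each derivative of \<open>U 0\<close> replaces one average by a difference quotient: the
  derivative of order \<open>j\<close> consists of \<open>j\<close> difference quotients applied to the bounded function \<open>U j\<close>.
\<close>
theorem smooth_step_exists:
  fixes w :: "nat \<Rightarrow> real"
  assumes w: "\<And>i. 0 < w i" "summable w" and d: "0 < d" "suminf w \<le> d / 2"
  shows "\<exists>F :: nat \<Rightarrow> real \<Rightarrow> real. (\<forall>j t. (F j has_real_derivative F (Suc j) t) (at t)) \<and>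
    (\<forall>j t. \<bar>F j t\<bar> \<le> (\<Prod>i<j. 2 / w i)) \<and> (\<forall>t\<le>0. F 0 t = 1) \<and> (\<forall>t\<ge>d. F 0 t = 0)"
proof -
  define L where "L = 2 / d"
  \<comment> \<open>The ramp falls on \<open>{0..d / 2}\<close>; the averages use up at most another \<open>d / 2\<close> to its right.\<close>
  define u :: "real \<Rightarrow> real" where "u = (\<lambda>t. max 0 (min 1 (1 - L * t)))"
  define G where "G = iter_avg w u"
  have L: "0 < L" using d by (simp add: L_def)
  have uL: "\<bar>u s - u t\<bar> \<le> L * \<bar>s - t\<bar>" for s t
  proof -
    have "\<bar>u s - u t\<bar> \<le> \<bar>(1 - L * s) - (1 - L * t)\<bar>" by (auto simp: u_def)
    also have "\<dots> = \<bar>L * (t - s)\<bar>" by (simp add: right_diff_distrib)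
    also have "\<dots> = L * \<bar>s - t\<bar>" using L by (simp add: abs_mult)
    finally show ?thesis .
  qed
  have lip_cont: "continuous_on UNIV f" if "\<And>s t. \<bar>f s - f t\<bar> \<le> L * \<bar>s - t\<bar>" for f :: "real \<Rightarrow> real"
  proof -
    have "L-lipschitz_on UNIV f" using that L by (intro lipschitz_onI) (auto simp: dist_real_def)
    then show ?thesis by (rule lipschitz_on_continuous_on)
  qed
  have GL: "\<bar>G n m s - G n m t\<bar> \<le> L * \<bar>s - t\<bar>" for n m s t
  proof (induction n arbitrary: m s t)
    case (Suc n)
    then have c: "continuous_on UNIV (G n (Suc m))" by (intro lip_cont)
    have "\<bar>run_avg (w m) (G n (Suc m)) s - run_avg (w m) (G n (Suc m)) t\<bar> \<le> L * \<bar>s - t\<bar>"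
    proof (rule run_avg_diff_le[OF c c])
      show "\<bar>G n (Suc m) (s - w m * s') - G n (Suc m) (t - w m * s')\<bar> \<le> L * \<bar>s - t\<bar>" for s'
        using Suc[of "Suc m" "s - w m * s'" "t - w m * s'"] by simp
    qed
    then show ?case by (simp add: G_def)
  qed (simp add: G_def uL)
  have Gc: "continuous_on UNIV (G n m)" for n m using GL by (rule lip_cont)
  have G_step: "\<bar>G (Suc n) m t - G n m t\<bar> \<le> L * w (m + n)" for n m t
  proof (induction n arbitrary: m t)
    case 0
    have "\<bar>run_avg (w m) u t - run_avg (w m) (\<lambda>_. u t) t\<bar> \<le> L * w m"
    proof (rule run_avg_diff_le)
      fix s :: real assume s: "0 \<le> s" "s \<le> 1"
      have "\<bar>u (t - w m * s) - u t\<bar> \<le> L * (w m * s)"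
        using uL[of "t - w m * s" t] s w(1)[of m] by (simp add: abs_mult)
      also have "\<dots> \<le> L * (w m * 1)" using s L w(1)[of m] by (intro mult_left_mono) auto
      finally show "\<bar>u (t - w m * s) - u t\<bar> \<le> L * w m" by simp
    qed (use lip_cont[OF uL] in auto)
    then show ?case by (simp add: G_def run_avg_const)
  next
    case (Suc n)
    have "\<bar>run_avg (w m) (G (Suc n) (Suc m)) t - run_avg (w m) (G n (Suc m)) t\<bar> \<le> L * w (m + Suc n)"
      by (intro run_avg_diff_le Gc) (use Suc[of "Suc m"] in auto)
    then show ?case by (simp add: G_def)
  qed
  have G01: "0 \<le> G n m t \<and> G n m t \<le> 1" for n m t
  proof (induction n arbitrary: m t)
    case (Suc n)
    have "\<bar>run_avg (w m) (G n (Suc m)) t - run_avg (w m) (\<lambda>_. 1/2) t\<bar> \<le> 1/2"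
    proof (intro run_avg_diff_le Gc)
      show "\<bar>G n (Suc m) (t - w m * s) - 1 / 2\<bar> \<le> 1/2" for s
        using Suc[of "Suc m" "t - w m * s"] by (auto simp: abs_le_iff field_simps)
    qed auto
    then have "\<bar>G (Suc n) m t - 1/2\<bar> \<le> 1/2" by (simp only: G_def iter_avg.simps run_avg_const)
    then show ?case by arith
  qed (auto simp: G_def u_def)
  have G1: "G n m t = 1" if "t \<le> 0" for n m t
    using that
  proof (induction n arbitrary: m t)
    case (Suc n)
    have "\<bar>run_avg (w m) (G n (Suc m)) t - run_avg (w m) (\<lambda>_. 1) t\<bar> \<le> 0"
    proof (intro run_avg_diff_le Gc)
      fix s :: real assume s: "0 \<le> s" "s \<le> 1"
      then have "0 \<le> w m * s" using w(1)[of m] by simp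
      then have "t - w m * s \<le> 0" using Suc.prems by linarith
      then show "\<bar>G n (Suc m) (t - w m * s) - 1\<bar> \<le> 0" using Suc.IH by simp
    qed auto
    then show ?case by (simp add: G_def run_avg_const)
  next
    case 0
    then have "L * t \<le> 0" using L by (simp add: mult_le_0_iff)
    then show ?case by (simp add: G_def u_def)
  qed
  have G0: "G n m t = 0" if "d / 2 + (\<Sum>i<n. w (m + i)) \<le> t" for n m t
    using that
  proof (induction n arbitrary: m t)
    case (Suc n)
    have "\<bar>run_avg (w m) (G n (Suc m)) t - run_avg (w m) (\<lambda>_. 0) t\<bar> \<le> 0"
    proof (intro run_avg_diff_le Gc)
      fix s :: real assume s: "0 \<le> s" "s \<le> 1"
      then have "w m * s \<le> w m" using w(1)[of m] by (simp add: mult_left_le)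
      moreover have "(\<Sum>i<Suc n. w (m + i)) = w m + (\<Sum>i<n. w (Suc m + i))"
        by (subst sum.lessThan_Suc_shift) simp
      ultimately have "d / 2 + (\<Sum>i<n. w (Suc m + i)) \<le> t - w m * s" using Suc.prems by linarith
      from Suc.IH[OF this] show "\<bar>G n (Suc m) (t - w m * s) - 0\<bar> \<le> 0" by simp
    qed auto
    then show ?case by (simp add: G_def run_avg_const)
  next
    case 0
    then have "1 \<le> L * t" using d by (simp add: L_def field_simps)
    then show ?case by (simp add: G_def u_def)
  qed
  have conv: "convergent (\<lambda>n. G n m t)" for m t
  proof -
    have "summable (\<lambda>n. L * w (m + n))"
      using w(2) by (intro summable_mult) (subst add.commute, simp only: summable_iff_shift)
    then have "summable (\<lambda>n. G (Suc n) m t - G n m t)"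
      by (rule summable_comparison_test'[where N = 0]) (use G_step in auto)
    then have "convergent (\<lambda>n. \<Sum>i<n. G (Suc i) m t - G i m t)" by (simp add: summable_iff_convergent)
    then have "convergent (\<lambda>n. G n m t - G 0 m t)" by (simp only: sum_lessThan_telescope[of "\<lambda>i. G i m t"])
    from convergent_add[OF this convergent_const[of "G 0 m t"]] show ?thesis by simp
  qed
  define U where "U = (\<lambda>m t. lim (\<lambda>n. G n m t))"
  have lim: "(\<lambda>n. G n m t) \<longlonglongrightarrow> U m t" for m t
    using conv by (simp add: U_def convergent_LIMSEQ_iff)
  have U01: "0 \<le> U m t" "U m t \<le> 1" for m t
    by (rule LIMSEQ_le_const[OF lim], use G01 in blast) (rule LIMSEQ_le_const2[OF lim], use G01 in blast)
  have UL: "\<bar>U m s - U m t\<bar> \<le> L * \<bar>s - t\<bar>" for m s t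
  proof -
    have "(\<lambda>n. \<bar>G n m s - G n m t\<bar>) \<longlonglongrightarrow> \<bar>U m s - U m t\<bar>" by (intro tendsto_intros lim)
    then show ?thesis by (rule LIMSEQ_le_const2) (use GL in auto)
  qed
  have Uc: "continuous_on UNIV (U m)" for m using UL by (rule lip_cont)
  have U_avg: "U m t = run_avg (w m) (U (Suc m)) t" for m t
  proof -
    have "(\<lambda>n. integral {0..1} (\<lambda>s. G n (Suc m) (t - w m * s))) \<longlonglongrightarrow>
        integral {0..1} (\<lambda>s. U (Suc m) (t - w m * s))"
    proof (rule dominated_convergence(2)[where h = "\<lambda>_. 1"])
      show "(\<lambda>s. G n (Suc m) (t - w m * s)) integrable_on {0..1}" for n
        by (intro integrable_continuous_interval continuous_along Gc)
      show "norm (G n (Suc m) (t - w m * s)) \<le> 1" for n s using G01[of n "Suc m" "t - w m * s"] by simp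
    qed (use lim in auto)
    then have "(\<lambda>n. G (Suc n) m t) \<longlonglongrightarrow> run_avg (w m) (U (Suc m)) t"
      by (simp add: G_def run_avg_def)
    moreover have "(\<lambda>n. G (Suc n) m t) \<longlonglongrightarrow> U m t" using lim by (rule LIMSEQ_Suc)
    ultimately show ?thesis by (rule LIMSEQ_unique[rotated])
  qed
  have U_der: "(U m has_real_derivative (U (Suc m) t - U (Suc m) (t - w m)) / w m) (at t)" for m t
  proof -
    have "U m = run_avg (w m) (U (Suc m))" using U_avg by (intro ext)
    then show ?thesis using run_avg_derivative[OF Uc w(1)] by simp
  qed
  show ?thesis
  proof (intro exI[of _ "\<lambda>j. iter_quot w j (U j)"] conjI allI impI)
    show "(iter_quot w j (U j) has_real_derivative iter_quot w (Suc j) (U (Suc j)) t) (at t)" for j t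
      using iter_quot_derivative[OF U_der[of j]] by simp
    show "\<bar>iter_quot w j (U j) t\<bar> \<le> (\<Prod>i<j. 2 / w i)" for j t
    proof -
      have "\<bar>U j s\<bar> \<le> 1" for s using U01[of j s] by simp
      from iter_quot_bound[OF this w(1)] show ?thesis by simp
    qed
    show "iter_quot w 0 (U 0) t = 1" if "t \<le> 0" for t
    proof -
      have "(\<lambda>n. G n 0 t) = (\<lambda>n. 1)" using G1[OF that] by simp
      then show ?thesis using lim[of 0 t] by (simp add: LIMSEQ_const_iff)
    qed
    show "iter_quot w 0 (U 0) t = 0" if t: "d \<le> t" for t
    proof -
      have "G n 0 t = 0" for n
      proof (rule G0)
        have "(\<Sum>i<n. w (0 + i)) \<le> suminf w"
          using sum_le_suminf[of w "{..<n}"] w by (simp add: less_imp_le)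
        then show "d / 2 + (\<Sum>i<n. w (0 + i)) \<le> t" using d t by linarith
      qed
      then have "(\<lambda>n. G n 0 t) = (\<lambda>n. 0)" by simp
      then show ?thesis using lim[of 0 t] by (simp add: LIMSEQ_const_iff)
    qed
  qed
qed

section \<open>The Gumbel kernel as an approximate identity\<close>

lemma lipschitz_of_vector_derivative:
  fixes f :: "real \<Rightarrow> 'b::real_normed_vector"
  assumes "\<And>t. (f has_vector_derivative f' t) (at t)" "\<And>t. norm (f' t) \<le> B"
  shows "norm (f u - f v) \<le> B * \<bar>u - v\<bar>"
proof -
  have "norm (f u - f v) \<le> B * norm (u - v)"
  proof (rule differentiable_bound[of UNIV f "\<lambda>t h. h *\<^sub>R f' t"])
    show "onorm (\<lambda>h. h *\<^sub>R f' t) \<le> B" for t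
      using assms(2)[of t] by (intro onorm_le) (simp add: mult.commute[of B] mult_left_mono)
  qed (use assms(1) in \<open>auto simp: has_vector_derivative_def\<close>)
  then show ?thesis by simp
qed

text \<open>
  The derivative of \<open>exp (- exp (n * (s - \<tau>)))\<close> up to sign: a Gumbel density concentrated near
  \<open>s = \<tau>\<close> for large \<open>n\<close>.
\<close>
definition gumbel :: "real \<Rightarrow> real \<Rightarrow> real \<Rightarrow> real" where
  "gumbel n \<tau> s = n * exp (n * (s - \<tau>)) * exp (- exp (n * (s - \<tau>)))"

text \<open>
  Expanding the factor \<open>exp (- exp (n * (s - \<tau>)))\<close> into the exponential series turns the kernel into
  a combination of exponentials in \<open>s\<close>; these are the partial sums, with exponents \<open>n, 2 n, \<dots>, N n\<close>.
\<close>
definition gumbel_sum :: "real \<Rightarrow> real \<Rightarrow> nat \<Rightarrow> real \<Rightarrow> real" where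
  "gumbel_sum n \<tau> N s = (\<Sum>k<N. n * (- 1) ^ k / fact k * exp (real (Suc k) * n * (s - \<tau>)))"

lemma gumbel_sum_eq:
  "gumbel_sum n \<tau> N s = n * exp (n * (s - \<tau>)) * (\<Sum>k<N. (- exp (n * (s - \<tau>))) ^ k / fact k)"
proof -
  let ?X = "exp (n * (s - \<tau>))"
  have "exp (real (Suc k) * n * (s - \<tau>)) = ?X * ?X ^ k" for k
    using exp_of_nat_mult[of "Suc k" "n * (s - \<tau>)"] by (simp add: mult.assoc)
  moreover have "(- ?X) ^ k = (- 1) ^ k * ?X ^ k" for k by (rule power_minus)
  ultimately show ?thesis unfolding gumbel_sum_def sum_distrib_left
    by (intro sum.cong refl) simp
qed

lemma gumbel_sum_uniform:
  assumes "0 < n" "0 < e"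
  obtains N where "\<And>s. \<bar>s\<bar> \<le> R \<Longrightarrow> \<bar>gumbel_sum n \<tau> N s - gumbel n \<tau> s\<bar> \<le> e"
proof -
  define X where "X = exp (n * (R + \<bar>\<tau>\<bar>))"
  have "(\<lambda>N. n * X * exp X * (X ^ N /\<^sub>R fact N)) \<longlonglongrightarrow> n * X * exp X * 0"
    by (intro tendsto_intros summable_LIMSEQ_zero summable_exp_generic)
  then have "\<forall>\<^sub>F N in sequentially. n * X * exp X * (X ^ N /\<^sub>R fact N) < e"
    using assms(2) by (intro order_tendstoD) auto
  then obtain N where N: "n * X * exp X * (X ^ N /\<^sub>R fact N) < e"
    by (auto simp: eventually_sequentially)
  have "\<bar>gumbel_sum n \<tau> N s - gumbel n \<tau> s\<bar> \<le> e" if s: "\<bar>s\<bar> \<le> R" for s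
  proof -
    let ?x = "exp (n * (s - \<tau>))"
    have xX: "?x \<le> X" using s assms(1) by (simp add: X_def)
    obtain t where t: "\<bar>t\<bar> \<le> \<bar>- ?x\<bar>" "exp (- ?x) = (\<Sum>m<N. (- ?x) ^ m / fact m) + exp t / fact N * (- ?x) ^ N"
      using Maclaurin_exp_le[of "- ?x" N] by blast
    have tX: "exp t \<le> exp X" using t(1) xX by simp
    have "gumbel n \<tau> s - gumbel_sum n \<tau> N s = n * ?x * (exp (- ?x) - (\<Sum>k<N. (- ?x) ^ k / fact k))"
      unfolding gumbel_sum_eq gumbel_def by (simp add: right_diff_distrib)
    also have "\<dots> = n * ?x * (exp t / fact N * (- ?x) ^ N)" using t(2) by simp
    finally have "\<bar>gumbel_sum n \<tau> N s - gumbel n \<tau> s\<bar> = n * ?x * (exp t / fact N * ?x ^ N)"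
      using assms(1) by (simp add: abs_minus_commute[of "gumbel_sum n \<tau> N s"] abs_mult power_abs)
    also have "\<dots> \<le> n * X * (exp X / fact N * X ^ N)"
      using assms(1) by (intro mult_mono divide_right_mono power_mono tX xX) (auto simp: X_def)
    also have "\<dots> = n * X * exp X * (X ^ N /\<^sub>R fact N)" by (simp add: divide_inverse)
    also have "\<dots> \<le> e" using N by simp
    finally show ?thesis .
  qed
  then show thesis using that by blast
qed

lemma gumbel_nonneg: "0 < n \<Longrightarrow> 0 \<le> gumbel n \<tau> s"
  by (simp add: gumbel_def)

lemma gumbel_integral:
  assumes "B \<ge> 0"
  shows "((\<lambda>u. gumbel n \<tau> (t - u)) has_integral
     (exp (- exp (n * (t - B - \<tau>))) - exp (- exp (n * (t + B - \<tau>))))) {-B..B}"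
proof -
  have "((\<lambda>u. gumbel n \<tau> (t - u)) has_integral
     (exp (- exp (n * (t - B - \<tau>))) - exp (- exp (n * (t - (-B) - \<tau>))))) {-B..B}"
  proof (rule fundamental_theorem_of_calculus)
    fix u
    have "((\<lambda>u. exp (- exp (n * (t - u - \<tau>)))) has_real_derivative gumbel n \<tau> (t - u)) (at u within {-B..B})"
      unfolding gumbel_def by (auto intro!: derivative_eq_intros)
    then show "((\<lambda>u. exp (- exp (n * (t - u - \<tau>)))) has_vector_derivative gumbel n \<tau> (t - u)) (at u within {-B..B})"
      by (simp add: has_real_derivative_iff_has_vector_derivative)
  qed (use assms in auto)
  then show ?thesis by simp
qed

text \<open>
  Left of 0 the factor \<open>exp (n * (s - \<tau>))\<close> is small; right of \<open>2 * \<tau>\<close> it is a large number \<open>X\<close> and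
  \<open>X * exp (- X) \<le> 2 / X\<close>.
\<close>
lemma gumbel_small:
  assumes "0 < n" "0 < \<tau>" "s < 0 \<or> 2 * \<tau> < s"
  shows "gumbel n \<tau> s \<le> 2 * n * exp (- n * \<tau>)"
  using assms(3)
proof
  assume s: "s < 0"
  have "exp (n * (s - \<tau>)) * exp (- exp (n * (s - \<tau>))) \<le> exp (- n * \<tau>) * 1"
    using s assms by (intro mult_mono) (auto simp: right_diff_distrib mult_le_0_iff)
  also have "\<dots> \<le> 2 * exp (- n * \<tau>)" by simp
  finally have "n * (exp (n * (s - \<tau>)) * exp (- exp (n * (s - \<tau>)))) \<le> n * (2 * exp (- n * \<tau>))"
    using assms by (intro mult_left_mono) auto
  then show ?thesis by (simp add: gumbel_def mult_ac)
next
  assume s: "2 * \<tau> < s"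
  define X where "X = exp (n * (s - \<tau>))"
  have X: "0 < X" by (simp add: X_def)
  have "X ^ 2 / 2 \<le> exp X" using exp_lower_Taylor_quadratic[of X] X by simp
  then have "X * exp (- X) \<le> 2 / X" using X by (simp add: exp_minus field_simps power2_eq_square)
  also have "2 / X = 2 * exp (- (n * (s - \<tau>)))" by (simp add: X_def exp_minus divide_inverse)
  also have "\<dots> \<le> 2 * exp (- n * \<tau>)" using s assms by simp
  finally have "n * (X * exp (- X)) \<le> n * (2 * exp (- n * \<tau>))" using assms by (intro mult_left_mono) auto
  then show ?thesis by (simp add: gumbel_def X_def mult_ac)
qed

text \<open>
  The kernel has almost all of its mass in \<open>{0..2 * \<tau>}\<close>, where \<open>F (t - s)\<close> differs from \<open>F t\<close> by at most
  \<open>2 * \<tau> * A2\<close>.  The explicit dependence on \<open>A1\<close> and \<open>A2\<close> matters: it is applied to all derivatives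
  of one function at once.
\<close>
lemma gumbel_approx_identity:
  fixes F :: "real \<Rightarrow> complex"
  assumes n: "0 < n" and \<tau>: "0 < \<tau>" "\<tau> \<le> 1" and F: "continuous_on UNIV F"
    and A1: "\<And>u. norm (F u) \<le> A1" and A2: "\<And>u v. norm (F u - F v) \<le> A2 * \<bar>u - v\<bar>"
    and t: "\<bar>t\<bar> \<le> K" and B: "K + 2 \<le> B"
  shows "norm (integral {-B..B} (\<lambda>u. of_real (gumbel n \<tau> (t - u)) * F u) - F t)
     \<le> 2 * A1 * exp (- n) + A2 * (2 * \<tau> + 8 * B\<^sup>2 * n * exp (- n * \<tau>))"
proof -
  define g where "g = (\<lambda>u. gumbel n \<tau> (t - u))"
  define I where "I = exp (- exp (n * (t - B - \<tau>))) - exp (- exp (n * (t + B - \<tau>)))"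
  have B0: "0 \<le> B" using t B by linarith
  have A20: "0 \<le> A2" using order_trans[OF norm_ge_zero A2[of 0 1]] by simp
  have A10: "0 \<le> A1" using A1[of 0] norm_ge_zero[of "F 0"] by linarith
  have gI: "(g has_integral I) {-B..B}" unfolding g_def I_def by (rule gumbel_integral[OF B0])
  have gc: "continuous_on S g" for S unfolding g_def gumbel_def by (intro continuous_intros)
  have g0: "0 \<le> g u" for u using gumbel_nonneg[OF n] by (simp add: g_def)
  have I1: "I \<le> 1" unfolding I_def
    using exp_gt_zero[of "- exp (n * (t + B - \<tau>))"] by (smt (verit) exp_gt_zero one_le_exp_iff exp_less_one_iff)
  have I2: "1 - I \<le> 2 * exp (- n)"
  proof -
    have a: "1 - exp (n * (t - B - \<tau>)) \<le> exp (- exp (n * (t - B - \<tau>)))"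
      using exp_ge_add_one_self[of "- exp (n * (t - B - \<tau>))"] by simp
    have "t - B - \<tau> \<le> - 1" using t B \<tau> by linarith
    then have "n * (t - B - \<tau>) \<le> n * (- 1)" using n by (intro mult_left_mono) auto
    then have b: "exp (n * (t - B - \<tau>)) \<le> exp (- n)" by simp
    have "1 \<le> t + B - \<tau>" using t B \<tau> by linarith
    then have "n * 1 \<le> n * (t + B - \<tau>)" using n by (intro mult_left_mono) auto
    also have "\<dots> \<le> exp (n * (t + B - \<tau>))" using exp_ge_add_one_self[of "n * (t + B - \<tau>)"] by linarith
    finally have d: "exp (- exp (n * (t + B - \<tau>))) \<le> exp (- n)" by simp
    show ?thesis using a b d unfolding I_def by linarith
  qed
  have cF: "continuous_on S F" for S using F continuous_on_subset by blast
  have int: "((\<lambda>u. of_real (g u) * F u) has_integral integral {-B..B} (\<lambda>u. of_real (g u) * F u)) {-B..B}"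
    by (intro integrable_integral integrable_continuous_interval continuous_intros cF gc)
  have "((\<lambda>u. of_real (g u) * F t) has_integral of_real I * F t) {-B..B}"
    using has_integral_scaleR_left[OF gI, of "F t"] by (simp add: scaleR_conv_of_real)
  then have diff: "((\<lambda>u. of_real (g u) * (F u - F t)) has_integral
      (integral {-B..B} (\<lambda>u. of_real (g u) * F u) - of_real I * F t)) {-B..B}"
    using has_integral_diff[OF int] by (simp add: right_diff_distrib)
  define \<epsilon> where "\<epsilon> = 2 * n * exp (- n * \<tau>)"
  have e0: "0 \<le> \<epsilon>" using n by (simp add: \<epsilon>_def)
  have "norm (integral {-B..B} (\<lambda>u. of_real (g u) * (F u - F t)))
      \<le> integral {-B..B} (\<lambda>u. A2 * (2 * \<tau> * g u + 2 * B * \<epsilon>))"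
  proof (rule Henstock_Kurzweil_Integration.integral_norm_bound_integral)
    show "(\<lambda>u. of_real (g u) * (F u - F t)) integrable_on {-B..B}" using diff by blast
    show "(\<lambda>u. A2 * (2 * \<tau> * g u + 2 * B * \<epsilon>)) integrable_on {-B..B}"
      by (intro integrable_continuous_interval continuous_intros gc)
    fix u assume u: "u \<in> {-B..B}"
    \<comment> \<open>This bound holds on the whole interval, so that the integral need not be split.\<close>
    have "g u * \<bar>u - t\<bar> \<le> 2 * \<tau> * g u + 2 * B * \<epsilon>"
    proof (cases "t - u < 0 \<or> 2 * \<tau> < t - u")
      case True
      have "g u \<le> \<epsilon>" unfolding g_def \<epsilon>_def by (rule gumbel_small[OF n \<tau>(1) True])
      moreover have "\<bar>u - t\<bar> \<le> 2 * B" using u t B by auto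
      ultimately have "g u * \<bar>u - t\<bar> \<le> \<epsilon> * (2 * B)" using g0[of u] e0 by (intro mult_mono) auto
      moreover have "0 \<le> 2 * \<tau> * g u" using g0[of u] \<tau> by simp
      ultimately show ?thesis by (simp add: mult_ac)
    next
      case False
      then have "g u * \<bar>u - t\<bar> \<le> g u * (2 * \<tau>)" using g0[of u] by (intro mult_left_mono) auto
      moreover have "0 \<le> 2 * B * \<epsilon>" using B0 e0 by simp
      ultimately show ?thesis by (simp add: mult_ac)
    qed
    then have "A2 * (g u * \<bar>u - t\<bar>) \<le> A2 * (2 * \<tau> * g u + 2 * B * \<epsilon>)" using A20 by (rule mult_left_mono)
    moreover have "g u * norm (F u - F t) \<le> g u * (A2 * \<bar>u - t\<bar>)"
      using g0 by (intro mult_left_mono A2)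
    ultimately show "norm (of_real (g u) * (F u - F t)) \<le> A2 * (2 * \<tau> * g u + 2 * B * \<epsilon>)"
      using g0[of u] by (simp add: norm_mult mult_ac)
  qed
  also have "integral {-B..B} (\<lambda>u. A2 * (2 * \<tau> * g u + 2 * B * \<epsilon>)) = A2 * (2 * \<tau> * I + 2 * B * (2 * B * \<epsilon>))"
  proof (rule integral_unique)
    have "((\<lambda>u. 2 * B * \<epsilon>) has_integral (2 * B * \<epsilon>) * (B - (- B))) {-B..B}"
      using has_integral_const_real[of "2 * B * \<epsilon>" "-B" B] B0 by (simp add: mult_ac)
    then have "((\<lambda>u. A2 * (2 * \<tau> * g u + 2 * B * \<epsilon>)) has_integral
        A2 * (2 * \<tau> * I + (2 * B * \<epsilon>) * (B - (- B)))) {-B..B}"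
      by (intro has_integral_mult_right has_integral_add gI)
    then show "((\<lambda>u. A2 * (2 * \<tau> * g u + 2 * B * \<epsilon>)) has_integral
        A2 * (2 * \<tau> * I + 2 * B * (2 * B * \<epsilon>))) {-B..B}" by (simp add: algebra_simps)
  qed
  also have "\<dots> \<le> A2 * (2 * \<tau> * 1 + 2 * B * (2 * B * \<epsilon>))"
    using I1 \<tau> A20 B0 e0 by (intro mult_left_mono add_mono) auto
  finally have 1: "norm (integral {-B..B} (\<lambda>u. of_real (g u) * F u) - of_real I * F t)
      \<le> A2 * (2 * \<tau> + 4 * B\<^sup>2 * \<epsilon>)"
    using diff by (simp add: integral_unique power2_eq_square algebra_simps)
  have "of_real I * F t - F t = - (of_real (1 - I) * F t)" by (simp add: algebra_simps)
  then have "norm (of_real I * F t - F t) = (1 - I) * norm (F t)"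
    using I1 by (simp add: norm_mult norm_minus_cancel del: of_real_diff)
  also have "\<dots> \<le> (2 * exp (- n)) * A1" using I1 I2 A1[of t] by (intro mult_mono) auto
  finally have 2: "norm (of_real I * F t - F t) \<le> 2 * A1 * exp (- n)" by (simp add: mult_ac)
  have "norm (integral {-B..B} (\<lambda>u. of_real (g u) * F u) - F t)
      \<le> norm (integral {-B..B} (\<lambda>u. of_real (g u) * F u) - of_real I * F t) + norm (of_real I * F t - F t)"
    using norm_triangle_ineq[of "integral {-B..B} (\<lambda>u. of_real (g u) * F u) - of_real I * F t"
        "of_real I * F t - F t"] by simp
  also have "\<dots> \<le> A2 * (2 * \<tau> + 4 * B\<^sup>2 * \<epsilon>) + 2 * A1 * exp (- n)" using 1 2 by linarith
  finally show ?thesis by (simp add: g_def \<epsilon>_def algebra_simps)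
qed

text \<open>
  The number of terms depends on the kernel and on the size of the interval alone, hence serves all
  functions \<open>F\<close> simultaneously.
\<close>
lemma gumbel_sum_approx_identity:
  fixes K B :: real
  assumes n: "0 < n" and \<tau>: "0 < \<tau>" "\<tau> \<le> 1" and K: "0 \<le> K" and B: "K + 2 \<le> B" and e: "0 < e"
  shows "\<exists>N. \<forall>F A1 A2 t. continuous_on UNIV F \<longrightarrow> (\<forall>u. norm (F u) \<le> A1) \<longrightarrow>
    (\<forall>u v. norm (F u - F v) \<le> A2 * \<bar>u - v\<bar>) \<longrightarrow> \<bar>t\<bar> \<le> K \<longrightarrow>
    norm (integral {-B..B} (\<lambda>u. of_real (gumbel_sum n \<tau> N (t - u)) * F u) - (F t :: complex))
     \<le> A1 * (2 * B * e + 2 * exp (- n)) + A2 * (2 * \<tau> + 8 * B\<^sup>2 * n * exp (- n * \<tau>))"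
proof -
  obtain N where N: "\<And>s. \<bar>s\<bar> \<le> 2 * B \<Longrightarrow> \<bar>gumbel_sum n \<tau> N s - gumbel n \<tau> s\<bar> \<le> e"
    using gumbel_sum_uniform[OF n e] by metis
  have "norm (integral {-B..B} (\<lambda>u. of_real (gumbel_sum n \<tau> N (t - u)) * F u) - F t)
     \<le> A1 * (2 * B * e + 2 * exp (- n)) + A2 * (2 * \<tau> + 8 * B\<^sup>2 * n * exp (- n * \<tau>))"
    if F: "continuous_on UNIV F" and A1: "\<forall>u. norm (F u) \<le> A1"
      and A2: "\<forall>u v. norm (F u - F v) \<le> A2 * \<bar>u - v\<bar>" and t: "\<bar>t\<bar> \<le> K"
    for F :: "real \<Rightarrow> complex" and A1 A2 t
  proof -
    let ?f = "\<lambda>u. of_real (gumbel_sum n \<tau> N (t - u)) * F u"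
    let ?g = "\<lambda>u. of_real (gumbel n \<tau> (t - u)) * F u"
    have cF: "continuous_on S F" for S using F continuous_on_subset by blast
    have cf: "continuous_on {-B..B} ?f" unfolding gumbel_sum_def by (intro continuous_intros cF) auto
    have cg: "continuous_on {-B..B} ?g" unfolding gumbel_def by (intro continuous_intros cF)
    have A10: "0 \<le> A1" using A1 norm_ge_zero order_trans by blast
    have "integral {-B..B} ?f - integral {-B..B} ?g = integral {-B..B} (\<lambda>u. ?f u - ?g u)"
      using cf cg by (intro integral_diff[symmetric] integrable_continuous_interval)
    also have "norm \<dots> \<le> (e * A1) * (B - (- B))"
    proof (rule integral_bound)
      fix u assume u: "u \<in> {-B..B}"
      have "?f u - ?g u = of_real (gumbel_sum n \<tau> N (t - u) - gumbel n \<tau> (t - u)) * F u"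
        by (simp add: algebra_simps)
      then have "norm (?f u - ?g u) = \<bar>gumbel_sum n \<tau> N (t - u) - gumbel n \<tau> (t - u)\<bar> * norm (F u)"
        by (simp only: norm_mult norm_of_real)
      also have "\<dots> \<le> e * A1" using N[of "t - u"] A1 e t u B by (intro mult_mono) auto
      finally show "norm (?f u - ?g u) \<le> e * A1" .
    qed (use cf cg K B in \<open>auto intro: continuous_on_diff\<close>)
    finally have 1: "norm (integral {-B..B} ?f - integral {-B..B} ?g) \<le> (e * A1) * (B - (- B))" .
    have 2: "norm (integral {-B..B} ?g - F t)
        \<le> 2 * A1 * exp (- n) + A2 * (2 * \<tau> + 8 * B\<^sup>2 * n * exp (- n * \<tau>))"
      by (rule gumbel_approx_identity[OF n \<tau> F _ _ t B]) (use A1 A2 in auto)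
    have "integral {-B..B} ?f - F t = (integral {-B..B} ?f - integral {-B..B} ?g) + (integral {-B..B} ?g - F t)"
      by simp
    then have "norm (integral {-B..B} ?f - F t)
        \<le> norm (integral {-B..B} ?f - integral {-B..B} ?g) + norm (integral {-B..B} ?g - F t)"
      by (simp only: norm_triangle_ineq)
    also have "\<dots> \<le> (e * A1) * (B - (- B)) + (2 * A1 * exp (- n) + A2 * (2 * \<tau> + 8 * B\<^sup>2 * n * exp (- n * \<tau>)))"
      using 1 2 by linarith
    finally show ?thesis by (simp add: algebra_simps)
  qed
  then show ?thesis by blast
qed

section \<open>Linear functionals separating a point from a subspace\<close>

text \<open>
  A complex Hahn-Banach theorem for a vector space of functions that need not be a whole type.
  The proof goes through minimal sublinear functionals: these are automatically real-linear, which
  avoids extending functionals from subspaces.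
\<close>
locale complex_function_space =
  fixes V :: "('x \<Rightarrow> complex) set"
  assumes V_add: "f \<in> V \<Longrightarrow> g \<in> V \<Longrightarrow> (\<lambda>x. f x + g x) \<in> V"
    and V_scale: "f \<in> V \<Longrightarrow> (\<lambda>x. \<alpha> * f x) \<in> V"
    and V_zero: "(\<lambda>x. 0) \<in> V"
begin

lemma V_minus: "f \<in> V \<Longrightarrow> (\<lambda>x. - f x) \<in> V"
  using V_scale[of f "- 1"] by simp

definition sublinear :: "(('x \<Rightarrow> complex) \<Rightarrow> real) \<Rightarrow> bool" where
  "sublinear q \<longleftrightarrow> (\<forall>f\<in>V. \<forall>g\<in>V. q (\<lambda>x. f x + g x) \<le> q f + q g) \<and>
     (\<forall>f\<in>V. \<forall>t>0. q (\<lambda>x. of_real t * f x) = t * q f) \<and> (\<forall>f. f \<notin> V \<longrightarrow> q f = 0)"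

lemma sublinear_add: "sublinear q \<Longrightarrow> f \<in> V \<Longrightarrow> g \<in> V \<Longrightarrow> q (\<lambda>x. f x + g x) \<le> q f + q g"
  and sublinear_scale: "sublinear q \<Longrightarrow> f \<in> V \<Longrightarrow> 0 < t \<Longrightarrow> q (\<lambda>x. of_real t * f x) = t * q f"
  and sublinear_outside: "sublinear q \<Longrightarrow> f \<notin> V \<Longrightarrow> q f = 0"
  by (simp_all add: sublinear_def)

lemma sublinear_zero: "sublinear q \<Longrightarrow> q (\<lambda>x. 0) = 0"
  using sublinear_scale[of q "\<lambda>x. 0" 2] V_zero by simp

lemma sublinear_minus:
  assumes "sublinear q" "f \<in> V"
  shows "- q (\<lambda>x. - f x) \<le> q f"
  using sublinear_add[OF assms V_minus[OF assms(2)]] sublinear_zero[OF assms(1)] by simp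

text \<open>
  A convex cone in the product of \<open>V\<close> and the reals that lies below the graph of \<open>q\<close>; its members
  \<open>(v, s)\<close> are the conditions \<open>s \<le> m v\<close> to be imposed on a linear \<open>m \<le> q\<close>.
\<close>
definition cone_below :: "(('x \<Rightarrow> complex) \<Rightarrow> real) \<Rightarrow> (('x \<Rightarrow> complex) \<times> real) set \<Rightarrow> bool" where
  "cone_below q K \<longleftrightarrow> ((\<lambda>x. 0), 0) \<in> K \<and> (\<forall>(v, s)\<in>K. v \<in> V \<and> s \<le> q v) \<and>
     (\<forall>(v, s)\<in>K. \<forall>(v', s')\<in>K. ((\<lambda>x. v x + v' x), s + s') \<in> K) \<and>
     (\<forall>(v, s)\<in>K. \<forall>t>0. ((\<lambda>x. of_real t * v x), t * s) \<in> K)"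

lemma cone_belowI:
  assumes "((\<lambda>x. 0), 0) \<in> K" "\<And>v s. (v, s) \<in> K \<Longrightarrow> v \<in> V" "\<And>v s. (v, s) \<in> K \<Longrightarrow> s \<le> q v"
    "\<And>v s v' s'. (v, s) \<in> K \<Longrightarrow> (v', s') \<in> K \<Longrightarrow> ((\<lambda>x. v x + v' x), s + s') \<in> K"
    "\<And>v s t. (v, s) \<in> K \<Longrightarrow> 0 < t \<Longrightarrow> ((\<lambda>x. of_real t * v x), t * s) \<in> K"
  shows "cone_below q K"
  unfolding cone_below_def using assms by auto

text \<open>
  The largest sublinear functional below \<open>q\<close> that takes a value of at most \<open>- s\<close> at \<open>- v\<close> for every
  member \<open>(v, s)\<close> of the cone.
\<close>
definition lower_along :: "(('x \<Rightarrow> complex) \<times> real) set \<Rightarrow> (('x \<Rightarrow> complex) \<Rightarrow> real) \<Rightarrow> ('x \<Rightarrow> complex) \<Rightarrow> real" where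
  "lower_along K q f = (if f \<in> V then INF z\<in>K. q (\<lambda>x. f x + fst z x) - snd z else 0)"

context
  fixes q K assumes q: "sublinear q" and K: "cone_below q K"
begin

lemma cone_below_rules:
  "((\<lambda>x. 0), 0) \<in> K" "z \<in> K \<Longrightarrow> fst z \<in> V" "z \<in> K \<Longrightarrow> snd z \<le> q (fst z)"
  "z \<in> K \<Longrightarrow> z' \<in> K \<Longrightarrow> ((\<lambda>x. fst z x + fst z' x), snd z + snd z') \<in> K"
  "z \<in> K \<Longrightarrow> 0 < t \<Longrightarrow> ((\<lambda>x. of_real t * fst z x), t * snd z) \<in> K"
  using K unfolding cone_below_def by (auto simp: case_prod_beta)

lemma lower_along_bdd:
  assumes f: "f \<in> V"
  shows "bdd_below ((\<lambda>z. q (\<lambda>x. f x + fst z x) - snd z) ` K)"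
proof (rule bdd_belowI2)
  fix z assume z: "z \<in> K"
  have "q (\<lambda>x. (f x + fst z x) + - f x) \<le> q (\<lambda>x. f x + fst z x) + q (\<lambda>x. - f x)"
    by (intro sublinear_add[OF q] V_add V_minus f cone_below_rules(2)[OF z])
  then show "- q (\<lambda>x. - f x) \<le> q (\<lambda>x. f x + fst z x) - snd z"
    using cone_below_rules(3)[OF z] by simp
qed

lemma lower_along_le:
  assumes "f \<in> V" "z \<in> K"
  shows "lower_along K q f \<le> q (\<lambda>x. f x + fst z x) - snd z"
  using assms lower_along_bdd by (auto simp: lower_along_def intro: cINF_lower)

lemma lower_along_ge:
  assumes "f \<in> V" "\<And>z. z \<in> K \<Longrightarrow> b \<le> q (\<lambda>x. f x + fst z x) - snd z"
  shows "b \<le> lower_along K q f"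
proof -
  have "K \<noteq> {}" using cone_below_rules(1) by auto
  then show ?thesis using assms by (auto simp: lower_along_def intro: cINF_greatest)
qed

lemma lower_along_le_self: "lower_along K q f \<le> q f"
proof (cases "f \<in> V")
  case True
  from lower_along_le[OF True cone_below_rules(1)] show ?thesis by simp
qed (simp add: lower_along_def sublinear_outside[OF q])

lemma lower_along_cone:
  assumes z: "z \<in> K"
  shows "lower_along K q (\<lambda>x. - fst z x) \<le> - snd z"
  using lower_along_le[OF V_minus[OF cone_below_rules(2)[OF z]] z] sublinear_zero[OF q] by simp

lemma lower_along_sublinear: "sublinear (lower_along K q)"
  unfolding sublinear_def
proof (intro conjI ballI allI impI)
  fix f g assume f: "f \<in> V" and g: "g \<in> V"
  note fg = V_add[OF f g]
  have 1: "lower_along K q (\<lambda>x. f x + g x) \<le> (q (\<lambda>x. f x + fst z x) - snd z) + (q (\<lambda>x. g x + fst z' x) - snd z')"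
    if z: "z \<in> K" "z' \<in> K" for z z'
  proof -
    have "lower_along K q (\<lambda>x. f x + g x) \<le> q (\<lambda>x. (f x + g x) + (fst z x + fst z' x)) - (snd z + snd z')"
      using lower_along_le[OF fg cone_below_rules(4)[OF z]] by simp
    also have "(\<lambda>x. (f x + g x) + (fst z x + fst z' x)) = (\<lambda>x. (f x + fst z x) + (g x + fst z' x))"
      by (simp add: algebra_simps)
    also have "q (\<lambda>x. (f x + fst z x) + (g x + fst z' x)) \<le> q (\<lambda>x. f x + fst z x) + q (\<lambda>x. g x + fst z' x)"
      by (intro sublinear_add[OF q] V_add f g cone_below_rules(2) z)
    finally show ?thesis by simp
  qed
  have "lower_along K q (\<lambda>x. f x + g x) - (q (\<lambda>x. f x + fst z x) - snd z) \<le> lower_along K q g" if z: "z \<in> K" for z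
  proof (rule lower_along_ge[OF g])
    show "lower_along K q (\<lambda>x. f x + g x) - (q (\<lambda>x. f x + fst z x) - snd z) \<le> q (\<lambda>x. g x + fst z' x) - snd z'"
      if "z' \<in> K" for z' using 1[OF z that] by linarith
  qed
  then have "lower_along K q (\<lambda>x. f x + g x) - lower_along K q g \<le> lower_along K q f"
    by (intro lower_along_ge[OF f]) (simp add: algebra_simps)
  then show "lower_along K q (\<lambda>x. f x + g x) \<le> lower_along K q f + lower_along K q g" by simp
next
  have half: "lower_along K q (\<lambda>x. of_real t * f x) \<le> t * lower_along K q f" if f: "f \<in> V" and t: "0 < t" for f t
  proof -
    have "lower_along K q (\<lambda>x. of_real t * f x) / t \<le> lower_along K q f"
    proof (rule lower_along_ge[OF f])
      fix z assume z: "z \<in> K"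
      have "lower_along K q (\<lambda>x. of_real t * f x) \<le> q (\<lambda>x. of_real t * f x + of_real t * fst z x) - t * snd z"
        using lower_along_le[OF V_scale[OF f] cone_below_rules(5)[OF z t]] by simp
      also have "(\<lambda>x. of_real t * f x + of_real t * fst z x) = (\<lambda>x. of_real t * (f x + fst z x))"
        by (simp add: algebra_simps)
      also have "q (\<lambda>x. of_real t * (f x + fst z x)) = t * q (\<lambda>x. f x + fst z x)"
        by (intro sublinear_scale[OF q] V_add f cone_below_rules(2) z t)
      finally have "lower_along K q (\<lambda>x. of_real t * f x) \<le> (q (\<lambda>x. f x + fst z x) - snd z) * t"
        by (simp add: algebra_simps)
      then show "lower_along K q (\<lambda>x. of_real t * f x) / t \<le> q (\<lambda>x. f x + fst z x) - snd z"
        by (subst pos_divide_le_eq[OF t])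
    qed
    then show ?thesis using t by (simp add: pos_divide_le_eq mult.commute)
  qed
  fix f and t :: real assume f: "f \<in> V" and t: "0 < t"
  have "(\<lambda>x. complex_of_real (1 / t) * (of_real t * f x)) = f" using t by (simp add: field_simps)
  then have "lower_along K q f \<le> (1 / t) * lower_along K q (\<lambda>x. of_real t * f x)"
    using half[OF V_scale[OF f, of "of_real t"], of "1 / t"] t by simp
  then have "t * lower_along K q f \<le> lower_along K q (\<lambda>x. of_real t * f x)"
    using t by (simp add: pos_le_divide_eq mult.commute)
  with half[OF f t] show "lower_along K q (\<lambda>x. of_real t * f x) = t * lower_along K q f" by simp
qed (simp add: lower_along_def)

end

text \<open>
  Lowering \<open>m\<close> along the ray through \<open>g\<close> forces \<open>m (- g) \<le> - m g\<close>, and by minimality changes nothing.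
\<close>
lemma minimal_sublinear_minus:
  assumes m: "sublinear m" and min: "\<forall>q. sublinear q \<longrightarrow> (\<forall>f. q f \<le> m f) \<longrightarrow> q = m" and g: "g \<in> V"
  shows "m (\<lambda>x. - g x) = - m g"
proof -
  define K where "K = (\<lambda>t. ((\<lambda>x. of_real t * g x), t * m g)) ` {0..}"
  have K: "cone_below m K"
    unfolding cone_below_def
  proof (intro conjI)
    show "((\<lambda>x. 0), 0) \<in> K" unfolding K_def by (rule image_eqI[of _ _ 0]) auto
    show "\<forall>(v, s)\<in>K. v \<in> V \<and> s \<le> m v"
    proof (clarsimp simp: K_def V_scale[OF g])
      fix t :: real assume "0 \<le> t"
      then show "t * m g \<le> m (\<lambda>x. of_real t * g x)"
        using sublinear_scale[OF m g, of t] sublinear_zero[OF m] by (cases "t = 0") auto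
    qed
    show "\<forall>(v, s)\<in>K. \<forall>(v', s')\<in>K. ((\<lambda>x. v x + v' x), s + s') \<in> K"
    proof (clarsimp simp: K_def)
      fix t t' :: real assume "0 \<le> t" "0 \<le> t'"
      then show "(\<lambda>x. of_real t * g x + of_real t' * g x, t * m g + t' * m g) \<in> (\<lambda>t. (\<lambda>x. of_real t * g x, t * m g)) ` {0..}"
        by (intro image_eqI[of _ _ "t + t'"]) (auto simp: algebra_simps)
    qed
    show "\<forall>(v, s)\<in>K. \<forall>t>0. ((\<lambda>x. of_real t * v x), t * s) \<in> K"
    proof (clarsimp simp: K_def)
      fix t t' :: real assume "0 \<le> t" "0 < t'"
      then show "(\<lambda>x. of_real t' * (of_real t * g x), t' * (t * m g)) \<in> (\<lambda>t. (\<lambda>x. of_real t * g x, t * m g)) ` {0..}"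
        by (intro image_eqI[of _ _ "t' * t"]) (auto simp: algebra_simps)
    qed
  qed
  have "lower_along K m = m"
    using min lower_along_sublinear[OF m K] lower_along_le_self[OF m K] by simp
  moreover have "((\<lambda>x. of_real 1 * g x), 1 * m g) \<in> K" unfolding K_def by (rule imageI) simp
  ultimately have "m (\<lambda>x. - g x) \<le> - m g" using lower_along_cone[OF m K] by fastforce
  moreover have "- m g \<le> m (\<lambda>x. - g x)" using sublinear_minus[OF m V_minus[OF g]] by simp
  ultimately show ?thesis by simp
qed

lemma minimal_sublinear_linear:
  assumes m: "sublinear m" and min: "\<forall>q. sublinear q \<longrightarrow> (\<forall>f. q f \<le> m f) \<longrightarrow> q = m"
  shows "f \<in> V \<Longrightarrow> g \<in> V \<Longrightarrow> m (\<lambda>x. f x + g x) = m f + m g"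
    and "f \<in> V \<Longrightarrow> m (\<lambda>x. of_real t * f x) = t * m f"
proof -
  note neg = minimal_sublinear_minus[OF m min]
  show "m (\<lambda>x. f x + g x) = m f + m g" if f: "f \<in> V" and g: "g \<in> V"
  proof (rule antisym)
    show "m (\<lambda>x. f x + g x) \<le> m f + m g" by (rule sublinear_add[OF m f g])
    have "m (\<lambda>x. (f x + g x) + - g x) \<le> m (\<lambda>x. f x + g x) + m (\<lambda>x. - g x)"
      by (intro sublinear_add[OF m] V_add V_minus f g)
    then show "m f + m g \<le> m (\<lambda>x. f x + g x)" using neg[OF g] by simp
  qed
  show "m (\<lambda>x. of_real t * f x) = t * m f" if f: "f \<in> V"
  proof -
    consider "0 < t" | "t = 0" | "t < 0" by linarith
    then show ?thesis
    proof cases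
      case 1 then show ?thesis by (rule sublinear_scale[OF m f])
    next
      case 2 then show ?thesis using sublinear_zero[OF m] by simp
    next
      case 3
      then have "m (\<lambda>x. of_real (- t) * f x) = - t * m f" by (intro sublinear_scale[OF m f]) simp
      moreover have "m (\<lambda>x. - (of_real (- t) * f x)) = - m (\<lambda>x. of_real (- t) * f x)"
        by (rule neg[OF V_scale[OF f]])
      ultimately show ?thesis by simp
    qed
  qed
qed

text \<open>
  Zorn's lemma for the reversed pointwise order: the infimum of a chain is again sublinear because
  two members of the chain are comparable.
\<close>
lemma minimal_sublinear_exists:
  assumes p: "sublinear p"
  shows "\<exists>m. sublinear m \<and> (\<forall>f. m f \<le> p f) \<and> (\<forall>q. sublinear q \<longrightarrow> (\<forall>f. q f \<le> m f) \<longrightarrow> q = m)"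
proof -
  define A where "A = {q. sublinear q \<and> (\<forall>f. q f \<le> p f)}"
  define P :: "(('x \<Rightarrow> complex) \<Rightarrow> real) \<Rightarrow> (('x \<Rightarrow> complex) \<Rightarrow> real) \<Rightarrow> bool" where "P = (\<lambda>a b. b \<le> a)"
  have "\<exists>m\<in>A. \<forall>q\<in>A. P m q \<longrightarrow> q = m"
  proof (rule predicate_Zorn)
    show "partial_order_on A (relation_of P A)"
      by (rule partial_order_on_relation_ofI) (auto simp: P_def)
    fix C assume "C \<in> Chains (relation_of P A)"
    then have CA: "C \<subseteq> A" and tot: "\<And>q q'. q \<in> C \<Longrightarrow> q' \<in> C \<Longrightarrow> q \<le> q' \<or> q' \<le> q"
      by (auto simp: Chains_def relation_of_def P_def)
    show "\<exists>u\<in>A. \<forall>q\<in>C. P q u"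
    proof (cases "C = {}")
      case True
      then show ?thesis using p by (auto simp: A_def)
    next
      case ne: False
      have sub: "sublinear q" and le: "q f \<le> p f" if "q \<in> C" for q f using that CA by (auto simp: A_def)
      have bdd: "bdd_below ((\<lambda>q. q f) ` C)" if f: "f \<in> V" for f
      proof (rule bdd_belowI2)
        fix q assume "q \<in> C"
        then show "- p (\<lambda>x. - f x) \<le> q f"
          using sublinear_minus[OF sub f, of q] le[of q "\<lambda>x. - f x"] by linarith
      qed
      define u where "u = (\<lambda>f. if f \<in> V then INF q\<in>C. q f else 0)"
      have u_le: "u f \<le> q f" if "q \<in> C" for q f
        using that bdd[of f] sublinear_outside[OF sub[OF that]] by (auto simp: u_def intro: cINF_lower)
      have u_ge: "b \<le> u f" if "f \<in> V" "\<And>q. q \<in> C \<Longrightarrow> b \<le> q f" for b f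
        using that ne by (auto simp: u_def intro: cINF_greatest)
      have "sublinear u"
        unfolding sublinear_def
      proof (intro conjI ballI allI impI)
        fix f g assume f: "f \<in> V" and g: "g \<in> V"
        have 1: "u (\<lambda>x. f x + g x) \<le> q f + q' g" if q: "q \<in> C" "q' \<in> C" for q q'
        proof -
          obtain s where s: "s \<in> C" "s \<le> q" "s \<le> q'" using tot[OF q] q by blast
          have "u (\<lambda>x. f x + g x) \<le> s (\<lambda>x. f x + g x)" by (rule u_le[OF s(1)])
          also have "\<dots> \<le> s f + s g" by (rule sublinear_add[OF sub[OF s(1)] f g])
          also have "\<dots> \<le> q f + q' g" using s by (intro add_mono) (auto simp: le_fun_def)
          finally show ?thesis .
        qed
        have "u (\<lambda>x. f x + g x) - q f \<le> u g" if "q \<in> C" for q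
          using 1[OF that] by (intro u_ge[OF g]) (simp add: algebra_simps)
        then have "u (\<lambda>x. f x + g x) - u g \<le> u f"
          by (intro u_ge[OF f]) (simp add: algebra_simps)
        then show "u (\<lambda>x. f x + g x) \<le> u f + u g" by simp
      next
        fix f and t :: real assume f: "f \<in> V" and t: "0 < t"
        have sc: "q (\<lambda>x. of_real t * f x) = t * q f" if "q \<in> C" for q
          by (rule sublinear_scale[OF sub[OF that] f t])
        show "u (\<lambda>x. of_real t * f x) = t * u f"
        proof (rule antisym)
          have "u (\<lambda>x. of_real t * f x) / t \<le> u f"
          proof (rule u_ge[OF f])
            fix q assume "q \<in> C"
            then have "u (\<lambda>x. of_real t * f x) \<le> t * q f" using u_le[of q "\<lambda>x. of_real t * f x"] sc by simp
            then show "u (\<lambda>x. of_real t * f x) / t \<le> q f" using t by (simp add: pos_divide_le_eq mult.commute)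
          qed
          then show "u (\<lambda>x. of_real t * f x) \<le> t * u f" using t by (simp add: pos_divide_le_eq mult.commute)
          show "t * u f \<le> u (\<lambda>x. of_real t * f x)"
            using t u_le by (intro u_ge[OF V_scale[OF f]]) (simp add: sc)
        qed
      qed (simp add: u_def)
      moreover have "u f \<le> p f" for f
      proof -
        obtain q where "q \<in> C" using ne by blast
        then show ?thesis using u_le[of q f] le[of q f] by linarith
      qed
      ultimately show ?thesis using u_le by (intro bexI[of _ u]) (auto simp: A_def P_def le_fun_def)
    qed
  qed
  then obtain m where m: "m \<in> A" "\<And>q. q \<in> A \<Longrightarrow> q \<le> m \<Longrightarrow> q = m" by (auto simp: P_def)
  have "q = m" if "sublinear q" "\<forall>f. q f \<le> m f" for q
    using that m(1) by (intro m(2)) (auto simp: A_def le_fun_def intro: order_trans)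
  then show ?thesis using m(1) by (auto simp: A_def)
qed

text \<open>
  The cone spanned by \<open>W\<close> at height 0 and by \<open>f0\<close> at height \<open>e\<close> lies below \<open>p\<close>, since \<open>f0\<close> has distance at
  least \<open>e\<close> from \<open>W\<close>.  A minimal sublinear functional below the lowering of \<open>p\<close> along this cone is
  real-linear, vanishes on \<open>W\<close> and is at least \<open>e\<close> at \<open>f0\<close>; it is the real part of \<open>S\<close>.
\<close>
theorem hahn_banach_separation:
  assumes p_add: "\<And>f g. f \<in> V \<Longrightarrow> g \<in> V \<Longrightarrow> p (\<lambda>x. f x + g x) \<le> p f + p g"
    and p_scale: "\<And>f \<alpha>. f \<in> V \<Longrightarrow> p (\<lambda>x. \<alpha> * f x) = norm \<alpha> * (p f :: real)"
    and W: "W \<subseteq> V" "(\<lambda>x. 0) \<in> W" "\<And>f g. f \<in> W \<Longrightarrow> g \<in> W \<Longrightarrow> (\<lambda>x. f x + g x) \<in> W"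
      "\<And>f \<alpha>. f \<in> W \<Longrightarrow> (\<lambda>x. \<alpha> * f x) \<in> W"
    and f0: "f0 \<in> V" and e: "0 < e" "\<And>w. w \<in> W \<Longrightarrow> e \<le> p (\<lambda>x. f0 x - w x)"
  shows "\<exists>S. (\<forall>f\<in>V. \<forall>g\<in>V. S (\<lambda>x. f x + g x) = S f + S g) \<and> (\<forall>f\<in>V. \<forall>\<alpha>. S (\<lambda>x. \<alpha> * f x) = \<alpha> * S f) \<and>
    (\<forall>f\<in>V. norm (S f) \<le> p f) \<and> (\<forall>w\<in>W. S w = 0) \<and> (S f0 :: complex) \<noteq> 0"
proof -
  define q where "q = (\<lambda>f. if f \<in> V then p f else 0)"
  have q: "sublinear q"
    using p_add p_scale by (auto simp: sublinear_def q_def V_add V_scale)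
  have p_zero: "p (\<lambda>x. 0) = 0" using p_scale[OF V_zero, of 0] by simp
  have p_nonneg: "0 \<le> p f" if "f \<in> V" for f
    using p_add[OF that V_minus[OF that]] p_scale[OF that, of "- 1"] p_zero by simp
  define K where "K = (\<lambda>(w, t). ((\<lambda>x. w x + of_real t * f0 x), t * e)) ` (W \<times> {0..})"
  have K_mem: "((\<lambda>x. w x + of_real t * f0 x), t * e) \<in> K" if "w \<in> W" "0 \<le> t" for w t
    unfolding K_def using that by (intro image_eqI[of _ _ "(w, t)"]) auto
  have K_elim: "\<exists>w t. z = ((\<lambda>x. w x + of_real t * f0 x), t * e) \<and> w \<in> W \<and> 0 \<le> t" if "z \<in> K" for z
    using that unfolding K_def by auto
  have "cone_below q K"
  proof (rule cone_belowI)
    show "((\<lambda>x. 0), 0) \<in> K" using K_mem[OF W(2), of 0] by simp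
  next
    fix v s assume "(v, s) \<in> K"
    from K_elim[OF this] obtain w t where v: "v = (\<lambda>x. w x + of_real t * f0 x)" "s = t * e" "w \<in> W" "0 \<le> t" by auto
    have wV: "w \<in> V" using v W by auto
    have vV: "v \<in> V" unfolding v by (intro V_add V_scale f0 wV)
    have "s \<le> p v"
    proof (cases "t = 0")
      case True
      then show ?thesis using v p_nonneg[OF vV] by simp
    next
      case False
      then have t: "0 < t" using v by simp
      have "e \<le> p (\<lambda>x. f0 x - of_real (- 1 / t) * w x)" by (intro e(2) W(4) v)
      then have "t * e \<le> t * p (\<lambda>x. f0 x - of_real (- 1 / t) * w x)" using t by simp
      also have "\<dots> = p (\<lambda>x. of_real t * (f0 x - of_real (- 1 / t) * w x))"
      proof -
        have "(\<lambda>x. f0 x + (- of_real (- 1 / t)) * w x) \<in> V" by (intro V_add V_scale f0 wV)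
        then show ?thesis using p_scale[of "\<lambda>x. f0 x - of_real (- 1 / t) * w x" "of_real t"] t by simp
      qed
      also have "(\<lambda>x. of_real t * (f0 x - of_real (- 1 / t) * w x)) = v"
        unfolding v(1) using t by (auto simp: field_simps)
      finally show ?thesis by (simp add: v)
    qed
    then show "v \<in> V" "s \<le> q v" using vV by (auto simp: q_def)
  next
    fix v s v' s' assume "(v, s) \<in> K" "(v', s') \<in> K"
    from K_elim[OF this(1)] K_elim[OF this(2)] obtain w t w' t' where v:
      "v = (\<lambda>x. w x + of_real t * f0 x)" "s = t * e" "w \<in> W" "0 \<le> t"
      "v' = (\<lambda>x. w' x + of_real t' * f0 x)" "s' = t' * e" "w' \<in> W" "0 \<le> t'" by auto
    show "((\<lambda>x. v x + v' x), s + s') \<in> K"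
      using K_mem[OF W(3)[OF v(3,7)], of "t + t'"] v by (simp add: algebra_simps)
  next
    fix v s and r :: real assume "(v, s) \<in> K" and r: "0 < r"
    from K_elim[OF this(1)] obtain w t where v: "v = (\<lambda>x. w x + of_real t * f0 x)" "s = t * e" "w \<in> W" "0 \<le> t" by auto
    show "((\<lambda>x. of_real r * v x), r * s) \<in> K"
      using K_mem[OF W(4)[OF v(3), of "of_real r"], of "r * t"] v r by (simp add: algebra_simps)
  qed
  note K = this
  obtain m where m: "sublinear m" "\<forall>f. m f \<le> lower_along K q f"
    and min: "\<forall>s. sublinear s \<longrightarrow> (\<forall>f. s f \<le> m f) \<longrightarrow> s = m"
    using minimal_sublinear_exists[OF lower_along_sublinear[OF q K]] by (elim exE conjE)
  note lin = minimal_sublinear_linear[OF m(1) min]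
  have neg: "m (\<lambda>x. - f x) = - m f" if "f \<in> V" for f
    by (rule minimal_sublinear_minus[OF m(1) min that])
  have m_p: "m f \<le> p f" if "f \<in> V" for f
    using m(2)[rule_format, of f] lower_along_le_self[OF q K, of f] that by (simp add: q_def)
  have m_K: "snd z \<le> m (fst z)" if z: "z \<in> K" for z
    using m(2)[rule_format, of "\<lambda>x. - fst z x"] lower_along_cone[OF q K z]
      neg[OF cone_below_rules(2)[OF q K z]] by simp
  have m_W: "m w = 0" if w: "w \<in> W" for w
  proof -
    have "0 \<le> m v" if "v \<in> W" for v using m_K[OF K_mem[OF that, of 0]] by simp
    from this[OF w] this[OF W(4)[OF w, of "- 1"]] show ?thesis using neg[of w] w W(1) by auto
  qed
  have m_f0: "e \<le> m f0" using m_K[OF K_mem[OF W(2), of 1]] by simp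
  define S where "S = (\<lambda>f. Complex (m f) (- m (\<lambda>x. \<i> * f x)))"
  have S_add: "S (\<lambda>x. f x + g x) = S f + S g" if "f \<in> V" "g \<in> V" for f g
    using lin(1)[OF that] lin(1)[OF V_scale[OF that(1)] V_scale[OF that(2)], of \<i> \<i>]
    by (simp add: S_def complex_eq_iff distrib_left)
  have S_scale: "S (\<lambda>x. \<alpha> * f x) = \<alpha> * S f" if f: "f \<in> V" for f \<alpha>
  proof -
    note if' = V_scale[OF f, of \<i>]
    have 1: "(\<lambda>x. \<alpha> * f x) = (\<lambda>x. of_real (Re \<alpha>) * f x + of_real (Im \<alpha>) * (\<i> * f x))"
      by (rule ext, subst complex_eq[of \<alpha>]) (simp add: algebra_simps)
    have 2: "(\<lambda>x. \<i> * (\<alpha> * f x)) = (\<lambda>x. of_real (Re \<alpha>) * (\<i> * f x) + of_real (- Im \<alpha>) * f x)"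
      by (rule ext, subst complex_eq[of \<alpha>]) (simp add: algebra_simps)
    have "m (\<lambda>x. \<alpha> * f x) = Re \<alpha> * m f + Im \<alpha> * m (\<lambda>x. \<i> * f x)"
      unfolding 1 by (subst lin(1)[OF V_scale[OF f] V_scale[OF if']]) (simp only: lin(2)[OF f] lin(2)[OF if'])
    moreover have "m (\<lambda>x. \<i> * (\<alpha> * f x)) = Re \<alpha> * m (\<lambda>x. \<i> * f x) + - Im \<alpha> * m f"
      unfolding 2 by (subst lin(1)[OF V_scale[OF if'] V_scale[OF f]]) (simp only: lin(2)[OF f] lin(2)[OF if'])
    ultimately show ?thesis by (simp add: S_def complex_eq_iff)
  qed
  have S_bound: "norm (S f) \<le> p f" if f: "f \<in> V" for f
  proof (cases "S f = 0")
    case True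
    then show ?thesis using p_nonneg[OF f] by simp
  next
    case False
    \<comment> \<open>The rotation by \<open>\<alpha>\<close> makes the value real, where \<open>S\<close> agrees with \<open>m\<close>.\<close>
    define \<alpha> where "\<alpha> = cnj (S f) / of_real (norm (S f))"
    have "norm \<alpha> = 1" using False by (simp add: \<alpha>_def norm_divide)
    have "S (\<lambda>x. \<alpha> * f x) = \<alpha> * S f" by (rule S_scale[OF f])
    also have "\<dots> = of_real (norm (S f))"
      using False complex_norm_square[of "S f"] by (simp add: \<alpha>_def field_simps power2_eq_square)
    finally have "norm (S f) = m (\<lambda>x. \<alpha> * f x)" by (simp add: S_def complex_eq_iff)
    also have "\<dots> \<le> p (\<lambda>x. \<alpha> * f x)" by (rule m_p[OF V_scale[OF f]])
    also have "\<dots> = p f" using p_scale[OF f, of \<alpha>] \<open>norm \<alpha> = 1\<close> by simp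
    finally show ?thesis .
  qed
  have "S w = 0" if "w \<in> W" for w
    using m_W[OF that] m_W[OF W(4)[OF that, of \<i>]] by (simp add: S_def complex_eq_iff)
  moreover have "S f0 \<noteq> 0" using m_f0 e(1) by (auto simp: S_def complex_eq_iff)
  ultimately show ?thesis using S_add S_scale S_bound by (intro exI[of _ S]) blast
qed

end

section \<open>The weight and the derivative bounds it controls\<close>

locale ultradiff =
  fixes \<omega> :: "real \<Rightarrow> real" and a :: ereal and c r :: "nat \<Rightarrow> real"
  assumes setting: "ultradiff_setting \<omega> a c r"
begin

abbreviation \<U> :: "(real \<Rightarrow> complex) set" where
  "\<U> \<equiv> U_space \<omega> a c"

lemma weight: "weight \<omega>"
  using setting by (simp add: ultradiff_setting_def)

lemma weight_nonneg: "0 \<le> x \<Longrightarrow> 0 \<le> \<omega> x"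
  using weight by (simp add: weight_def)

lemma weight_mono: "0 \<le> x \<Longrightarrow> x \<le> y \<Longrightarrow> \<omega> x \<le> \<omega> y"
  using weight by (auto simp: weight_def mono_on_def)

lemma weight_almost_subadditive:
  assumes "1 < \<sigma>"
  obtains C where "0 < C" "\<And>x y. 0 \<le> x \<Longrightarrow> 0 \<le> y \<Longrightarrow> \<omega> (x + y) \<le> \<sigma> * (\<omega> x + \<omega> y) + C"
proof -
  have "\<forall>\<sigma>>1. \<exists>C>0. \<forall>x\<ge>0. \<forall>y\<ge>0. \<omega> (x + y) \<le> \<sigma> * (\<omega> x + \<omega> y) + C"
    using weight by (simp add: weight_def)
  then obtain C where "0 < C" "\<forall>x\<ge>0. \<forall>y\<ge>0. \<omega> (x + y) \<le> \<sigma> * (\<omega> x + \<omega> y) + C"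
    using assms by meson
  then show thesis using that[of C] by simp
qed

lemma ln_le_weight:
  assumes "0 < e"
  obtains C where "0 \<le> C" "\<And>x. 1 \<le> x \<Longrightarrow> ln x \<le> e * \<omega> x + C"
proof -
  have "ln \<in> o(\<omega>)" using weight by (simp add: weight_def)
  then have "eventually (\<lambda>x. norm (ln x) \<le> e * norm (\<omega> x)) at_top"
    using assms by (rule landau_o.smallD)
  then obtain x0 where x0: "\<And>x. x0 \<le> x \<Longrightarrow> \<bar>ln x\<bar> \<le> e * \<bar>\<omega> x\<bar>"
    unfolding eventually_at_top_linorder real_norm_def by blast
  define C where "C = ln (max 1 x0)"
  have "ln x \<le> e * \<omega> x + C" if "1 \<le> x" for x
  proof (cases "x0 \<le> x")
    case True
    have "0 \<le> C" by (simp add: C_def)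
    then show ?thesis using x0[OF True] weight_nonneg[of x] that ln_ge_zero[OF that] by simp
  next
    case False
    then have "ln x \<le> C" using that by (simp add: C_def)
    moreover have "0 \<le> e * \<omega> x" using weight_nonneg[of x] that assms by simp
    ultimately show ?thesis by linarith
  qed
  moreover have "0 \<le> C" by (simp add: C_def)
  ultimately show thesis by (rule that[rotated])
qed

lemma weight_le_linear:
  assumes "0 < e"
  obtains C where "0 \<le> C" "\<And>x. 0 \<le> x \<Longrightarrow> \<omega> x \<le> e * x + C"
proof -
  have "\<omega> \<in> o(\<lambda>x. x)" using weight by (simp add: weight_def)
  then have "eventually (\<lambda>x. norm (\<omega> x) \<le> e * norm x) at_top"
    using assms by (rule landau_o.smallD)
  then obtain x0 where x0: "\<And>x. x0 \<le> x \<Longrightarrow> \<bar>\<omega> x\<bar> \<le> e * \<bar>x\<bar>"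
    unfolding eventually_at_top_linorder real_norm_def by blast
  define C where "C = \<omega> (max 0 x0)"
  have "\<omega> x \<le> e * x + C" if "0 \<le> x" for x
  proof (cases "x0 \<le> x")
    case True
    then show ?thesis using x0[OF True] weight_nonneg[of "max 0 x0"] that
      by (auto simp: C_def)
  next
    case False
    then have "\<omega> x \<le> C" using that weight_mono[of x "max 0 x0"] by (simp add: C_def)
    moreover have "0 \<le> e * x" using that assms by simp
    ultimately show ?thesis by linarith
  qed
  moreover have "0 \<le> C" by (simp add: C_def weight_nonneg)
  ultimately show thesis by (rule that[rotated])
qed

text \<open>
  The bound on derivatives of order \<open>j\<close> that the semi-norm with parameter \<open>q\<close> prescribes.  The next
  lemmas identify it as the supremum of \<open>x ^ j * exp (- q * \<omega> x)\<close> over \<open>x \<ge> 1\<close> (substitute \<open>x = exp t\<close>);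
  from then on the conjugate function is not mentioned.
\<close>
definition M :: "real \<Rightarrow> nat \<Rightarrow> real" where
  "M q j = exp (q * young_conj \<omega> (real j / q))"

lemma M_pos: "0 < M q j"
  by (simp add: M_def)

lemma young_bdd:
  assumes "0 \<le> s"
  shows "bdd_above ((\<lambda>t. s * t - \<omega> (exp t)) ` {0..})"
proof -
  obtain C where C: "0 \<le> C" "\<And>x. 1 \<le> x \<Longrightarrow> ln x \<le> 1 / (s + 1) * \<omega> x + C"
    using ln_le_weight[of "1 / (s + 1)"] assms by auto
  have "s * t - \<omega> (exp t) \<le> s * C" if "0 \<le> t" for t
  proof -
    have "t \<le> 1 / (s + 1) * \<omega> (exp t) + C" using C(2)[of "exp t"] that by simp
    then have "s * t \<le> s * (1 / (s + 1) * \<omega> (exp t) + C)" using assms by (rule mult_left_mono)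
    also have "\<dots> = s / (s + 1) * \<omega> (exp t) + s * C" by (simp add: algebra_simps)
    also have "\<dots> \<le> 1 * \<omega> (exp t) + s * C"
      using assms weight_nonneg[of "exp t"] by (intro add_mono mult_right_mono order_refl) (simp_all add: field_simps)
    finally show ?thesis by simp
  qed
  then show ?thesis by (intro bdd_aboveI[of _ "s * C"]) auto
qed

lemma M_upper:
  assumes "0 < q" "1 \<le> x"
  shows "x ^ j * exp (- q * \<omega> x) \<le> M q j"
proof -
  have "real j / q * ln x - \<omega> (exp (ln x)) \<le> young_conj \<omega> (real j / q)"
    unfolding young_conj_def
    by (rule cSUP_upper[where f = "\<lambda>t. real j / q * t - \<omega> (exp t)"]) (use assms young_bdd[of "real j / q"] in \<open>auto simp del: times_divide_eq_left\<close>)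
  then have "q * (real j / q * ln x - \<omega> x) \<le> q * young_conj \<omega> (real j / q)"
    using assms by (intro mult_left_mono) auto
  then have "j * ln x - q * \<omega> x \<le> q * young_conj \<omega> (real j / q)"
    using assms by (simp add: algebra_simps)
  then have "exp (j * ln x - q * \<omega> x) \<le> M q j" by (simp add: M_def)
  moreover have "exp (j * ln x - q * \<omega> x) = x ^ j * exp (- q * \<omega> x)"
    using assms by (simp add: exp_diff exp_of_nat_mult exp_minus divide_inverse)
  ultimately show ?thesis by simp
qed

lemma M_least:
  assumes "0 < q" "0 < d" "\<And>x. 1 \<le> x \<Longrightarrow> d * (x ^ j * exp (- q * \<omega> x)) \<le> B"
  shows "d * M q j \<le> B"
proof -
  have "0 < d * (1 ^ j * exp (- q * \<omega> 1))" using assms by simp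
  also have "\<dots> \<le> B" by (rule assms(3)) simp
  finally have B: "0 < B" .
  have "young_conj \<omega> (real j / q) \<le> ln (B / d) / q"
    unfolding young_conj_def
  proof (rule cSUP_least)
    fix t :: real assume "t \<in> {0..}"
    then have "d * (exp t ^ j * exp (- q * \<omega> (exp t))) \<le> B" by (intro assms(3)) simp
    then have "exp (j * t - q * \<omega> (exp t)) \<le> B / d"
      using assms by (simp add: field_simps exp_diff exp_minus flip: exp_of_nat_mult)
    then have "j * t - q * \<omega> (exp t) \<le> ln (B / d)"
      using B assms by (subst ln_ge_iff) auto
    moreover have "q * (real j / q * t - \<omega> (exp t)) = j * t - q * \<omega> (exp t)"
      using assms by (simp add: right_diff_distrib)
    ultimately show "real j / q * t - \<omega> (exp t) \<le> ln (B / d) / q"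
      using assms by (simp add: pos_le_divide_eq mult.commute)
  qed auto
  then have "q * young_conj \<omega> (real j / q) \<le> ln (B / d)"
    using assms by (simp add: field_simps)
  then have "M q j \<le> B / d"
    using B assms unfolding M_def by (subst (asm) ln_ge_iff) auto
  then show ?thesis using assms by (simp add: field_simps)
qed

lemma M_antimono:
  assumes "0 < q" "q \<le> q'"
  shows "M q' j \<le> M q j"
proof -
  have "1 * (x ^ j * exp (- q' * \<omega> x)) \<le> M q j" if "1 \<le> x" for x
  proof -
    have "x ^ j * exp (- q' * \<omega> x) \<le> x ^ j * exp (- q * \<omega> x)"
      using that assms weight_nonneg[of x] by (auto intro!: mult_left_mono mult_right_mono)
    also have "\<dots> \<le> M q j" using assms that by (intro M_upper) auto
    finally show ?thesis by simp
  qed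
  then have "1 * M q' j \<le> M q j" using assms by (intro M_least) auto
  then show ?thesis by simp
qed

text \<open>
  The additional factor \<open>x\<close> is absorbed by \<open>exp ((q' - q) * \<omega> x)\<close>, as \<open>ln x = o(\<omega> x)\<close>.
\<close>
lemma M_Suc_le:
  assumes "0 < q" "q < q'"
  obtains C where "0 < C" "\<And>j. M q' (Suc j) \<le> C * M q j"
proof -
  obtain C where C: "0 \<le> C" "\<And>x. 1 \<le> x \<Longrightarrow> ln x \<le> (q' - q) * \<omega> x + C"
    using ln_le_weight[of "q' - q"] assms by auto
  have "1 * M q' (Suc j) \<le> exp C * M q j" for j
  proof (rule M_least)
    fix x :: real assume x: "1 \<le> x"
    have "x = exp (ln x)" using x by simp
    also have "\<dots> \<le> exp ((q' - q) * \<omega> x + C)" using C(2)[OF x] by (simp only: exp_le_cancel_iff)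
    finally have "x * exp (- q' * \<omega> x) \<le> exp ((q' - q) * \<omega> x + C) * exp (- q' * \<omega> x)"
      by (rule mult_right_mono) simp
    also have "\<dots> = exp C * exp (- q * \<omega> x)" by (simp flip: exp_add add: algebra_simps)
    finally have "x ^ j * (x * exp (- q' * \<omega> x)) \<le> x ^ j * (exp C * exp (- q * \<omega> x))"
      using x by (intro mult_left_mono) auto
    also have "\<dots> = exp C * (x ^ j * exp (- q * \<omega> x))" by simp
    also have "\<dots> \<le> exp C * M q j" using x assms by (intro mult_left_mono M_upper) auto
    finally show "1 * (x ^ Suc j * exp (- q' * \<omega> x)) \<le> exp C * M q j" by (simp add: mult_ac)
  qed (use assms in auto)
  then show thesis using that[of "exp C"] by simp
qed

text \<open>
  A single term of the binomial expansion is at most \<open>(x + y) ^ j\<close>, and \<open>\<omega>\<close> is subadditive up to a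
  factor that can be taken as \<open>q' / q\<close>.
\<close>
lemma M_product_le_aux:
  assumes "0 < q" "q < q'"
  obtains C where "0 < C" "\<And>i j. i \<le> j \<Longrightarrow> real (j choose i) * M q' i * M q' (j - i) \<le> C * M q j"
proof -
  obtain C where C: "0 < C"
    "\<And>x y. 0 \<le> x \<Longrightarrow> 0 \<le> y \<Longrightarrow> \<omega> (x + y) \<le> q' / q * (\<omega> x + \<omega> y) + C"
    using weight_almost_subadditive[of "q' / q"] assms by auto
  have *: "real (j choose i) * (x ^ i * exp (- q' * \<omega> x)) * (y ^ (j - i) * exp (- q' * \<omega> y))
      \<le> exp (q * C) * M q j" if "i \<le> j" "1 \<le> x" "1 \<le> y" for i j x y
  proof -
    have "real (j choose i) * x ^ i * y ^ (j - i) \<le> (\<Sum>k\<le>j. real (j choose k) * x ^ k * y ^ (j - k))"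
      using that by (intro member_le_sum) auto
    also have "\<dots> = (x + y) ^ j" by (simp add: binomial_ring)
    finally have 1: "real (j choose i) * x ^ i * y ^ (j - i) \<le> (x + y) ^ j" .
    have "q * \<omega> (x + y) \<le> q * (q' / q * (\<omega> x + \<omega> y) + C)"
      using C(2)[of x y] that assms by (intro mult_left_mono) auto
    also have "\<dots> = q' * (\<omega> x + \<omega> y) + q * C" using assms by (simp add: field_simps)
    finally have 2: "exp (- q' * \<omega> x) * exp (- q' * \<omega> y) \<le> exp (q * C) * exp (- q * \<omega> (x + y))"
      by (simp flip: exp_add add: algebra_simps)
    have "(real (j choose i) * x ^ i * y ^ (j - i)) * (exp (- q' * \<omega> x) * exp (- q' * \<omega> y))
        \<le> (x + y) ^ j * (exp (q * C) * exp (- q * \<omega> (x + y)))"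
      by (rule mult_mono[OF 1 2]) (use that in auto)
    also have "\<dots> = exp (q * C) * ((x + y) ^ j * exp (- q * \<omega> (x + y)))" by simp
    also have "\<dots> \<le> exp (q * C) * M q j"
      using that assms by (intro mult_left_mono M_upper) auto
    finally show ?thesis by (simp add: mult_ac)
  qed
  have "real (j choose i) * M q' i * M q' (j - i) \<le> exp (q * C) * M q j" if "i \<le> j" for i j
  proof -
    have ch: "0 < real (j choose i)" using that by simp
    have "(real (j choose i) * (x ^ i * exp (- q' * \<omega> x))) * M q' (j - i) \<le> exp (q * C) * M q j"
      if "1 \<le> x" for x
    proof (rule M_least)
      show "0 < real (j choose i) * (x ^ i * exp (- q' * \<omega> x))" using ch that by simp
    qed (use assms *[OF \<open>i \<le> j\<close> that] in simp_all)
    then have "(real (j choose i) * M q' (j - i)) * M q' i \<le> exp (q * C) * M q j"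
      using assms ch M_pos[of q' "j - i"] by (intro M_least) (simp_all add: mult_ac)
    then show ?thesis by (simp add: mult_ac)
  qed
  then show thesis using that[of "exp (q * C)"] by simp
qed

text \<open>
  By Bernoulli's inequality \<open>(j + 1) * x ^ j \<le> x * (x + 1) ^ j\<close>; the factor \<open>x\<close> is absorbed as above, and
  the shift to \<open>x + 1\<close> by almost subadditivity.  The intermediate parameter \<open>p\<close> leaves room for both.
\<close>
lemma M_times_order_le:
  assumes "0 < q" "q < q'"
  obtains C where "0 < C" "\<And>j. real (Suc j) * M q' j \<le> C * M q j"
proof -
  define p where "p = (q + q') / 2"
  have p: "q < p" "p < q'" using assms by (auto simp: p_def)
  obtain C where C: "0 < C"
    "\<And>x y. 0 \<le> x \<Longrightarrow> 0 \<le> y \<Longrightarrow> \<omega> (x + y) \<le> p / q * (\<omega> x + \<omega> y) + C"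
    using weight_almost_subadditive[of "p / q"] assms p by auto
  obtain E where E: "0 \<le> E" "\<And>x. 1 \<le> x \<Longrightarrow> ln x \<le> (q' - p) * \<omega> x + E"
    using ln_le_weight[of "q' - p"] p by auto
  define B where "B = E + q * C + p * \<omega> 1"
  have "real (Suc j) * M q' j \<le> exp B * M q j" for j
  proof (rule M_least)
    fix x :: real assume x: "1 \<le> x"
    have "1 + real j * (1 / x) \<le> (1 + 1 / x) ^ j"
      using Bernoulli_inequality[of "1 / x" j] x by (smt (verit) divide_nonneg_nonneg)
    also have "\<dots> = (x + 1) ^ j / x ^ j" using x by (simp add: field_simps flip: power_divide)
    finally have "x ^ j * (1 + real j * (1 / x)) \<le> (x + 1) ^ j" using x by (simp add: field_simps)
    then have "x * (x ^ j * (1 + real j * (1 / x))) \<le> x * (x + 1) ^ j" using x by simp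
    moreover have "x ^ j * (1 + real j) \<le> x * (x ^ j * (1 + real j * (1 / x)))"
      using x by (simp add: field_simps)
    ultimately have 1: "x ^ j * (1 + real j) \<le> x * (x + 1) ^ j" by linarith
    have "x = exp (ln x)" using x by simp
    also have "\<dots> \<le> exp ((q' - p) * \<omega> x + E)" using E(2)[OF x] by (simp only: exp_le_cancel_iff)
    finally have 2: "x \<le> exp ((q' - p) * \<omega> x + E)" .
    have "q * \<omega> (x + 1) \<le> q * (p / q * (\<omega> x + \<omega> 1) + C)"
      using C(2)[of x 1] x assms by (intro mult_left_mono) auto
    also have "\<dots> = p * \<omega> x + p * \<omega> 1 + q * C" using assms by (simp add: field_simps)
    finally have 3: "exp ((q' - p) * \<omega> x + E) * exp (- q' * \<omega> x) \<le> exp B * exp (- q * \<omega> (x + 1))"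
      by (simp flip: exp_add add: algebra_simps B_def)
    have "real (Suc j) * (x ^ j * exp (- q' * \<omega> x)) = (x ^ j * (1 + real j)) * exp (- q' * \<omega> x)"
      by (simp add: algebra_simps)
    also have "\<dots> \<le> (x * (x + 1) ^ j) * exp (- q' * \<omega> x)" using 1 by simp
    also have "\<dots> \<le> (exp ((q' - p) * \<omega> x + E) * (x + 1) ^ j) * exp (- q' * \<omega> x)"
      using 2 x by simp
    also have "\<dots> = (x + 1) ^ j * (exp ((q' - p) * \<omega> x + E) * exp (- q' * \<omega> x))" by simp
    also have "\<dots> \<le> (x + 1) ^ j * (exp B * exp (- q * \<omega> (x + 1)))"
      using 3 x by (intro mult_left_mono) auto
    also have "\<dots> = exp B * ((x + 1) ^ j * exp (- q * \<omega> (x + 1)))" by simp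
    also have "\<dots> \<le> exp B * M q j" using x assms by (intro mult_left_mono M_upper) auto
    finally show "real (Suc j) * (x ^ j * exp (- q' * \<omega> x)) \<le> exp B * M q j" .
  qed (use assms in auto)
  then show thesis using that[of "exp B"] by simp
qed

lemma M_product_le:
  assumes "0 < q" "q < q'"
  obtains C where "0 < C" "\<And>j. (\<Sum>i\<le>j. real (j choose i) * M q' i * M q' (j - i)) \<le> C * M q j"
proof -
  define p where "p = (q + q') / 2"
  have p: "0 < p" "q < p" "p < q'" using assms by (auto simp: p_def)
  obtain C where C: "0 < C"
      "\<And>i j. i \<le> j \<Longrightarrow> real (j choose i) * M q' i * M q' (j - i) \<le> C * M p j"
    using M_product_le_aux[OF p(1,3)] by blast
  obtain E where E: "0 < E" "\<And>j. real (Suc j) * M p j \<le> E * M q j"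
    using M_times_order_le[OF assms(1) p(2)] by blast
  have "(\<Sum>i\<le>j. real (j choose i) * M q' i * M q' (j - i)) \<le> C * E * M q j" for j
  proof -
    have "(\<Sum>i\<le>j. real (j choose i) * M q' i * M q' (j - i)) \<le> (\<Sum>i\<le>j. C * M p j)"
      by (intro sum_mono C(2)) simp
    also have "\<dots> = C * (real (Suc j) * M p j)" by simp
    also have "\<dots> \<le> C * (E * M q j)" using C(1) E(2) by (intro mult_left_mono) auto
    finally show ?thesis by (simp add: mult_ac)
  qed
  then show thesis using that[of "C * E"] C(1) E(1) by simp
qed

lemma weight_ivt:
  assumes "\<omega> 1 \<le> v"
  obtains x where "1 \<le> x" "\<omega> x = v"
proof -
  obtain C where C: "0 \<le> C" "\<And>x. 1 \<le> x \<Longrightarrow> ln x \<le> 1 * \<omega> x + C" using ln_le_weight[of 1] by auto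
  define b where "b = exp (max 0 (v + C))"
  have b: "1 \<le> b" by (simp add: b_def)
  have "v \<le> \<omega> b" using C(2)[OF b] by (simp add: b_def)
  moreover have "continuous_on {1..b} \<omega>"
    using weight by (auto simp: weight_def intro: continuous_on_subset)
  ultimately have "\<exists>x\<ge>1. x \<le> b \<and> \<omega> x = v" using assms b by (intro IVT') auto
  then show thesis using that by blast
qed

text \<open>
  The points \<open>y i\<close> are where \<open>\<omega>\<close> takes consecutive integer values.  As \<open>1 / y i\<close> is the integral of
  \<open>x\<close> to the power \<open>- 2\<close> over \<open>{y i..}\<close>, a finite sum of these numbers is the integral of the number
  of levels below \<open>x\<close>, divided by \<open>x\<^sup>2\<close>; and that number is at most \<open>\<omega> x\<close>.
\<close>
lemma weight_levels:
  obtains y :: "nat \<Rightarrow> real" and n0 :: nat where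
    "\<And>i. 1 \<le> y i" "\<And>i. \<omega> (y i) = real (n0 + i)" "mono y" "summable (\<lambda>i. 1 / y i)"
proof -
  define n0 where "n0 = nat \<lceil>\<omega> 1\<rceil> + 1"
  have n0: "\<omega> 1 \<le> real n0" "1 \<le> n0" unfolding n0_def by linarith+
  have "\<exists>x. 1 \<le> x \<and> \<omega> x = real (n0 + i)" for i
    by (rule weight_ivt[of "real (n0 + i)"]) (use n0 in auto)
  then obtain y where y: "\<And>i. 1 \<le> y i" "\<And>i. \<omega> (y i) = real (n0 + i)" by metis
  have "y i \<le> y j" if "i \<le> j" for i j
  proof (rule ccontr)
    assume "\<not> y i \<le> y j"
    then have l: "y j < y i" by simp
    then have "\<omega> (y j) \<le> \<omega> (y i)" using y(1)[of j] by (intro weight_mono) auto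
    then have "i = j" using y(2) that by simp
    then show False using l by simp
  qed
  then have "mono y" by (simp add: monoI)
  have int: "(\<lambda>x. \<omega> x / x\<^sup>2) integrable_on {1..}"
    using weight by (auto simp: weight_def intro: set_borel_integral_eq_integral)
  have "(\<Sum>i<n. 1 / y i) \<le> integral {1..} (\<lambda>x. \<omega> x / x\<^sup>2)" for n
  proof (rule has_integral_le)
    have "((\<lambda>x. if x \<in> {y i..} then 1 / x ^ 2 else 0) has_integral 1 / y i) {1..}" for i
    proof -
      have "((\<lambda>x. 1 / x ^ 2) has_integral 1 / (real (2 - 1) * y i ^ (2 - 1))) {y i..}"
        using y(1)[of i] by (intro has_integral_inverse_power_to_inf) auto
      then show ?thesis using y(1)[of i] by (subst has_integral_restrict) auto
    qed
    then show "((\<lambda>x. \<Sum>i<n. if x \<in> {y i..} then 1 / x ^ 2 else 0) has_integral (\<Sum>i<n. 1 / y i)) {1..}"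
      by (intro has_integral_sum) auto
    show "((\<lambda>x. \<omega> x / x\<^sup>2) has_integral integral {1..} (\<lambda>x. \<omega> x / x\<^sup>2)) {1..}"
      using int by (rule integrable_integral)
    fix x :: real assume x: "x \<in> {1..}"
    define S where "S = {i. i < n \<and> y i \<le> x}"
    have "real (card S) \<le> \<omega> x"
    proof (cases "S = {}")
      case False
      have fin: "finite S" by (simp add: S_def)
      define m where "m = Max S"
      have m: "m \<in> S" "S \<subseteq> {..m}" using False fin by (auto simp: m_def)
      have "card S \<le> Suc m" using card_mono[OF _ m(2)] by simp
      also have "real (Suc m) \<le> \<omega> (y m)" using y(2) n0 by simp
      also have "\<dots> \<le> \<omega> x" using m(1) y(1)[of m] by (intro weight_mono) (auto simp: S_def)
      finally show ?thesis by simp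
    qed (use x weight_nonneg[of x] in auto)
    moreover have "(\<Sum>i<n. if x \<in> {y i..} then 1 / x ^ 2 else 0) = real (card S) * (1 / x\<^sup>2)"
    proof -
      have "(\<Sum>i<n. if x \<in> {y i..} then 1 / x ^ 2 else 0) = (\<Sum>i\<in>{i\<in>{..<n}. y i \<le> x}. 1 / x ^ 2)"
        by (subst sum.inter_filter) auto
      also have "{i\<in>{..<n}. y i \<le> x} = S" by (auto simp: S_def)
      finally show ?thesis by simp
    qed
    ultimately show "(\<Sum>i<n. if x \<in> {y i..} then 1 / x ^ 2 else 0) \<le> \<omega> x / x\<^sup>2"
      using x by (simp add: divide_right_mono)
  qed
  then have "(\<Sum>i\<le>n. 1 / y i) \<le> integral {1..} (\<lambda>x. \<omega> x / x\<^sup>2)" for n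
    unfolding lessThan_Suc_atMost[symmetric] .
  moreover have "0 \<le> 1 / y i" for i using y(1)[of i] by simp
  ultimately have "summable (\<lambda>i. 1 / y i)" by (intro bounded_imp_summable)
  then show thesis using that[OF y \<open>mono y\<close>] by simp
qed

text \<open>
  The widths \<open>2 * exp 1 / y (i + N)\<close> are summable, with small sum for large \<open>N\<close>.  They bound the
  derivative of order \<open>j\<close> by a product of \<open>j\<close> factors \<open>y (i + N) / exp 1\<close>, hence by \<open>x ^ j * exp (- j)\<close>
  with \<open>x = y (j + N)\<close>.  Since \<open>\<omega> x = n0 + j + N\<close>, this is a constant times \<open>x ^ j * exp (- \<omega> x)\<close>.
\<close>
lemma weight_step:
  assumes d: "0 < d"
  shows "\<exists>F :: nat \<Rightarrow> real \<Rightarrow> real. \<exists>C. (\<forall>j t. (F j has_real_derivative F (Suc j) t) (at t)) \<and>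
    (\<forall>q j t. 0 < q \<longrightarrow> q \<le> 1 \<longrightarrow> \<bar>F j t\<bar> \<le> C * M q j) \<and>
    (\<forall>t\<le>0. F 0 t = 1) \<and> (\<forall>t\<ge>d. F 0 t = 0)"
proof -
  obtain y n0 where y: "\<And>i. 1 \<le> y i" "\<And>i. \<omega> (y i) = real (n0 + i)" "mono y" "summable (\<lambda>i. 1 / y i)"
    using weight_levels by metis
  have "summable (\<lambda>i. 2 * exp 1 * (1 / y i))" using y(4) by (rule summable_mult)
  from suminf_exist_split[OF _ this, of "d / 2"] d
  obtain N where N: "norm (\<Sum>i. 2 * exp 1 * (1 / y (i + N))) < d / 2" by auto
  define w where "w = (\<lambda>i. 2 * exp 1 * (1 / y (i + N)))"
  have ypos: "0 < y i" for i using y(1)[of i] by linarith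
  have sw: "summable w" unfolding w_def using \<open>summable (\<lambda>i. 2 * exp 1 * (1 / y i))\<close>
    by (subst summable_iff_shift)
  have wp: "0 < w i" for i using ypos by (simp add: w_def)
  have sl: "suminf w \<le> d / 2" using N by (simp add: w_def abs_less_iff)
  from smooth_step_exists[OF wp sw d sl] obtain F :: "nat \<Rightarrow> real \<Rightarrow> real" where F:
    "\<forall>j t. (F j has_real_derivative F (Suc j) t) (at t)"
    "\<forall>j t. \<bar>F j t\<bar> \<le> (\<Prod>i<j. 2 / w i)"
    "\<forall>t\<le>0. F 0 t = 1" "\<forall>t\<ge>d. F 0 t = 0"
    by (elim exE conjE)
  have "\<bar>F j t\<bar> \<le> exp (real (n0 + N)) * M q j" if q: "0 < q" "q \<le> 1" for q j t
  proof -
    let ?x = "y (j + N)"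
    have "(\<Prod>i<j. 2 / w i) \<le> (\<Prod>i<j. ?x / exp 1)"
    proof (rule prod_mono)
      fix i assume "i \<in> {..<j}"
      then have "y (i + N) \<le> ?x" by (intro monoD[OF y(3)]) simp
      then show "0 \<le> 2 / w i \<and> 2 / w i \<le> ?x / exp 1"
        using ypos[of "i + N"] by (simp add: w_def divide_right_mono)
    qed
    also have "\<dots> = ?x ^ j * exp (- real j)"
      using exp_of_nat_mult[of j "1::real"] by (simp add: power_mult_distrib power_inverse exp_minus divide_inverse)
    also have "\<dots> \<le> ?x ^ j * (exp (real (n0 + N)) * exp (- q * \<omega> ?x))"
    proof (intro mult_left_mono)
      have "q * real (n0 + (j + N)) \<le> 1 * real (n0 + (j + N))" using q by (intro mult_right_mono) auto
      then show "exp (- real j) \<le> exp (real (n0 + N)) * exp (- q * \<omega> ?x)"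
        unfolding y(2) by (simp flip: exp_add)
    qed (use ypos[of "j + N"] in auto)
    also have "\<dots> = exp (real (n0 + N)) * (?x ^ j * exp (- q * \<omega> ?x))" by simp
    also have "\<dots> \<le> exp (real (n0 + N)) * M q j"
      using q y(1) by (intro mult_left_mono M_upper) auto
    finally show ?thesis using F(2)[rule_format, of j t] by linarith
  qed
  then show ?thesis using F by (intro exI[of _ F] exI[of _ "exp (real (n0 + N))"]) simp
qed

section \<open>The space of ultradifferentiable functions\<close>

lemma c_pos: "0 < c k" and c_mono: "k \<le> l \<Longrightarrow> c k \<le> c l"
  and c_exhaust: "(\<Union>k. {- c k..c k}) = sym_interval a" and a_pos: "0 < a"
  using setting by (auto simp: ultradiff_setting_def incseq_def)

lemma c_in: "{- c k..c k} \<subseteq> sym_interval a"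
  using c_exhaust by blast

text \<open>
  A real bound for the extended-real semi-norm is a bound for all derivatives; the proofs below
  work with the latter.
\<close>
lemma jet_bound_iff:
  "U_seminorm \<omega> a c q k f \<le> ereal B \<longleftrightarrow>
     (\<forall>j. \<forall>x\<in>{- c k..c k}. norm ((D_op a ^^ j) f x) \<le> B * M q j)"
proof -
  have "norm z * exp (- q * young_conj \<omega> (real j / q)) \<le> B \<longleftrightarrow> norm z \<le> B * M q j" for z :: complex and j
    by (simp add: M_def exp_minus divide_inverse[symmetric] pos_divide_le_eq)
  then show ?thesis by (simp add: U_seminorm_def SUP_le_iff)
qed

lemma U_seminorm_nonneg: "0 \<le> U_seminorm \<omega> a c q k f"
proof -
  have "0 \<in> {- c k..c k}" using c_pos[of k] by simp
  then have "ereal (norm ((D_op a ^^ 0) f 0) * exp (- q * young_conj \<omega> (real 0 / q))) \<le> U_seminorm \<omega> a c q k f"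
    unfolding U_seminorm_def by (intro SUP_upper2[of 0] SUP_upper) auto
  moreover have "0 \<le> ereal (norm ((D_op a ^^ 0) f 0) * exp (- q * young_conj \<omega> (real 0 / q)))" by simp
  ultimately show ?thesis by (rule order_trans[rotated])
qed

lemma U_spaceI:
  assumes "f \<in> smooth_functions a"
    and "\<And>q k. 0 < q \<Longrightarrow> q < 1 \<Longrightarrow>
      \<exists>B. \<forall>j. \<forall>x\<in>{- c k..c k}. norm ((D_op a ^^ j) f x) \<le> B * M q j"
  shows "f \<in> \<U>"
proof -
  have "U_seminorm \<omega> a c q k f < \<infinity>" if "q \<in> {0<..<1}" for q k
  proof -
    have q: "0 < q" "q < 1" using that by auto
    from assms(2)[OF q, of k] obtain B
      where "\<forall>j. \<forall>x\<in>{- c k..c k}. norm ((D_op a ^^ j) f x) \<le> B * M q j" by (elim exE)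
    then have "U_seminorm \<omega> a c q k f \<le> ereal B" by (simp only: jet_bound_iff)
    then show ?thesis by (rule le_less_trans) simp
  qed
  then show ?thesis using assms(1) by (simp add: U_space_def)
qed

lemma U_space_smooth: "f \<in> \<U> \<Longrightarrow> f \<in> smooth_functions a"
  by (simp add: U_space_def)

lemma U_space_seminorm_real:
  assumes "f \<in> \<U>" "0 < q" "q < 1"
  obtains B where "0 \<le> B" "U_seminorm \<omega> a c q k f = ereal B"
proof -
  have "U_seminorm \<omega> a c q k f < \<infinity>" using assms by (simp add: U_space_def)
  with U_seminorm_nonneg[of q k f] show thesis
    using that by (cases "U_seminorm \<omega> a c q k f") auto
qed

lemma U_space_bound:
  assumes "f \<in> \<U>" "0 < q" "q < 1"
  obtains B where "0 \<le> B" "\<And>j x. x \<in> {- c k..c k} \<Longrightarrow> norm ((D_op a ^^ j) f x) \<le> B * M q j"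
proof -
  obtain B where "0 \<le> B" "U_seminorm \<omega> a c q k f = ereal B"
    using U_space_seminorm_real[OF assms] by metis
  then show thesis using that[of B] jet_bound_iff[of q k f B] by simp
qed

lemma U_space_add:
  assumes "f \<in> \<U>" "g \<in> \<U>"
  shows "(\<lambda>x. f x + g x) \<in> \<U>"
proof (rule U_spaceI)
  show "(\<lambda>x. f x + g x) \<in> smooth_functions a" using assms U_space_smooth D_op_power_add(2) by blast
  fix q :: real and k assume q: "0 < q" "q < 1"
  obtain A where A: "\<And>j x. x \<in> {- c k..c k} \<Longrightarrow> norm ((D_op a ^^ j) f x) \<le> A * M q j"
    using U_space_bound[OF assms(1) q] by metis
  obtain B where B: "\<And>j x. x \<in> {- c k..c k} \<Longrightarrow> norm ((D_op a ^^ j) g x) \<le> B * M q j"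
    using U_space_bound[OF assms(2) q] by metis
  have "norm ((D_op a ^^ j) (\<lambda>x. f x + g x) x) \<le> (A + B) * M q j" if "x \<in> {- c k..c k}" for j x
  proof -
    have "norm ((D_op a ^^ j) f x + (D_op a ^^ j) g x) \<le> A * M q j + B * M q j"
      by (intro norm_triangle_mono A B that)
    then show ?thesis by (simp add: D_op_power_add(1) U_space_smooth assms algebra_simps)
  qed
  then show "\<exists>B. \<forall>j. \<forall>x\<in>{- c k..c k}. norm ((D_op a ^^ j) (\<lambda>x. f x + g x) x) \<le> B * M q j" by blast
qed

lemma U_space_scale:
  assumes "f \<in> \<U>"
  shows "(\<lambda>x. \<alpha> * f x) \<in> \<U>"
proof (rule U_spaceI)
  show "(\<lambda>x. \<alpha> * f x) \<in> smooth_functions a" using assms U_space_smooth D_op_power_scale(2) by blast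
  fix q :: real and k assume q: "0 < q" "q < 1"
  obtain A where A: "\<And>j x. x \<in> {- c k..c k} \<Longrightarrow> norm ((D_op a ^^ j) f x) \<le> A * M q j"
    using U_space_bound[OF assms(1) q] by metis
  have "norm ((D_op a ^^ j) (\<lambda>x. \<alpha> * f x) x) \<le> (norm \<alpha> * A) * M q j" if "x \<in> {- c k..c k}" for j x
  proof -
    have "norm \<alpha> * norm ((D_op a ^^ j) f x) \<le> norm \<alpha> * (A * M q j)"
      by (intro mult_left_mono A that) auto
    then show ?thesis by (simp add: D_op_power_scale(1) U_space_smooth assms norm_mult mult_ac)
  qed
  then show "\<exists>B. \<forall>j. \<forall>x\<in>{- c k..c k}. norm ((D_op a ^^ j) (\<lambda>x. \<alpha> * f x) x) \<le> B * M q j" by blast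
qed

lemma U_space_diff:
  assumes "f \<in> \<U>" "g \<in> \<U>"
  shows "(\<lambda>x. f x - g x) \<in> \<U>"
  using U_space_add[OF assms(1) U_space_scale[OF assms(2), of "- 1"]] by simp

lemma D_op_power_diff:
  assumes "f \<in> smooth_functions a" "g \<in> smooth_functions a"
  shows "(D_op a ^^ j) (\<lambda>x. f x - g x) = (\<lambda>x. (D_op a ^^ j) f x - (D_op a ^^ j) g x)"
  using D_op_power_add(1)[OF assms(1) D_op_power_scale(2)[OF assms(2), of "- 1"], of j]
    D_op_power_scale(1)[OF assms(2), of j "- 1"] by simp

lemma U_space_zero: "(\<lambda>x. 0) \<in> \<U>"
proof (rule U_spaceI)
  have *: "(D_op a ^^ j) (\<lambda>x. 0) = (\<lambda>x. 0)" for j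
    by (rule D_op_criterion_power[where F = "\<lambda>j x. 0"]) auto
  show "(\<lambda>x. 0) \<in> smooth_functions a"
    by (rule D_op_criterion_smooth[where F = "\<lambda>j x. 0"]) auto
  show "\<exists>B. \<forall>j. \<forall>x\<in>{- c k..c k}. norm ((D_op a ^^ j) (\<lambda>x. 0) x) \<le> B * M q j" for q k
    by (rule exI[of _ 0]) (simp add: *)
qed

text \<open>
  The estimate is made at a single point because it will be applied to exponentials, whose size
  depends on the point.
\<close>
lemma pointwise_product_bound:
  assumes "0 < q" "q < q'"
  shows "\<exists>C>0. \<forall>f g x A B j. f \<in> smooth_functions a \<longrightarrow> g \<in> smooth_functions a \<longrightarrow> 0 \<le> A \<longrightarrow> 0 \<le> B \<longrightarrow>
      (\<forall>j. norm ((D_op a ^^ j) f x) \<le> A * M q' j) \<longrightarrow> (\<forall>j. norm ((D_op a ^^ j) g x) \<le> B * M q' j) \<longrightarrow>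
      norm ((D_op a ^^ j) (\<lambda>x. f x * g x) x) \<le> C * A * B * M q j"
proof -
  obtain C where C: "0 < C" "\<And>j. (\<Sum>i\<le>j. real (j choose i) * M q' i * M q' (j - i)) \<le> C * M q j"
    using M_product_le[OF assms] by metis
  show ?thesis
  proof (rule exI[of _ C], intro conjI C(1) allI impI)
    fix f g :: "real \<Rightarrow> complex" and x A B :: real and j
    assume f: "f \<in> smooth_functions a" and g: "g \<in> smooth_functions a" and AB: "0 \<le> A" "0 \<le> B"
      and A: "\<forall>j. norm ((D_op a ^^ j) f x) \<le> A * M q' j" and B: "\<forall>j. norm ((D_op a ^^ j) g x) \<le> B * M q' j"
    have "norm ((D_op a ^^ j) (\<lambda>x. f x * g x) x)
        \<le> (\<Sum>i\<le>j. norm (of_nat (j choose i) * ((D_op a ^^ i) f x * (D_op a ^^ (j - i)) g x)))"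
      unfolding D_op_power_mult(1)[OF f g] by (rule norm_sum)
    also have "\<dots> \<le> (\<Sum>i\<le>j. real (j choose i) * ((A * M q' i) * (B * M q' (j - i))))"
      unfolding norm_mult norm_of_nat
      using AB by (intro sum_mono mult_left_mono mult_mono A[rule_format] B[rule_format])
        (auto simp: less_imp_le M_pos)
    also have "\<dots> = A * B * (\<Sum>i\<le>j. real (j choose i) * M q' i * M q' (j - i))"
      by (simp add: sum_distrib_left mult_ac)
    also have "\<dots> \<le> A * B * (C * M q j)" using AB by (intro mult_left_mono C(2)) auto
    finally show "norm ((D_op a ^^ j) (\<lambda>x. f x * g x) x) \<le> C * A * B * M q j" by (simp add: mult_ac)
  qed
qed

lemma U_space_mult:
  assumes "f \<in> \<U>" "g \<in> \<U>"
  shows "(\<lambda>x. f x * g x) \<in> \<U>"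
proof (rule U_spaceI)
  show "(\<lambda>x. f x * g x) \<in> smooth_functions a" using assms U_space_smooth D_op_power_mult(2) by blast
  fix q :: real and k assume q: "0 < q" "q < 1"
  define q' where "q' = (q + 1) / 2"
  have q': "q < q'" "0 < q'" "q' < 1" using q by (auto simp: q'_def)
  from pointwise_product_bound[OF q(1) q'(1)] obtain C where C: "0 < C"
    "\<forall>f g x A B j. f \<in> smooth_functions a \<longrightarrow> g \<in> smooth_functions a \<longrightarrow> 0 \<le> A \<longrightarrow> 0 \<le> B \<longrightarrow>
      (\<forall>j. norm ((D_op a ^^ j) f x) \<le> A * M q' j) \<longrightarrow> (\<forall>j. norm ((D_op a ^^ j) g x) \<le> B * M q' j) \<longrightarrow>
      norm ((D_op a ^^ j) (\<lambda>x. f x * g x) x) \<le> C * A * B * M q j"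
    by (elim exE conjE)
  obtain A where A: "0 \<le> A" "\<And>j x. x \<in> {- c k..c k} \<Longrightarrow> norm ((D_op a ^^ j) f x) \<le> A * M q' j"
    using U_space_bound[OF assms(1) q'(2,3)] by metis
  obtain B where B: "0 \<le> B" "\<And>j x. x \<in> {- c k..c k} \<Longrightarrow> norm ((D_op a ^^ j) g x) \<le> B * M q' j"
    using U_space_bound[OF assms(2) q'(2,3)] by metis
  have "norm ((D_op a ^^ j) (\<lambda>x. f x * g x) x) \<le> (C * A * B) * M q j" if "x \<in> {- c k..c k}" for j x
    by (rule C(2)[rule_format]) (use assms U_space_smooth A B that in auto)
  then show "\<exists>B. \<forall>j. \<forall>x\<in>{- c k..c k}. norm ((D_op a ^^ j) (\<lambda>x. f x * g x) x) \<le> B * M q j" by blast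
qed

lemma U_space_reflect:
  assumes "f \<in> \<U>"
  shows "(\<lambda>x. f (- x)) \<in> \<U>"
proof (rule U_spaceI)
  show "(\<lambda>x. f (- x)) \<in> smooth_functions a" using assms U_space_smooth D_op_power_reflect(2) by blast
  fix q :: real and k assume q: "0 < q" "q < 1"
  obtain A where A: "\<And>j x. x \<in> {- c k..c k} \<Longrightarrow> norm ((D_op a ^^ j) f x) \<le> A * M q j"
    using U_space_bound[OF assms(1) q] by metis
  have "norm ((D_op a ^^ j) (\<lambda>x. f (- x)) x) \<le> A * M q j" if "x \<in> {- c k..c k}" for j x
    using A[of "- x" j] that by (simp add: D_op_power_reflect(1) U_space_smooth assms norm_mult norm_power)
  then show "\<exists>B. \<forall>j. \<forall>x\<in>{- c k..c k}. norm ((D_op a ^^ j) (\<lambda>x. f (- x)) x) \<le> B * M q j" by blast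
qed

lemma U_space_cut:
  assumes "f \<in> \<U>" "\<And>j. (D_op a ^^ j) f p = 0"
  shows "(\<lambda>x. if p < x then f x else 0) \<in> \<U>"
proof (rule U_spaceI)
  show "(\<lambda>x. if p < x then f x else 0) \<in> smooth_functions a"
    using assms U_space_smooth D_op_power_cut(2) by blast
  fix q :: real and k assume q: "0 < q" "q < 1"
  obtain A where A: "0 \<le> A" "\<And>j x. x \<in> {- c k..c k} \<Longrightarrow> norm ((D_op a ^^ j) f x) \<le> A * M q j"
    using U_space_bound[OF assms(1) q] by metis
  have "norm ((D_op a ^^ j) (\<lambda>x. if p < x then f x else 0) x) \<le> A * M q j" if "x \<in> {- c k..c k}" for j x
    unfolding D_op_power_cut(1)[OF U_space_smooth[OF assms(1)] assms(2)]
    using A that M_pos[of q j] by auto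
  then show "\<exists>B. \<forall>j. \<forall>x\<in>{- c k..c k}. norm ((D_op a ^^ j) (\<lambda>x. if p < x then f x else 0) x) \<le> B * M q j"
    by blast
qed

text \<open>
  The exponentials of which the transform of a functional on the imaginary axis consists, extended
  by zero outside the interval.
\<close>
definition expf :: "real \<Rightarrow> real \<Rightarrow> complex" where
  "expf y t = (if t \<in> sym_interval a then complex_of_real (exp (y * t)) else 0)"

lemma expf_D_op: "(D_op a ^^ j) (expf y) = (\<lambda>t. of_real (y ^ j) * expf y t)"
  and expf_smooth: "expf y \<in> smooth_functions a"
proof -
  define F where "F = (\<lambda>j t. of_real (y ^ j) * expf y t)"
  note crit = D_op_criterion[where F = F and f = "expf y" and a = a]
  have 0: "F 0 = expf y" by (simp add: F_def)
  have 1: "(F j has_vector_derivative F (Suc j) t) (at t)" if t: "t \<in> sym_interval a" for j t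
  proof -
    have "((\<lambda>t. y ^ j * exp (y * t)) has_real_derivative y ^ Suc j * exp (y * t)) (at t)"
      by (auto intro!: derivative_eq_intros)
    then have "((\<lambda>t. complex_of_real (y ^ j * exp (y * t))) has_vector_derivative
        complex_of_real (y ^ Suc j * exp (y * t))) (at t)"
      by (intro has_vector_derivative_of_real)
    then have "(F j has_vector_derivative complex_of_real (y ^ Suc j * exp (y * t))) (at t)"
      by (rule has_vector_derivative_transform_within_open[OF _ open_sym_interval t]) (simp add: F_def expf_def)
    then show ?thesis using t by (simp add: F_def expf_def)
  qed
  have 2: "F j t = 0" if "t \<notin> sym_interval a" for j t
    using that by (simp add: F_def expf_def)
  show "(D_op a ^^ j) (expf y) = (\<lambda>t. of_real (y ^ j) * expf y t)"
    using crit(1)[OF 0 2 1] by (simp add: F_def)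
  show "expf y \<in> smooth_functions a" by (rule crit(2)[OF 0 2 1])
qed

lemma expf_bound:
  assumes "0 < q"
  shows "norm ((D_op a ^^ j) (expf y) t) \<le> exp (y * t) * exp (q * \<omega> (max 1 \<bar>y\<bar>)) * M q j"
proof -
  let ?m = "max 1 \<bar>y\<bar>"
  have "\<bar>y\<bar> ^ j \<le> ?m ^ j" by (intro power_mono) auto
  also have "\<dots> = exp (q * \<omega> ?m) * (?m ^ j * exp (- q * \<omega> ?m))" by (simp add: exp_minus)
  also have "\<dots> \<le> exp (q * \<omega> ?m) * M q j" using assms by (intro mult_left_mono M_upper) auto
  finally have "exp (y * t) * \<bar>y\<bar> ^ j \<le> exp (y * t) * (exp (q * \<omega> ?m) * M q j)" by (intro mult_left_mono) simp_all
  moreover have "norm ((D_op a ^^ j) (expf y) t) \<le> exp (y * t) * \<bar>y\<bar> ^ j"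
    by (simp add: expf_D_op expf_def norm_mult norm_power power_abs)
  ultimately show ?thesis unfolding mult.assoc by (rule order_trans[rotated])
qed

lemma expf_in_U: "expf y \<in> \<U>"
proof (rule U_spaceI[OF expf_smooth])
  fix q :: real and k assume q: "0 < q" "q < 1"
  have "norm ((D_op a ^^ j) (expf y) t) \<le> exp (\<bar>y\<bar> * c k) * exp (q * \<omega> (max 1 \<bar>y\<bar>)) * M q j"
    if "t \<in> {- c k..c k}" for j t
  proof -
    have "y * t \<le> \<bar>y\<bar> * \<bar>t\<bar>" by (simp add: abs_mult[symmetric])
    also have "\<dots> \<le> \<bar>y\<bar> * c k" using that by (intro mult_left_mono) auto
    finally have "exp (y * t) * exp (q * \<omega> (max 1 \<bar>y\<bar>)) * M q j
        \<le> exp (\<bar>y\<bar> * c k) * exp (q * \<omega> (max 1 \<bar>y\<bar>)) * M q j"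
      using M_pos[of q j] by simp
    then show ?thesis using expf_bound[OF q(1), of j y t] by linarith
  qed
  then show "\<exists>B. \<forall>j. \<forall>x\<in>{- c k..c k}. norm ((D_op a ^^ j) (expf y) x) \<le> B * M q j" by blast
qed

text \<open>
  With these cut-off functions the space is not quasianalytic, so that a functional can be localized.
\<close>
lemma step_in_U:
  assumes "\<alpha> < \<beta>"
  obtains \<kappa> where "\<kappa> \<in> \<U>"
    "\<And>t. t \<in> sym_interval a \<Longrightarrow> t \<le> \<alpha> \<Longrightarrow> \<kappa> t = 1" "\<And>t. \<beta> \<le> t \<Longrightarrow> \<kappa> t = 0"
proof -
  have "0 < \<beta> - \<alpha>" using assms by simp
  from weight_step[OF this] obtain F :: "nat \<Rightarrow> real \<Rightarrow> real" and C where F: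
    "\<forall>j t. (F j has_real_derivative F (Suc j) t) (at t)"
    "\<forall>q j t. 0 < q \<longrightarrow> q \<le> 1 \<longrightarrow> \<bar>F j t\<bar> \<le> C * M q j"
    "\<forall>t\<le>0. F 0 t = 1" "\<forall>t\<ge>\<beta> - \<alpha>. F 0 t = 0"
    by (elim exE conjE)
  define G where "G = (\<lambda>j t. if t \<in> sym_interval a then complex_of_real (F j (t - \<alpha>)) else 0)"
  define \<kappa> where "\<kappa> = G 0"
  note crit = D_op_criterion[where F = G and f = \<kappa> and a = a]
  have 1: "(G j has_vector_derivative G (Suc j) t) (at t)" if t: "t \<in> sym_interval a" for j t
  proof -
    have "((\<lambda>t. t - \<alpha>) has_real_derivative 1) (at t)" by (auto intro!: derivative_eq_intros)
    from DERIV_chain2[OF F(1)[rule_format] this, of j]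
    have "((\<lambda>t. F j (t - \<alpha>)) has_real_derivative F (Suc j) (t - \<alpha>)) (at t)" by simp
    then have "((\<lambda>t. complex_of_real (F j (t - \<alpha>))) has_vector_derivative
        complex_of_real (F (Suc j) (t - \<alpha>))) (at t)"
      by (intro has_vector_derivative_of_real)
    then have "(G j has_vector_derivative complex_of_real (F (Suc j) (t - \<alpha>))) (at t)"
      by (rule has_vector_derivative_transform_within_open[OF _ open_sym_interval t]) (simp add: G_def)
    then show ?thesis using t by (simp add: G_def)
  qed
  have 2: "G j t = 0" if "t \<notin> sym_interval a" for j t using that by (simp add: G_def)
  have 0: "G 0 = \<kappa>" by (simp add: \<kappa>_def)
  have "\<kappa> \<in> \<U>"
  proof (rule U_spaceI[OF crit(2)[OF 0 2 1]])
    fix q :: real and k assume q: "0 < q" "q < 1"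
    have "norm ((D_op a ^^ j) \<kappa> x) \<le> C * M q j" if "x \<in> {- c k..c k}" for j x
    proof -
      have "(D_op a ^^ j) \<kappa> x = G j x" by (rule fun_cong[OF crit(1)[OF 0 2 1]])
      moreover have "x \<in> sym_interval a" using c_in[of k] that by auto
      ultimately show ?thesis using F(2)[rule_format, of q j "x - \<alpha>"] q by (simp add: G_def)
    qed
    then show "\<exists>B. \<forall>j. \<forall>x\<in>{- c k..c k}. norm ((D_op a ^^ j) \<kappa> x) \<le> B * M q j" by blast
  qed
  then show thesis by (rule that) (use F in \<open>auto simp: \<kappa>_def G_def\<close>)
qed

section \<open>Functionals annihilating functions supported on one side\<close>

lemma U_space_lincomb:
  fixes N :: nat
  assumes "\<And>i. i < N \<Longrightarrow> g i \<in> \<U>"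
  shows "(\<lambda>t. \<Sum>i<N. \<alpha> i * g i t) \<in> \<U>"
    and "(D_op a ^^ j) (\<lambda>t. \<Sum>i<N. \<alpha> i * g i t) = (\<lambda>t. \<Sum>i<N. \<alpha> i * (D_op a ^^ j) (g i) t)"
  using assms
proof (induction N)
  case 0
  { case 1 show ?case by (simp add: U_space_zero) }
  { case 2 show ?case using D_op_power_eq_0[of UNIV "\<lambda>x. 0" _ j a] by auto }
next
  case (Suc N)
  have g: "g N \<in> \<U>" if "\<And>i. i < Suc N \<Longrightarrow> g i \<in> \<U>" using that by simp
  { case 1
    have "(\<lambda>t. \<Sum>i<N. \<alpha> i * g i t) \<in> \<U>" using 1 by (intro Suc.IH(1)) auto
    from U_space_add[OF this U_space_scale[OF g, of "\<alpha> N"]] 1 show ?case by simp }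
  { case 2
    have 3: "(\<lambda>t. \<Sum>i<N. \<alpha> i * g i t) \<in> \<U>" using 2 by (intro Suc.IH(1)) auto
    have 4: "(D_op a ^^ j) (\<lambda>t. \<Sum>i<N. \<alpha> i * g i t) = (\<lambda>t. \<Sum>i<N. \<alpha> i * (D_op a ^^ j) (g i) t)"
      using 2 by (intro Suc.IH(2)) auto
    have "g N \<in> smooth_functions a" using 2 by (intro U_space_smooth) auto
    from D_op_power_add(1)[OF U_space_smooth[OF 3] D_op_power_scale(2)[OF this, of "\<alpha> N"], of j]
      D_op_power_scale(1)[OF this, of j "\<alpha> N"] 4
    show ?case by simp }
qed

definition linear_on_U :: "((real \<Rightarrow> complex) \<Rightarrow> complex) \<Rightarrow> bool" where
  "linear_on_U S \<longleftrightarrow>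
     (\<forall>f\<in>\<U>. \<forall>g\<in>\<U>. S (\<lambda>x. f x + g x) = S f + S g) \<and>
     (\<forall>f\<in>\<U>. \<forall>\<alpha>. S (\<lambda>x. \<alpha> * f x) = \<alpha> * S f)"

text \<open>
  Continuity of a functional with respect to one semi-norm, expressed through derivatives on
  \<open>{- c k..c k}\<close>.
\<close>
definition bounded_by :: "((real \<Rightarrow> complex) \<Rightarrow> complex) \<Rightarrow> real \<Rightarrow> nat \<Rightarrow> real \<Rightarrow> bool" where
  "bounded_by S q k C \<longleftrightarrow> 0 < q \<and> q < 1 \<and> 0 \<le> C \<and>
     (\<forall>f\<in>\<U>. \<forall>B\<ge>0. (\<forall>j. \<forall>x\<in>{- c k..c k}. norm ((D_op a ^^ j) f x) \<le> B * M q j)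
        \<longrightarrow> norm (S f) \<le> C * B)"

lemma linear_on_U_add:
  "linear_on_U S \<Longrightarrow> f \<in> \<U> \<Longrightarrow> g \<in> \<U> \<Longrightarrow> S (\<lambda>x. f x + g x) = S f + S g"
  by (simp add: linear_on_U_def)

lemma linear_on_U_scale: "linear_on_U S \<Longrightarrow> f \<in> \<U> \<Longrightarrow> S (\<lambda>x. \<alpha> * f x) = \<alpha> * S f"
  by (simp add: linear_on_U_def)

lemma linear_on_U_diff:
  assumes "linear_on_U S" "f \<in> \<U>" "g \<in> \<U>"
  shows "S (\<lambda>x. f x - g x) = S f - S g"
  using linear_on_U_add[OF assms(1,2) U_space_scale[OF assms(3), of "- 1"]]
    linear_on_U_scale[OF assms(1,3), of "- 1"] by simp

lemma linear_on_U_lincomb: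
  fixes N :: nat
  assumes S: "linear_on_U S" and g: "\<And>i. i < N \<Longrightarrow> g i \<in> \<U>"
  shows "S (\<lambda>t. \<Sum>i<N. \<alpha> i * g i t) = (\<Sum>i<N. \<alpha> i * S (g i))"
  using g
proof (induction N)
  case 0
  have "S (\<lambda>x. 0 * 0) = 0 * S (\<lambda>x. 0)" by (rule linear_on_U_scale[OF S U_space_zero])
  then show ?case by simp
next
  case (Suc N)
  have "(\<lambda>t. \<Sum>i<N. \<alpha> i * g i t) \<in> \<U>" using Suc.prems by (intro U_space_lincomb) auto
  moreover have g: "g N \<in> \<U>" using Suc.prems by simp
  ultimately have "S (\<lambda>t. (\<Sum>i<N. \<alpha> i * g i t) + \<alpha> N * g N t)
      = S (\<lambda>t. \<Sum>i<N. \<alpha> i * g i t) + S (\<lambda>t. \<alpha> N * g N t)"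
    by (intro linear_on_U_add[OF S] U_space_scale)
  then show ?case using Suc linear_on_U_scale[OF S g, of "\<alpha> N"] by simp
qed

lemma bounded_byD:
  assumes "bounded_by S q k C" "f \<in> \<U>" "0 \<le> B"
    "\<And>j x. x \<in> {- c k..c k} \<Longrightarrow> norm ((D_op a ^^ j) f x) \<le> B * M q j"
  shows "norm (S f) \<le> C * B"
  using assms unfolding bounded_by_def by blast

text \<open>
  A functional bounded by a semi-norm sees no more than the derivatives on a compact interval.
\<close>
lemma bounded_by_locality:
  assumes "linear_on_U S" "bounded_by S q k C" "f \<in> \<U>" "g \<in> \<U>"
    and "open V" "{- c k..c k} \<subseteq> V" "\<And>x. x \<in> V \<Longrightarrow> f x = g x"
  shows "S f = S g"
proof -
  have "norm (S (\<lambda>x. f x - g x)) \<le> C * 0"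
  proof (rule bounded_byD[OF assms(2) U_space_diff[OF assms(3,4)]])
    fix j x assume "x \<in> {- c k..c k}"
    then have "(D_op a ^^ j) (\<lambda>x. f x - g x) x = 0"
      using assms by (intro D_op_power_eq_0[OF assms(5)]) auto
    then show "norm ((D_op a ^^ j) (\<lambda>x. f x - g x) x) \<le> 0 * M q j" by simp
  qed simp
  then show ?thesis using linear_on_U_diff[OF assms(1,3,4)] by simp
qed

text \<open>
  The functions \<open>P\<close> in the proof are combinations of exponentials which converge to \<open>f\<close> together with
  all derivatives as first \<open>n\<close> tends to infinity and then \<open>\<tau>\<close> to 0: integration by parts turns the
  factor \<open>m ^ j\<close> of the derivatives of \<open>e\<^sub>m\<close> into a derivative of \<open>f\<close> under the integral, so every
  derivative of \<open>P\<close> is the convolution of the kernel with the same derivative of \<open>f\<close>.  On the other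
  hand the assumed growth makes \<open>S P\<close> tend to 0 with \<open>n\<close>.
\<close>
lemma annihilates_compactly_supported:
  assumes S: "linear_on_U S" "bounded_by S q k C" and f: "f \<in> \<U>"
    and b: "b \<le> b'" "{b..b'} \<subseteq> sym_interval a" and supp: "\<And>t. t \<notin> {b..b'} \<Longrightarrow> f t = 0"
    and growth: "\<And>\<delta>. 0 < \<delta> \<Longrightarrow> \<exists>A\<ge>0. \<forall>m\<ge>1. norm (S (expf (real m))) \<le> A * exp ((b + \<delta>) * real m)"
  shows "S f = 0"
proof -
  have q: "0 < q" "q < 1" "0 \<le> C" using S(2) by (auto simp: bounded_by_def)
  define F where "F = (\<lambda>j. (D_op a ^^ j) f)"
  have F0: "F j t = 0" if "t \<notin> {b..b'}" for j t
    unfolding F_def by (rule D_op_power_eq_0[of "- {b..b'}"]) (use supp that in auto)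
  have F_der: "(F j has_vector_derivative F (Suc j) t) (at t)" for j t
  proof (cases "t \<in> sym_interval a")
    case True
    then show ?thesis unfolding F_def by (rule D_op_power_derivative[OF U_space_smooth[OF f]])
  next
    case False
    then have t: "t \<in> - {b..b'}" using b by auto
    have "((\<lambda>_. 0) has_vector_derivative 0) (at t)" by simp
    then have "(F j has_vector_derivative 0) (at t)"
      by (rule has_vector_derivative_transform_within_open[of _ _ _ "- {b..b'}"]) (use t F0 in auto)
    then show ?thesis using F0[of t "Suc j"] t by simp
  qed
  have F_cont: "continuous_on X (F j)" for X j
    using F_der has_vector_derivative_continuous continuous_at_imp_continuous_on by blast
  \<comment> \<open>A stronger semi-norm controls one more derivative, hence the Lipschitz constants of all derivatives.\<close>
  define q' where "q' = (q + 1) / 2"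
  have q': "q < q'" "0 < q'" "q' < 1" using q by (auto simp: q'_def)
  obtain l where l: "{b..b'} \<subseteq> {- c l..c l}"
  proof -
    have "b \<in> (\<Union>k. {- c k..c k})" "b' \<in> (\<Union>k. {- c k..c k})" using b c_exhaust by auto
    then obtain l1 l2 where "- c l1 \<le> b" "b' \<le> c l2" by auto
    moreover have "c l1 \<le> c (max l1 l2)" "c l2 \<le> c (max l1 l2)" by (intro c_mono; simp)+
    ultimately have "{b..b'} \<subseteq> {- c (max l1 l2)..c (max l1 l2)}" by auto
    then show thesis by (rule that)
  qed
  obtain A1 where A1: "0 \<le> A1" "\<And>j x. x \<in> {- c l..c l} \<Longrightarrow> norm ((D_op a ^^ j) f x) \<le> A1 * M q' j"
    using U_space_bound[OF f q'(2,3)] by metis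
  have F_bd': "norm (F j x) \<le> A1 * M q' j" for j x
    using A1 F0[of x j] l M_pos[of q' j] by (cases "x \<in> {b..b'}") (auto simp: F_def)
  obtain Cq where Cq: "0 < Cq" "\<And>j. M q' (Suc j) \<le> Cq * M q j" using M_Suc_le[OF q(1) q'(1)] by metis
  define A2 where "A2 = A1 * Cq"
  have A20: "0 \<le> A2" using A1 Cq by (simp add: A2_def)
  have F_bd: "norm (F j x) \<le> A1 * M q j" for j x
  proof -
    have "A1 * M q' j \<le> A1 * M q j" using A1(1) q q' by (intro mult_left_mono M_antimono) auto
    then show ?thesis using F_bd'[of j x] by linarith
  qed
  have F_lip: "norm (F j u - F j v) \<le> (A2 * M q j) * \<bar>u - v\<bar>" for j u v
  proof (rule lipschitz_of_vector_derivative[OF F_der])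
    fix t
    have "A1 * M q' (Suc j) \<le> A1 * (Cq * M q j)" using A1(1) Cq(2) by (rule mult_left_mono[rotated])
    then show "norm (F (Suc j) t) \<le> A2 * M q j" using F_bd'[of "Suc j" t] by (simp add: A2_def mult.assoc)
  qed
  \<comment> \<open>The interval \<open>{-B..B}\<close> contains the support and, with the margin required by the kernel, \<open>{- c k..c k}\<close>.\<close>
  define B where "B = max (max \<bar>b\<bar> \<bar>b'\<bar>) (c k) + 2"
  have B: "c k + 2 \<le> B" "b > - B" "b' < B" "0 \<le> B" using c_pos[of k] by (auto simp: B_def)
  have F_end: "F j B = 0" "F j (- B) = 0" for j using B F0 by auto
  define L where "L = (\<lambda>y. integral {-B..B} (\<lambda>u. of_real (exp (- y * u)) * F 0 u))"
  have L_parts: "of_real (y ^ j) * L y = integral {-B..B} (\<lambda>u. of_real (exp (- y * u)) * F j u)" for y j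
  proof (induction j)
    case (Suc j)
    let ?e = "\<lambda>u. complex_of_real (exp (- y * u))"
    have "((\<lambda>u. ?e u * F (Suc j) u + of_real (- y * exp (- y * u)) * F j u)
        has_integral (?e B * F j B - ?e (- B) * F j (- B))) {-B..B}"
    proof (rule fundamental_theorem_of_calculus)
      fix u
      have "((\<lambda>u. exp (- y * u)) has_real_derivative - y * exp (- y * u)) (at u)"
        by (auto intro!: derivative_eq_intros)
      then have "(?e has_vector_derivative of_real (- y * exp (- y * u))) (at u)"
        by (rule has_vector_derivative_of_real)
      from has_vector_derivative_mult[OF this F_der[of j u]]
      show "((\<lambda>u. ?e u * F j u) has_vector_derivative
          ?e u * F (Suc j) u + of_real (- y * exp (- y * u)) * F j u) (at u within {-B..B})"
        by (rule has_vector_derivative_at_within)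
    qed (use B in auto)
    then have 1: "((\<lambda>u. ?e u * F (Suc j) u + of_real (- y * exp (- y * u)) * F j u) has_integral 0) {-B..B}"
      by (simp add: F_end)
    have 2: "((\<lambda>u. of_real y * (?e u * F j u)) has_integral of_real y * integral {-B..B} (\<lambda>u. ?e u * F j u)) {-B..B}"
      by (intro has_integral_mult_right integrable_integral integrable_continuous_interval continuous_intros F_cont)
    have "((\<lambda>u. ?e u * F (Suc j) u) has_integral of_real y * integral {-B..B} (\<lambda>u. ?e u * F j u)) {-B..B}"
      using has_integral_add[OF 1 2] by (simp add: algebra_simps)
    then have "integral {-B..B} (\<lambda>u. ?e u * F (Suc j) u) = of_real y * (of_real (y ^ j) * L y)"
      unfolding Suc by (rule integral_unique)
    then show ?case by (simp add: mult.assoc)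
  qed (simp add: L_def)
  define A3 where "A3 = 2 * B * (A1 * M q 0)"
  have A30: "0 \<le> A3" using B A1 M_pos[of q 0] by (simp add: A3_def)
  have L_bound: "norm (L y) \<le> A3 * exp (- y * b)" if "0 \<le> y" for y
  proof -
    have "norm (L y) \<le> (exp (- y * b) * (A1 * M q 0)) * (B - (- B))"
      unfolding L_def
    proof (rule integral_bound)
      fix u
      show "norm (of_real (exp (- y * u)) * F 0 u) \<le> exp (- y * b) * (A1 * M q 0)"
      proof (cases "u < b")
        case True
        then show ?thesis using F0[of u 0] A1(1) M_pos[of q 0] by simp
      next
        case False
        have "exp (- y * u) * norm (F 0 u) \<le> exp (- y * b) * (A1 * M q 0)"
          using False that F_bd[of 0 u] by (intro mult_mono) (auto intro: mult_left_mono)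
        then show ?thesis by (simp add: norm_mult)
      qed
    qed (use B in \<open>auto intro!: continuous_intros F_cont\<close>)
    then show ?thesis by (simp add: A3_def mult_ac)
  qed
  have main: "norm (S f) \<le> C * (A2 * (2 * \<tau>))" if \<tau>: "0 < \<tau>" "\<tau> \<le> 1" for \<tau>
  proof -
    \<comment> \<open>Half of the decay \<open>exp (- m * \<tau>)\<close> of the coefficients pays for the loss in the growth of \<open>S\<close>.\<close>
    obtain A where A: "0 \<le> A" "\<And>m. 1 \<le> m \<Longrightarrow> norm (S (expf (real m))) \<le> A * exp ((b + \<tau> / 2) * real m)"
      using growth[of "\<tau> / 2"] \<tau> by auto
    define E1 where "E1 = A * A3 * exp 1"
    \<comment> \<open>The first term bounds \<open>S P\<close>, the second one \<open>S (P - f)\<close> with truncation error \<open>1 / n\<close> for the kernel.\<close>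
    define bnd where "bnd = (\<lambda>n. E1 * (n * exp (- n * \<tau> / 2)) +
        C * (A1 * (2 * B * (1 / n) + 2 * exp (- n)) + A2 * (2 * \<tau> + 8 * B\<^sup>2 * (n * exp (- n * \<tau>)))))"
    have est: "norm (S f) \<le> bnd (real n)" if n: "1 \<le> n" for n :: nat
    proof -
      have n0: "0 < real n" using n by simp
      have "0 < 1 / real n" using n by simp
      from gumbel_sum_approx_identity[OF n0 \<tau> less_imp_le[OF c_pos] B(1) this]
      obtain N where N: "\<forall>F A1 A2 t. continuous_on UNIV F \<longrightarrow> (\<forall>u. norm (F u) \<le> A1) \<longrightarrow>
        (\<forall>u v. norm (F u - F v) \<le> A2 * \<bar>u - v\<bar>) \<longrightarrow> \<bar>t\<bar> \<le> c k \<longrightarrow>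
        norm (integral {-B..B} (\<lambda>u. of_real (gumbel_sum (real n) \<tau> N (t - u)) * F u) - (F t :: complex))
         \<le> A1 * (2 * B * (1 / real n) + 2 * exp (- real n)) + A2 * (2 * \<tau> + 8 * B\<^sup>2 * real n * exp (- real n * \<tau>))"
        by (elim exE)
      define m where "m = (\<lambda>i. Suc i * n)"
      define \<gamma> where "\<gamma> = (\<lambda>i. real n * (- 1) ^ i / fact i * exp (- real (m i) * \<tau>))"
      define P where "P = (\<lambda>t. \<Sum>i<N. (of_real (\<gamma> i) * L (real (m i))) * expf (real (m i)) t)"
      have PU: "P \<in> \<U>" unfolding P_def by (intro U_space_lincomb expf_in_U)
      have DP: "(D_op a ^^ j) P t = integral {-B..B} (\<lambda>u. of_real (gumbel_sum (real n) \<tau> N (t - u)) * F j u)"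
        if t: "t \<in> sym_interval a" for j t
      proof -
        have "(D_op a ^^ j) P t = (\<Sum>i<N. of_real (\<gamma> i * exp (real (m i) * t)) * (of_real (real (m i) ^ j) * L (real (m i))))"
          unfolding P_def U_space_lincomb(2)[OF expf_in_U] expf_D_op
          using t by (intro sum.cong refl) (simp add: expf_def mult_ac)
        also have "\<dots> = (\<Sum>i<N. integral {-B..B} (\<lambda>u. of_real (\<gamma> i * exp (real (m i) * t)) * (of_real (exp (- real (m i) * u)) * F j u)))"
          unfolding L_parts by simp
        also have "\<dots> = integral {-B..B} (\<lambda>u. \<Sum>i<N. of_real (\<gamma> i * exp (real (m i) * t)) * (of_real (exp (- real (m i) * u)) * F j u))"
          by (intro integral_sum[symmetric] integrable_continuous_interval continuous_intros F_cont) auto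
        also have "\<dots> = integral {-B..B} (\<lambda>u. of_real (gumbel_sum (real n) \<tau> N (t - u)) * F j u)"
        proof (intro integral_cong)
          fix u
          have "\<gamma> i * exp (real (m i) * t) * exp (- real (m i) * u)
              = real n * (- 1) ^ i / fact i * exp (real (Suc i) * real n * (t - u - \<tau>))" for i
          proof -
            have "exp (real (Suc i) * real n * (t - u - \<tau>))
                = exp (- real (m i) * \<tau>) * exp (real (m i) * t) * exp (- real (m i) * u)"
              unfolding exp_add[symmetric] m_def by (simp add: algebra_simps)
            then show ?thesis by (simp add: \<gamma>_def)
          qed
          then have "gumbel_sum (real n) \<tau> N (t - u) = (\<Sum>i<N. \<gamma> i * exp (real (m i) * t) * exp (- real (m i) * u))"
            by (simp only: gumbel_sum_def)
          then show "(\<Sum>i<N. of_real (\<gamma> i * exp (real (m i) * t)) * (of_real (exp (- real (m i) * u)) * F j u))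
              = of_real (gumbel_sum (real n) \<tau> N (t - u)) * F j u"
            by (simp add: sum_distrib_right mult.assoc)
        qed
        finally show ?thesis .
      qed
      define R where "R = A1 * (2 * B * (1 / real n) + 2 * exp (- real n))
          + A2 * (2 * \<tau> + 8 * B\<^sup>2 * real n * exp (- real n * \<tau>))"
      have R0: "0 \<le> R" using A1 A20 B n \<tau> by (simp add: R_def)
      have "norm (S (\<lambda>x. P x - f x)) \<le> C * R"
      proof (rule bounded_byD[OF S(2) U_space_diff[OF PU f] R0])
        fix j t assume t: "t \<in> {- c k..c k}"
        have "norm (integral {-B..B} (\<lambda>u. of_real (gumbel_sum (real n) \<tau> N (t - u)) * F j u) - F j t)
          \<le> (A1 * M q j) * (2 * B * (1 / real n) + 2 * exp (- real n))
            + (A2 * M q j) * (2 * \<tau> + 8 * B\<^sup>2 * real n * exp (- real n * \<tau>))"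
          by (rule N[rule_format]) (use F_cont F_bd F_lip t in auto)
        also have "\<dots> = R * M q j" by (simp add: R_def algebra_simps)
        finally show "norm ((D_op a ^^ j) (\<lambda>x. P x - f x) t) \<le> R * M q j"
          using DP[of t j] t c_in[of k]
          by (simp add: D_op_power_diff U_space_smooth PU f F_def subset_eq)
      qed
      then have 1: "norm (S P - S f) \<le> C * R" by (simp add: linear_on_U_diff[OF S(1) PU f])
      have "S P = (\<Sum>i<N. (of_real (\<gamma> i) * L (real (m i))) * S (expf (real (m i))))"
        unfolding P_def by (intro linear_on_U_lincomb S(1) expf_in_U)
      also have "norm \<dots> \<le> (\<Sum>i<N. norm ((of_real (\<gamma> i) * L (real (m i))) * S (expf (real (m i)))))"
        by (rule norm_sum)
      also have "\<dots> \<le> (\<Sum>i<N. (A * A3 * real n * exp (- real n * \<tau> / 2)) * (1 / fact i))"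
      proof (rule sum_mono)
        fix i
        let ?m = "real (m i)"
        have m1: "1 \<le> m i" using n by (simp add: m_def)
        have nm: "real n \<le> ?m" by (simp add: m_def)
        have g: "\<bar>\<gamma> i\<bar> = real n / fact i * exp (- ?m * \<tau>)"
          by (simp add: \<gamma>_def abs_mult power_abs)
        have "norm ((of_real (\<gamma> i) * L ?m) * S (expf ?m)) = \<bar>\<gamma> i\<bar> * norm (L ?m) * norm (S (expf ?m))"
          by (simp add: norm_mult)
        also have "\<dots> \<le> (real n / fact i * exp (- ?m * \<tau>)) * (A3 * exp (- ?m * b)) * (A * exp ((b + \<tau> / 2) * ?m))"
          unfolding g using A30 by (intro mult_mono L_bound A(2) m1) auto
        also have "\<dots> = A * A3 * real n * (1 / fact i) * (exp (- ?m * \<tau>) * exp (- ?m * b) * exp ((b + \<tau> / 2) * ?m))"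
          by simp
        also have "exp (- ?m * \<tau>) * exp (- ?m * b) * exp ((b + \<tau> / 2) * ?m) = exp (- ?m * \<tau> / 2)"
          unfolding exp_add[symmetric] by (simp add: algebra_simps)
        also have "A * A3 * real n * (1 / fact i) * exp (- ?m * \<tau> / 2)
            \<le> A * A3 * real n * (1 / fact i) * exp (- real n * \<tau> / 2)"
          using A A30 nm \<tau> by (intro mult_left_mono) auto
        finally show "norm ((of_real (\<gamma> i) * L ?m) * S (expf ?m))
            \<le> (A * A3 * real n * exp (- real n * \<tau> / 2)) * (1 / fact i)" by (simp add: mult_ac)
      qed
      also have "\<dots> = (A * A3 * real n * exp (- real n * \<tau> / 2)) * (\<Sum>i<N. 1 / fact i)"
        by (simp only: sum_distrib_left)
      also have "\<dots> \<le> (A * A3 * real n * exp (- real n * \<tau> / 2)) * exp 1"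
      proof (rule mult_left_mono)
        have "summable (\<lambda>i. 1 ^ i /\<^sub>R fact i :: real)" by (rule summable_exp_generic)
        from sum_le_suminf[OF this, of "{..<N}"]
        show "(\<Sum>i<N. 1 / fact i) \<le> exp (1::real)" by (simp add: exp_def divide_inverse)
      qed (use A A30 in auto)
      finally have 2: "norm (S P) \<le> E1 * (real n * exp (- real n * \<tau> / 2))"
        by (simp add: E1_def mult_ac)
      have "norm (S f) \<le> norm (S P) + norm (S P - S f)"
        using norm_triangle_ineq4[of "S P" "S P - S f"] by simp
      also have "\<dots> \<le> bnd (real n)" using 1 2 by (simp add: bnd_def R_def mult.assoc)
      finally show ?thesis .
    qed
    have pw: "(\<lambda>n. real n * exp (- real n * s)) \<longlonglongrightarrow> 0" if "0 < s" for s :: real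
    proof -
      have "(\<lambda>n. real n * exp (- s) ^ n) \<longlonglongrightarrow> 0"
        by (rule powser_times_n_limit_0) (use that in simp)
      then show ?thesis by (simp add: exp_of_nat_mult[symmetric])
    qed
    have ex: "(\<lambda>n. exp (- real n)) \<longlonglongrightarrow> 0"
    proof (rule tendsto_sandwich[OF _ _ tendsto_const pw[of 1]])
      show "\<forall>\<^sub>F n in sequentially. exp (- real n) \<le> real n * exp (- real n * 1)"
        using eventually_ge_at_top[of 1] by eventually_elim simp
    qed auto
    have "(\<lambda>n. bnd (real n)) \<longlonglongrightarrow> E1 * 0 + C * (A1 * (2 * B * 0 + 2 * 0) + A2 * (2 * \<tau> + 8 * B\<^sup>2 * 0))"
      unfolding bnd_def
      using pw[of "\<tau> / 2"] pw[of \<tau>] \<tau> ex lim_1_over_n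
      by (intro tendsto_intros) (simp_all)
    then have "(\<lambda>n. bnd (real n)) \<longlonglongrightarrow> C * (A2 * (2 * \<tau>))" by simp
    then show ?thesis by (rule LIMSEQ_le_const) (use est in auto)
  qed
  have "(\<lambda>n. C * (A2 * (2 * (1 / real (Suc n))))) \<longlonglongrightarrow> C * (A2 * (2 * 0))"
    by (intro tendsto_intros LIMSEQ_inverse_real_of_nat[unfolded inverse_eq_divide])
  moreover have "norm (S f) \<le> C * (A2 * (2 * (1 / real (Suc n))))" for n
    by (rule main) auto
  ultimately have "norm (S f) \<le> C * (A2 * (2 * 0))"
    by (intro LIMSEQ_le_const) auto
  then show ?thesis by simp
qed

section \<open>Exponential type and support of a functional\<close>

text \<open>
  The indicator of the transform at \<open>pi / 2\<close> in terms of the functional; composing with the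
  reflection of the line gives the indicator at \<open>- pi / 2\<close>.
\<close>
definition upper_type :: "((real \<Rightarrow> complex) \<Rightarrow> complex) \<Rightarrow> ereal" where
  "upper_type S = Limsup at_top (\<lambda>\<rho>. ln_ext (norm (S (expf \<rho>))) / ereal \<rho>)"

definition reflect :: "((real \<Rightarrow> complex) \<Rightarrow> complex) \<Rightarrow> (real \<Rightarrow> complex) \<Rightarrow> complex" where
  "reflect S = (\<lambda>f. S (\<lambda>x. f (- x)))"

lemma expf_reflect: "(\<lambda>x. expf y (- x)) = expf (- y)"
  using sym_interval_uminus[of _ a] by (force simp: expf_def)

lemma indicator_fun_upper: "indicator_fun (fourier_laplace a S) (pi / 2) = upper_type S"
proof -
  have "(\<lambda>t. if t \<in> sym_interval a then exp (- \<i> * complex_of_real t * (complex_of_real \<rho> * cis (pi / 2))) else 0)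
      = expf \<rho>" for \<rho>
  proof
    fix t
    have "- \<i> * complex_of_real t * (complex_of_real \<rho> * cis (pi / 2)) = of_real (\<rho> * t)"
      by (simp add: algebra_simps)
    then show "(if t \<in> sym_interval a then exp (- \<i> * complex_of_real t * (complex_of_real \<rho> * cis (pi / 2))) else 0)
      = expf \<rho> t" unfolding expf_def by (simp only: exp_of_real)
  qed
  then show ?thesis by (simp only: indicator_fun_def fourier_laplace_def upper_type_def)
qed

lemma indicator_fun_lower: "indicator_fun (fourier_laplace a S) (- pi / 2) = upper_type (reflect S)"
proof -
  have "(\<lambda>t. if t \<in> sym_interval a then exp (- \<i> * complex_of_real t * (complex_of_real \<rho> * cis (- pi / 2))) else 0)
      = (\<lambda>x. expf \<rho> (- x))" for \<rho>
    unfolding expf_reflect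
  proof
    fix t
    have "- \<i> * complex_of_real t * (complex_of_real \<rho> * cis (- pi / 2)) = of_real (- \<rho> * t)"
      by (simp add: algebra_simps)
    then show "(if t \<in> sym_interval a then exp (- \<i> * complex_of_real t * (complex_of_real \<rho> * cis (- pi / 2))) else 0)
      = expf (- \<rho>) t" unfolding expf_def by (simp only: exp_of_real)
  qed
  then show ?thesis by (simp only: indicator_fun_def fourier_laplace_def upper_type_def reflect_def)
qed

lemma reflect_linear:
  assumes "linear_on_U S"
  shows "linear_on_U (reflect S)"
  unfolding linear_on_U_def reflect_def
  using linear_on_U_add[OF assms U_space_reflect U_space_reflect] linear_on_U_scale[OF assms U_space_reflect]
  by simp

lemma reflect_bounded:
  assumes "bounded_by S q k C"
  shows "bounded_by (reflect S) q k C"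
proof -
  have "norm (reflect S f) \<le> C * B"
    if f: "f \<in> \<U>" and B: "0 \<le> B"
      and bd: "\<forall>j. \<forall>x\<in>{- c k..c k}. norm ((D_op a ^^ j) f x) \<le> B * M q j" for f B
    unfolding reflect_def
  proof (rule bounded_byD[OF assms U_space_reflect[OF f] B])
    fix j x assume "x \<in> {- c k..c k}"
    then have "- x \<in> {- c k..c k}" by simp
    with bd show "norm ((D_op a ^^ j) (\<lambda>x. f (- x)) x) \<le> B * M q j"
      by (simp add: D_op_power_reflect(1) U_space_smooth f norm_mult norm_power)
  qed
  then show ?thesis using assms unfolding bounded_by_def by blast
qed

lemma upper_type_le:
  assumes "eventually (\<lambda>\<rho>. norm (S (expf \<rho>)) \<le> exp (v * \<rho>)) at_top"
  shows "upper_type S \<le> ereal v"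
  unfolding upper_type_def
proof (rule Limsup_bounded)
  show "eventually (\<lambda>\<rho>. ln_ext (norm (S (expf \<rho>))) / ereal \<rho> \<le> ereal v) at_top"
    using assms eventually_gt_at_top[of 0]
  proof eventually_elim
    case (elim \<rho>)
    show ?case
    proof (cases "S (expf \<rho>) = 0")
      case True
      then show ?thesis using elim by (simp add: ln_ext_def)
    next
      case False
      then have "ln (norm (S (expf \<rho>))) \<le> v * \<rho>" using elim(1) by (subst exp_le_cancel_iff[symmetric]) auto
      then show ?thesis using False elim(2) by (simp add: ln_ext_def pos_divide_le_eq)
    qed
  qed
qed

lemma upper_type_less:
  assumes "upper_type S < ereal v"
  shows "eventually (\<lambda>\<rho>. norm (S (expf \<rho>)) \<le> exp (v * \<rho>)) at_top"
proof -
  have "eventually (\<lambda>\<rho>. ln_ext (norm (S (expf \<rho>))) / ereal \<rho> < ereal v) at_top"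
    using assms unfolding upper_type_def by (rule Limsup_lessD)
  then show ?thesis using eventually_gt_at_top[of 0]
  proof eventually_elim
    case (elim \<rho>)
    show ?case
    proof (cases "S (expf \<rho>) = 0")
      case False
      then have "ln (norm (S (expf \<rho>))) < v * \<rho>"
        using elim by (simp add: ln_ext_def pos_divide_less_eq)
      then show ?thesis using False by (subst (asm) exp_less_cancel_iff[symmetric]) auto
    qed simp
  qed
qed

lemma upper_type_le_of_weighted:
  assumes "\<And>y. 1 \<le> y \<Longrightarrow> norm (S (expf y)) \<le> E * exp (\<beta> * y + \<omega> y)"
  shows "upper_type S \<le> ereal \<beta>"
proof (rule ereal_le_epsilon2)
  fix e :: real assume e: "0 < e"
  obtain C where C: "0 \<le> C" "\<And>x. 0 \<le> x \<Longrightarrow> \<omega> x \<le> e / 2 * x + C"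
    using weight_le_linear[of "e / 2"] e by auto
  define E' where "E' = max 1 E"
  have "eventually (\<lambda>\<rho>. norm (S (expf \<rho>)) \<le> exp ((\<beta> + e) * \<rho>)) at_top"
    using eventually_ge_at_top[of "max 1 ((ln E' + C) / (e / 2))"]
  proof eventually_elim
    case (elim \<rho>)
    then have \<rho>: "1 \<le> \<rho>" and "(ln E' + C) / (e / 2) \<le> \<rho>" by auto
    then have 1: "ln E' + C \<le> e / 2 * \<rho>" using e by (simp add: pos_divide_le_eq mult.commute)
    have "norm (S (expf \<rho>)) \<le> E * exp (\<beta> * \<rho> + \<omega> \<rho>)" using \<rho> by (rule assms)
    also have "\<dots> \<le> E' * exp (\<beta> * \<rho> + \<omega> \<rho>)" by (intro mult_right_mono) (auto simp: E'_def)
    also have "\<dots> = exp (ln E' + (\<beta> * \<rho> + \<omega> \<rho>))" by (simp add: exp_add E'_def)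
    also have "\<dots> \<le> exp ((\<beta> + e) * \<rho>)" using 1 C(2)[of \<rho>] \<rho> by (simp add: algebra_simps)
    finally show ?case .
  qed
  from upper_type_le[OF this] show "upper_type S \<le> ereal \<beta> + ereal e" by simp
qed

text \<open>
  If \<open>S\<close> vanishes on functions supported to the right of \<open>\<alpha>\<close>, then \<open>e\<^sub>y\<close> can be multiplied with a step
  that is 0 to the right of \<open>\<beta>\<close>, and only values up to \<open>exp (\<beta> * y)\<close> remain.
\<close>
lemma upper_type_le_of_annihilation:
  assumes S: "linear_on_U S" "bounded_by S q k C" and \<alpha>: "\<alpha> < \<beta>"
    and kill: "\<And>g. g \<in> \<U> \<Longrightarrow> (\<And>t. t < \<alpha> \<Longrightarrow> g t = 0) \<Longrightarrow> S g = 0"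
  shows "upper_type S \<le> ereal \<beta>"
proof -
  have q: "0 < q" "q < 1" "0 \<le> C" using S(2) by (auto simp: bounded_by_def)
  define q' where "q' = (q + 1) / 2"
  have q': "q < q'" "0 < q'" "q' < 1" using q by (auto simp: q'_def)
  obtain \<kappa> where \<kappa>: "\<kappa> \<in> \<U>" "\<And>t. t \<in> sym_interval a \<Longrightarrow> t \<le> \<alpha> \<Longrightarrow> \<kappa> t = 1"
    "\<And>t. \<beta> \<le> t \<Longrightarrow> \<kappa> t = 0"
    using step_in_U[OF \<alpha>] by metis
  obtain A where A: "0 \<le> A" "\<And>j x. x \<in> {- c k..c k} \<Longrightarrow> norm ((D_op a ^^ j) \<kappa> x) \<le> A * M q' j"
    using U_space_bound[OF \<kappa>(1) q'(2,3)] by metis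
  from pointwise_product_bound[OF q(1) q'(1)] obtain C' where C': "0 < C'"
    "\<forall>f g x A B j. f \<in> smooth_functions a \<longrightarrow> g \<in> smooth_functions a \<longrightarrow> 0 \<le> A \<longrightarrow> 0 \<le> B \<longrightarrow>
      (\<forall>j. norm ((D_op a ^^ j) f x) \<le> A * M q' j) \<longrightarrow> (\<forall>j. norm ((D_op a ^^ j) g x) \<le> B * M q' j) \<longrightarrow>
      norm ((D_op a ^^ j) (\<lambda>x. f x * g x) x) \<le> C' * A * B * M q j"
    by (elim exE conjE)
  show ?thesis
  proof (rule upper_type_le_of_weighted)
    fix y :: real assume y: "1 \<le> y"
    have U: "(\<lambda>t. \<kappa> t * expf y t) \<in> \<U>" by (intro U_space_mult \<kappa> expf_in_U)
    have "S (\<lambda>t. expf y t - \<kappa> t * expf y t) = 0"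
    proof (rule kill[OF U_space_diff[OF expf_in_U U]])
      fix t assume "t < \<alpha>"
      then show "expf y t - \<kappa> t * expf y t = 0"
        using \<kappa>(2)[of t] by (cases "t \<in> sym_interval a") (auto simp: expf_def)
    qed
    then have eq: "S (expf y) = S (\<lambda>t. \<kappa> t * expf y t)"
      by (simp add: linear_on_U_diff[OF S(1) expf_in_U U])
    define B where "B = exp (y * \<beta>) * exp (\<omega> y)"
    have "norm (S (\<lambda>t. \<kappa> t * expf y t)) \<le> C * (C' * A * B)"
    proof (rule bounded_byD[OF S(2) U])
      show "0 \<le> C' * A * B" using C' A by (simp add: B_def)
      fix j t assume t: "t \<in> {- c k..c k}"
      show "norm ((D_op a ^^ j) (\<lambda>t. \<kappa> t * expf y t) t) \<le> C' * A * B * M q j"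
      proof (cases "t \<le> \<beta>")
        case True
        have "norm ((D_op a ^^ j) (expf y) t) \<le> B * M q' j" for j
        proof -
          have "q' * \<omega> y \<le> 1 * \<omega> y" using q' weight_nonneg[of y] y by (intro mult_right_mono) auto
          then have "exp (y * t) * exp (q' * \<omega> y) \<le> B" unfolding B_def
            using True y by (intro mult_mono) (auto intro: mult_left_mono)
          then have "exp (y * t) * exp (q' * \<omega> y) * M q' j \<le> B * M q' j"
            using M_pos[of q' j] by (intro mult_right_mono) auto
          moreover have "max 1 \<bar>y\<bar> = y" using y by simp
          ultimately show ?thesis using expf_bound[OF q'(2), of j y t] by simp
        qed
        then show ?thesis
          using C'(2)[rule_format, of \<kappa> "expf y" A B t j] A t
          by (simp add: U_space_smooth \<kappa>(1) expf_smooth B_def)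
      next
        case False
        have "(D_op a ^^ j) (\<lambda>t. \<kappa> t * expf y t) t = 0"
          by (rule D_op_power_eq_0[of "{\<beta><..}"]) (use False \<kappa>(3) in auto)
        then show ?thesis using C' A M_pos[of q j] by (simp add: B_def)
      qed
    qed
    then show "norm (S (expf y)) \<le> (C * C' * A) * exp (\<beta> * y + \<omega> y)"
      unfolding eq by (simp add: B_def exp_add mult_ac)
  qed
qed

lemma upper_type_le_c:
  assumes S: "linear_on_U S" "bounded_by S q k C"
  shows "upper_type S \<le> ereal (c k)"
proof (rule upper_type_le_of_weighted)
  fix y :: real assume y: "1 \<le> y"
  have q: "0 < q" "q < 1" using S(2) by (auto simp: bounded_by_def)
  have "norm (S (expf y)) \<le> C * (exp (c k * y + \<omega> y))"
  proof (rule bounded_byD[OF S(2) expf_in_U])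
    fix j t assume t: "t \<in> {- c k..c k}"
    have "q * \<omega> y \<le> 1 * \<omega> y" using q weight_nonneg[of y] y by (intro mult_right_mono) auto
    moreover have "y * t \<le> y * c k" using t y by (intro mult_left_mono) auto
    ultimately have "exp (y * t) * exp (q * \<omega> y) \<le> exp (c k * y + \<omega> y)"
      by (simp add: mult.commute flip: exp_add)
    then have "exp (y * t) * exp (q * \<omega> y) * M q j \<le> exp (c k * y + \<omega> y) * M q j"
      using M_pos[of q j] by (intro mult_right_mono) auto
    moreover have "max 1 \<bar>y\<bar> = y" using y by simp
    ultimately show "norm ((D_op a ^^ j) (expf y) t) \<le> exp (c k * y + \<omega> y) * M q j"
      using expf_bound[OF q(1), of j y t] by simp
  qed simp
  then show "norm (S (expf y)) \<le> C * exp (c k * y + \<omega> y)" .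
qed

lemma sym_interval_c: "- a < ereal (- c k)" "ereal (c k) < a"
proof -
  have "c k \<in> sym_interval a" "- c k \<in> sym_interval a" using c_in[of k] c_pos[of k] by auto
  then show "- a < ereal (- c k)" "ereal (c k) < a" by (auto simp: sym_interval_def)
qed

text \<open>
  A step that is 1 on a neighbourhood of \<open>{- c k..c k}\<close> makes the support of \<open>f\<close> compact without
  changing \<open>S f\<close>.
\<close>
lemma annihilates_right:
  assumes S: "linear_on_U S" "bounded_by S q k C" and type: "upper_type S \<le> ereal b"
    and b: "b \<in> sym_interval a" and f: "f \<in> \<U>" "\<And>t. t < b \<Longrightarrow> f t = 0"
  shows "S f = 0"
proof -
  have "ereal (max (c k) b) < a" using sym_interval_c[of k] b by (auto simp: sym_interval_def max_def)
  then obtain \<alpha> where \<alpha>: "max (c k) b < \<alpha>" "ereal \<alpha> < a" using ereal_dense2 by fastforce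
  then obtain \<beta> where \<beta>: "\<alpha> < \<beta>" "ereal \<beta> < a" using ereal_dense2[of "ereal \<alpha>" a] by auto
  obtain \<kappa> where \<kappa>: "\<kappa> \<in> \<U>" "\<And>t. t \<in> sym_interval a \<Longrightarrow> t \<le> \<alpha> \<Longrightarrow> \<kappa> t = 1"
    "\<And>t. \<beta> \<le> t \<Longrightarrow> \<kappa> t = 0"
    using step_in_U[OF \<beta>(1)] by metis
  have U: "(\<lambda>t. \<kappa> t * f t) \<in> \<U>" by (intro U_space_mult \<kappa> f)
  have "- a < ereal b" using b by (simp add: sym_interval_def)
  also have "ereal b \<le> ereal \<beta>" using \<alpha> \<beta> by simp
  finally have \<beta>_sym: "\<beta> \<in> sym_interval a" using \<beta> by (simp add: sym_interval_def)
  have "S f = S (\<lambda>t. \<kappa> t * f t)"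
  proof (rule bounded_by_locality[OF S f(1) U, of "{..<\<alpha>}"])
    show "f x = \<kappa> x * f x" if "x \<in> {..<\<alpha>}" for x
      using that \<kappa>(2)[of x] U_space_smooth[OF f(1)]
      by (cases "x \<in> sym_interval a") (auto simp: smooth_functions_def)
  qed (use \<alpha> in auto)
  also have "\<dots> = 0"
  proof (rule annihilates_compactly_supported[OF S U])
    show "b \<le> \<beta>" using \<alpha> \<beta> by simp
    show "{b..\<beta>} \<subseteq> sym_interval a" using sym_interval_between[OF b \<beta>_sym] by auto
    show "\<kappa> t * f t = 0" if "t \<notin> {b..\<beta>}" for t using that f(2)[of t] \<kappa>(3)[of t] by auto
    fix \<delta> :: real assume \<delta>: "0 < \<delta>"
    then have "upper_type S < ereal (b + \<delta>)" using type by (auto intro: le_less_trans)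
    from upper_type_less[OF this] obtain r0 where
      r0: "\<And>\<rho>. r0 \<le> \<rho> \<Longrightarrow> norm (S (expf \<rho>)) \<le> exp ((b + \<delta>) * \<rho>)"
      unfolding eventually_at_top_linorder by blast
    define N where "N = nat \<lceil>r0\<rceil>"
    define A where "A = 1 + (\<Sum>m<N. norm (S (expf (real m))) / exp ((b + \<delta>) * real m))"
    have A1: "1 \<le> A" unfolding A_def by (simp add: sum_nonneg)
    have "norm (S (expf (real m))) \<le> A * exp ((b + \<delta>) * real m)" for m
    proof (cases "m < N")
      case True
      then have "norm (S (expf (real m))) / exp ((b + \<delta>) * real m) \<le> A - 1"
        unfolding A_def using member_le_sum[of m "{..<N}" "\<lambda>m. norm (S (expf (real m))) / exp ((b + \<delta>) * real m)"]
        by simp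
      then have "norm (S (expf (real m))) / exp ((b + \<delta>) * real m) \<le> A" by simp
      then show ?thesis by (simp add: pos_divide_le_eq)
    next
      case False
      then have "r0 \<le> real m" by (simp add: N_def) linarith
      from r0[OF this] show ?thesis using A1
        by (smt (verit) exp_gt_zero mult_le_cancel_right1)
    qed
    then show "\<exists>A\<ge>0. \<forall>m\<ge>1. norm (S (expf (real m))) \<le> A * exp ((b + \<delta>) * real m)"
      using A1 by (intro exI[of _ A]) auto
  qed
  finally show ?thesis .
qed

lemma annihilates_left:
  assumes S: "linear_on_U S" "bounded_by S q k C" and type: "upper_type (reflect S) \<le> ereal (- b)"
    and b: "b \<in> sym_interval a" and f: "f \<in> \<U>" "\<And>t. b < t \<Longrightarrow> f t = 0"
  shows "S f = 0"
proof -
  have "reflect S (\<lambda>x. f (- x)) = 0"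
    by (rule annihilates_right[OF reflect_linear[OF S(1)] reflect_bounded[OF S(2)] type
          sym_interval_uminus[OF b] U_space_reflect[OF f(1)]]) (use f(2) in simp)
  then show ?thesis by (simp add: reflect_def)
qed

text \<open>
  Otherwise there were points \<open>p1 < p2\<close> between the types in the wrong order.  A step from \<open>p1\<close> to \<open>p2\<close>
  splits any function into parts supported left of \<open>p2\<close> and right of \<open>p1\<close>, and \<open>S\<close> vanishes on both.
\<close>
lemma types_ordered:
  assumes S: "linear_on_U S" "bounded_by S q k C" and nz: "f \<in> \<U>" "S f \<noteq> 0"
  shows "- upper_type (reflect S) \<le> upper_type S"
proof (rule ccontr)
  assume "\<not> ?thesis"
  then have lt: "upper_type S < - upper_type (reflect S)" by simp
  have 1: "upper_type S < a"
    using upper_type_le_c[OF S] sym_interval_c(2)[of k] by (rule le_less_trans)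
  have "upper_type (reflect S) < a"
    using upper_type_le_c[OF reflect_linear[OF S(1)] reflect_bounded[OF S(2)]] sym_interval_c(2)[of k]
    by (rule le_less_trans)
  then have 2: "- a < - upper_type (reflect S)" by simp
  have 3: "- a < a" using a_pos by (cases a) auto
  have "max (upper_type S) (- a) < min (- upper_type (reflect S)) a" using lt 1 2 3 by simp
  then obtain p1 where p1: "max (upper_type S) (- a) < ereal p1" "ereal p1 < min (- upper_type (reflect S)) a"
    using ereal_dense2 by blast
  then obtain p2 where p2: "ereal p1 < ereal p2" "ereal p2 < min (- upper_type (reflect S)) a"
    using ereal_dense2 by blast
  have p1s: "p1 \<in> sym_interval a" and p2s: "p2 \<in> sym_interval a"
    using p1 p2 unfolding sym_interval_def by (auto intro: less_trans)
  have t1: "upper_type S \<le> ereal p1" using p1 by (auto intro: less_imp_le)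
  have "ereal p2 < - upper_type (reflect S)" using p2 by simp
  then have t2: "upper_type (reflect S) \<le> ereal (- p2)"
    using ereal_less_uminus_reorder[of "ereal p2"] by (simp add: less_imp_le)
  have "p1 < p2" using p2 by simp
  then obtain \<kappa> where \<kappa>: "\<kappa> \<in> \<U>" "\<And>t. t \<in> sym_interval a \<Longrightarrow> t \<le> p1 \<Longrightarrow> \<kappa> t = 1"
    "\<And>t. p2 \<le> t \<Longrightarrow> \<kappa> t = 0"
    using step_in_U by metis
  have U: "(\<lambda>t. \<kappa> t * f t) \<in> \<U>" by (intro U_space_mult \<kappa> nz)
  have "S (\<lambda>t. \<kappa> t * f t) = 0"
    by (rule annihilates_left[OF S t2 p2s U]) (use \<kappa>(3) in auto)
  moreover have "S (\<lambda>t. f t - \<kappa> t * f t) = 0"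
  proof (rule annihilates_right[OF S t1 p1s U_space_diff[OF nz(1) U]])
    show "f t - \<kappa> t * f t = 0" if "t < p1" for t
      using that \<kappa>(2)[of t] U_space_smooth[OF nz(1)]
      by (cases "t \<in> sym_interval a") (auto simp: smooth_functions_def)
  qed
  ultimately show False using nz(2) linear_on_U_diff[OF S(1) nz(1) U] by simp
qed

text \<open>
  By \<open>types_ordered\<close> the types span an interval \<open>{l..h}\<close> with \<open>l \<le> h\<close>, on which \<open>f\<close> vanishes.  Cutting
  at \<open>h\<close>, where \<open>f\<close> is flat, leaves a part supported right of \<open>h\<close> and a part supported left of \<open>l\<close>.
\<close>
lemma annihilates_W_interval:
  assumes S: "linear_on_U S" "bounded_by S q k C" and nz: "g \<in> \<U>" "S g \<noteq> 0"
    and I: "is_interval I" "I \<subseteq> sym_interval a"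
    and supp: "\<And>x. x \<in> sym_interval a \<Longrightarrow> - upper_type (reflect S) \<le> ereal x \<Longrightarrow> ereal x \<le> upper_type S \<Longrightarrow> x \<in> I"
    and f: "f \<in> W_interval \<omega> a c I"
  shows "S f = 0"
proof -
  have fU: "f \<in> \<U>" and f0: "\<And>x. x \<in> I \<Longrightarrow> f x = 0" using f by (auto simp: W_interval_def)
  have ord: "- upper_type (reflect S) \<le> upper_type S" by (rule types_ordered[OF S nz])
  have hi: "upper_type S \<le> ereal (c k)" by (rule upper_type_le_c[OF S])
  have "upper_type (reflect S) \<le> ereal (c k)"
    by (rule upper_type_le_c[OF reflect_linear[OF S(1)] reflect_bounded[OF S(2)]])
  then have lo: "ereal (- c k) \<le> - upper_type (reflect S)"
    using ereal_uminus_le_reorder[of "ereal (c k)"] by simp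
  have "ereal (- c k) \<le> upper_type S" using lo ord by (rule order_trans)
  with hi obtain h where h: "upper_type S = ereal h" by (cases "upper_type S") auto
  have "- upper_type (reflect S) \<le> ereal (c k)" using ord hi by (rule order_trans)
  with lo obtain l where l: "- upper_type (reflect S) = ereal l"
    by (cases "upper_type (reflect S)") auto
  have lh: "l \<le> h" "- c k \<le> l" "h \<le> c k" using ord hi lo h l by auto
  then have ls: "l \<in> sym_interval a" and hs: "h \<in> sym_interval a" using c_in[of k] by auto
  have inI: "x \<in> I" if "l \<le> x" "x \<le> h" for x
    using supp[of x] sym_interval_between[OF ls hs that] that h l by simp
  have flat: "(D_op a ^^ j) f h = 0" for j
  proof (cases "\<exists>p. I = {p}")
    case True
    then have "I = {h}" using inI[of h] lh by auto
    then show ?thesis using f by (simp add: W_interval_def)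
  next
    case False
    then show ?thesis
      using flat_on_interval[OF U_space_smooth[OF fU] I, of h j] f0 inI[of h] lh by auto
  qed
  define f1 where "f1 = (\<lambda>x. if h < x then f x else 0)"
  have f1: "f1 \<in> \<U>" unfolding f1_def by (rule U_space_cut[OF fU flat])
  have "S f1 = 0"
    by (rule annihilates_right[OF S _ hs f1]) (auto simp: h f1_def)
  moreover have "S (\<lambda>x. f x - f1 x) = 0"
  proof (rule annihilates_left[OF S _ ls U_space_diff[OF fU f1]])
    show "upper_type (reflect S) \<le> ereal (- l)"
      using l ereal_uminus_eq_reorder[of "upper_type (reflect S)" "ereal l"] by simp
    show "f x - f1 x = 0" if "l < x" for x
      using that f0 inI[of x] by (auto simp: f1_def)
  qed
  ultimately show ?thesis using linear_on_U_diff[OF S(1) fU f1] by simp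
qed

lemma upper_type_le_of_annihilation_reflect:
  assumes S: "linear_on_U S" "bounded_by S q k C" and \<alpha>: "\<beta> < \<alpha>"
    and kill: "\<And>g. g \<in> \<U> \<Longrightarrow> (\<And>t. \<alpha> < t \<Longrightarrow> g t = 0) \<Longrightarrow> S g = 0"
  shows "upper_type (reflect S) \<le> ereal (- \<beta>)"
proof (rule upper_type_le_of_annihilation[OF reflect_linear[OF S(1)] reflect_bounded[OF S(2)], of "- \<alpha>"])
  fix g assume g: "g \<in> \<U>" "\<And>t. t < - \<alpha> \<Longrightarrow> g t = 0"
  show "reflect S g = 0" unfolding reflect_def
    by (rule kill[OF U_space_reflect[OF g(1)]]) (use g(2) in simp)
qed (use \<alpha> in simp)

lemma flat_in_W_interval:
  assumes "g \<in> \<U>" "open V" "I \<subseteq> V" "\<And>t. t \<in> V \<Longrightarrow> g t = 0"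
  shows "g \<in> W_interval \<omega> a c I"
  unfolding W_interval_def
proof (intro CollectI conjI ballI allI impI assms(1))
  show "g x = 0" if "x \<in> I" for x using that assms by auto
  show "(D_op a ^^ j) g p = 0" if "I = {p}" for p j
    by (rule D_op_power_eq_0[OF assms(2,4)]) (use that assms in auto)
qed

section \<open>The topology and the annihilator\<close>

definition U_norm :: "real \<Rightarrow> nat \<Rightarrow> (real \<Rightarrow> complex) \<Rightarrow> real" where
  "U_norm q k f = real_of_ereal (U_seminorm \<omega> a c q k f)"

lemma U_seminorm_U_norm:
  assumes "f \<in> \<U>" "0 < q" "q < 1"
  shows "U_seminorm \<omega> a c q k f = ereal (U_norm q k f)"
proof -
  obtain B where "U_seminorm \<omega> a c q k f = ereal B" using U_space_seminorm_real[OF assms] by metis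
  then show ?thesis by (simp add: U_norm_def)
qed

lemma U_norm_bound:
  assumes "f \<in> \<U>" "0 < q" "q < 1" "x \<in> {- c k..c k}"
  shows "norm ((D_op a ^^ j) f x) \<le> U_norm q k f * M q j"
  using jet_bound_iff[of q k f "U_norm q k f"] U_seminorm_U_norm[OF assms(1-3), of k] assms(4) by simp

lemma U_norm_least:
  assumes "f \<in> \<U>" "0 < q" "q < 1"
    "\<And>j x. x \<in> {- c k..c k} \<Longrightarrow> norm ((D_op a ^^ j) f x) \<le> B * M q j"
  shows "U_norm q k f \<le> B"
  using jet_bound_iff[of q k f B] U_seminorm_U_norm[OF assms(1-3), of k] assms(4) by simp

lemma U_norm_nonneg:
  assumes "f \<in> \<U>" "0 < q" "q < 1"
  shows "0 \<le> U_norm q k f"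
  using U_seminorm_nonneg[of q k f] by (simp add: U_norm_def real_of_ereal_pos)

lemma U_norm_mono:
  assumes f: "f \<in> \<U>" and q: "0 < q" "q \<le> q'" "q' < 1" and k: "k \<le> k'"
  shows "U_norm q k f \<le> U_norm q' k' f"
proof (rule U_norm_least[OF f])
  fix j x assume "x \<in> {- c k..c k}"
  then have x: "x \<in> {- c k'..c k'}" using c_mono[OF k] by auto
  have "norm ((D_op a ^^ j) f x) \<le> U_norm q' k' f * M q' j" by (rule U_norm_bound[OF f _ _ x]) (use q in auto)
  also have "\<dots> \<le> U_norm q' k' f * M q j"
    by (intro mult_left_mono M_antimono U_norm_nonneg f) (use q in auto)
  finally show "norm ((D_op a ^^ j) f x) \<le> U_norm q' k' f * M q j" .
qed (use q in auto)

lemma U_norm_add: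
  assumes f: "f \<in> \<U>" and g: "g \<in> \<U>" and q: "0 < q" "q < 1"
  shows "U_norm q k (\<lambda>x. f x + g x) \<le> U_norm q k f + U_norm q k g"
proof (rule U_norm_least[OF U_space_add[OF f g] q])
  fix j x assume x: "x \<in> {- c k..c k}"
  have "norm ((D_op a ^^ j) f x + (D_op a ^^ j) g x) \<le> U_norm q k f * M q j + U_norm q k g * M q j"
    by (intro norm_triangle_mono U_norm_bound f g q x)
  then show "norm ((D_op a ^^ j) (\<lambda>x. f x + g x) x) \<le> (U_norm q k f + U_norm q k g) * M q j"
    by (simp add: D_op_power_add(1) U_space_smooth f g algebra_simps)
qed

lemma U_norm_scale:
  assumes f: "f \<in> \<U>" and q: "0 < q" "q < 1"
  shows "U_norm q k (\<lambda>x. \<alpha> * f x) = norm \<alpha> * U_norm q k f"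
proof (rule antisym)
  have le: "U_norm q k (\<lambda>x. \<alpha> * f x) \<le> norm \<alpha> * U_norm q k f" if f: "f \<in> \<U>" for \<alpha> f
  proof (rule U_norm_least[OF U_space_scale[OF f] q])
    fix j x assume x: "x \<in> {- c k..c k}"
    have "norm \<alpha> * norm ((D_op a ^^ j) f x) \<le> norm \<alpha> * (U_norm q k f * M q j)"
      by (intro mult_left_mono U_norm_bound f q x) auto
    then show "norm ((D_op a ^^ j) (\<lambda>x. \<alpha> * f x) x) \<le> (norm \<alpha> * U_norm q k f) * M q j"
      by (simp add: D_op_power_scale(1) U_space_smooth f norm_mult mult.assoc)
  qed
  show "U_norm q k (\<lambda>x. \<alpha> * f x) \<le> norm \<alpha> * U_norm q k f" by (rule le[OF f])
  show "norm \<alpha> * U_norm q k f \<le> U_norm q k (\<lambda>x. \<alpha> * f x)"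
  proof (cases "\<alpha> = 0")
    case True
    then show ?thesis using U_norm_nonneg[OF U_space_zero q] by simp
  next
    case False
    have "(\<lambda>x. inverse \<alpha> * (\<alpha> * f x)) = f" using False by (simp add: mult.assoc[symmetric])
    then have "U_norm q k f \<le> norm (inverse \<alpha>) * U_norm q k (\<lambda>x. \<alpha> * f x)"
      using le[OF U_space_scale[OF f, of \<alpha>], of "inverse \<alpha>"] by simp
    then show ?thesis using False by (simp add: norm_divide norm_inverse field_simps)
  qed
qed

definition U_ball :: "(real \<Rightarrow> complex) \<Rightarrow> real \<Rightarrow> nat \<Rightarrow> real \<Rightarrow> (real \<Rightarrow> complex) set" where
  "U_ball f q k e = {g \<in> \<U>. U_norm q k (\<lambda>x. g x - f x) < e}"

lemma U_ball_eq:
  assumes "f \<in> \<U>" "0 < q" "q < 1"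
  shows "{g \<in> \<U>. U_seminorm \<omega> a c q k (\<lambda>x. g x - f x) < ereal e} = U_ball f q k e"
  using U_seminorm_U_norm[OF U_space_diff[OF _ assms(1)] assms(2,3)] by (auto simp: U_ball_def)

lemma U_ball_center: "f \<in> \<U> \<Longrightarrow> 0 < q \<Longrightarrow> q < 1 \<Longrightarrow> 0 < e \<Longrightarrow> f \<in> U_ball f q k e"
  using U_norm_scale[OF U_space_zero, of q k 0] by (simp add: U_ball_def)

lemma U_topology_basis:
  "U_topology \<omega> a c = topology_generated_by {U_ball f q k e | f q k e. f \<in> \<U> \<and> 0 < q \<and> q < 1 \<and> 0 < e}"
proof -
  have "{{g \<in> \<U>. U_seminorm \<omega> a c q k (\<lambda>x. g x - f x) < ereal e} | f q k e.
        f \<in> \<U> \<and> q \<in> {0<..<1} \<and> 0 < e}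
    = {U_ball f q k e | f q k e. f \<in> \<U> \<and> 0 < q \<and> q < 1 \<and> 0 < e}"
    (is "?A = ?B")
  proof
    show "?A \<subseteq> ?B"
    proof
      fix X assume "X \<in> ?A"
      then obtain f q k e where *: "X = {g \<in> \<U>. U_seminorm \<omega> a c q k (\<lambda>x. g x - f x) < ereal e}"
        "f \<in> \<U>" "0 < q" "q < 1" "0 < e" by auto
      then have "X = U_ball f q k e" using U_ball_eq by simp
      with * show "X \<in> ?B" by blast
    qed
    show "?B \<subseteq> ?A"
    proof
      fix X assume "X \<in> ?B"
      then obtain f q k e where *: "X = U_ball f q k e"
        "f \<in> \<U>" "0 < q" "q < 1" "0 < e" by auto
      then have "X = {g \<in> \<U>. U_seminorm \<omega> a c q k (\<lambda>x. g x - f x) < ereal e}" using U_ball_eq by simp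
      with * show "X \<in> ?A" by (intro CollectI exI[of _ f] exI[of _ q] exI[of _ k] exI[of _ e]) simp
    qed
  qed
  then show ?thesis by (simp only: U_topology_def)
qed

lemma openin_U_ball:
  assumes "f \<in> \<U>" "0 < q" "q < 1" "0 < e"
  shows "openin (U_topology \<omega> a c) (U_ball f q k e)"
  unfolding U_topology_basis by (rule topology_generated_by_Basis) (use assms in auto)

lemma topspace_U: "topspace (U_topology \<omega> a c) = \<U>"
proof
  show "topspace (U_topology \<omega> a c) \<subseteq> \<U>"
    unfolding U_topology_basis topology_generated_by_topspace by (auto simp: U_ball_def)
  show "\<U> \<subseteq> topspace (U_topology \<omega> a c)"
  proof
    fix f assume f: "f \<in> \<U>"
    have "f \<in> U_ball f (1/2) 0 1" by (rule U_ball_center[OF f]) auto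
    moreover have "openin (U_topology \<omega> a c) (U_ball f (1/2) 0 1)" by (rule openin_U_ball[OF f]) auto
    ultimately show "f \<in> topspace (U_topology \<omega> a c)" using openin_subset by blast
  qed
qed

lemma U_ball_shrink:
  assumes f: "f \<in> \<U>" and q: "0 < q" "q \<le> q'" "q' < 1" and "k \<le> k'" "e' \<le> e"
  shows "U_ball f q' k' e' \<subseteq> U_ball f q k e"
proof
  fix g assume g: "g \<in> U_ball f q' k' e'"
  then have gU: "g \<in> \<U>" by (simp add: U_ball_def)
  have "U_norm q k (\<lambda>x. g x - f x) \<le> U_norm q' k' (\<lambda>x. g x - f x)"
    by (rule U_norm_mono[OF U_space_diff[OF gU f]]) (use assms in auto)
  then show "g \<in> U_ball f q k e" using g assms by (simp add: U_ball_def)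
qed

text \<open>
  The semi-norms are directed, so that finite intersections of balls contain a ball of a single
  semi-norm about each of their points.
\<close>
lemma openin_U_contains_ball:
  assumes "openin (U_topology \<omega> a c) T" "f \<in> T"
  shows "\<exists>q k e. 0 < q \<and> q < 1 \<and> 0 < e \<and> U_ball f q k e \<subseteq> T"
proof -
  have "generate_topology_on {U_ball f q k e | f q k e. f \<in> \<U> \<and> 0 < q \<and> q < 1 \<and> 0 < e} T"
    using assms(1) unfolding U_topology_basis openin_topology_generated_by_iff .
  then show ?thesis using assms(2)
  proof (induction arbitrary: f)
    case Empty
    then show ?case by simp
  next
    case (Int A B)
    obtain q1 k1 e1 where 1: "0 < q1" "q1 < 1" "0 < e1" "U_ball f q1 k1 e1 \<subseteq> A" using Int.IH(1)[of f] Int.prems by auto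
    obtain q2 k2 e2 where 2: "0 < q2" "q2 < 1" "0 < e2" "U_ball f q2 k2 e2 \<subseteq> B" using Int.IH(2)[of f] Int.prems by auto
    have "openin (U_topology \<omega> a c) A"
      unfolding U_topology_basis openin_topology_generated_by_iff by (rule Int.hyps(1))
    then have "f \<in> \<U>" using Int.prems openin_subset topspace_U by blast
    then have "U_ball f (max q1 q2) (max k1 k2) (min e1 e2) \<subseteq> U_ball f q1 k1 e1"
      "U_ball f (max q1 q2) (max k1 k2) (min e1 e2) \<subseteq> U_ball f q2 k2 e2"
      using 1 2 by (intro U_ball_shrink; simp)+
    then have "U_ball f (max q1 q2) (max k1 k2) (min e1 e2) \<subseteq> A \<inter> B" using 1 2 by blast
    then show ?case
      using 1 2 by (intro exI[of _ "max q1 q2"] exI[of _ "max k1 k2"] exI[of _ "min e1 e2"]) auto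
  next
    case (UN K)
    then obtain X where X: "X \<in> K" "f \<in> X" by auto
    obtain q k e where "0 < q" "q < 1" "0 < e" "U_ball f q k e \<subseteq> X" using UN.IH[OF X] by auto
    then show ?case using X(1) by blast
  next
    case (Basis X)
    then obtain f0 q k e where X: "X = U_ball f0 q k e" "f0 \<in> \<U>" "0 < q" "q < 1" "0 < e" by auto
    have fU: "f \<in> \<U>" and fe: "U_norm q k (\<lambda>x. f x - f0 x) < e" using Basis.prems X by (auto simp: U_ball_def)
    have "U_ball f q k (e - U_norm q k (\<lambda>x. f x - f0 x)) \<subseteq> X"
    proof
      fix g assume g: "g \<in> U_ball f q k (e - U_norm q k (\<lambda>x. f x - f0 x))"
      then have gU: "g \<in> \<U>" by (simp add: U_ball_def)
      have "U_norm q k (\<lambda>x. (g x - f x) + (f x - f0 x)) \<le> U_norm q k (\<lambda>x. g x - f x) + U_norm q k (\<lambda>x. f x - f0 x)"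
        by (intro U_norm_add U_space_diff gU fU X)
      then show "g \<in> X" using g gU by (simp add: X U_ball_def)
    qed
    then show ?case using X fe by (intro exI[of _ q] exI[of _ k] exI[of _ "e - U_norm q k (\<lambda>x. f x - f0 x)"]) auto
  qed
qed

lemma U_dual_bounded:
  assumes S: "S \<in> U_dual \<omega> a c"
  shows "linear_on_U S" "\<exists>q k C. bounded_by S q k C"
proof -
  show lin: "linear_on_U S" using S by (auto simp: U_dual_def linear_on_U_def)
  have S0: "S (\<lambda>x. 0) = 0" using linear_on_U_scale[OF lin U_space_zero, of 0] by simp
  have "continuous_map (U_topology \<omega> a c) euclidean S" using S by (simp add: U_dual_def)
  then have "openin (U_topology \<omega> a c) {f \<in> topspace (U_topology \<omega> a c). S f \<in> ball 0 1}"
    by (rule openin_continuous_map_preimage) simp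
  then have "openin (U_topology \<omega> a c) {f \<in> \<U>. S f \<in> ball 0 1}" by (simp only: topspace_U)
  from openin_U_contains_ball[OF this, of "\<lambda>x. 0"] obtain q k e where
    q: "0 < q" "q < 1" "0 < e" and ball: "U_ball (\<lambda>x. 0) q k e \<subseteq> {f \<in> \<U>. S f \<in> ball 0 1}"
    using U_space_zero S0 by auto
  have "norm (S f) \<le> (1 / e) * B"
    if f: "f \<in> \<U>" and B: "0 \<le> B"
      and bd: "\<forall>j. \<forall>x\<in>{- c k..c k}. norm ((D_op a ^^ j) f x) \<le> B * M q j" for f B
  proof (rule field_le_epsilon)
    fix d :: real assume d: "0 < d"
    define s where "s = B + e * d"
    have s: "0 < s" "B < s" using B d q by (auto simp: s_def add_nonneg_pos)
    have "U_norm q k f \<le> B" by (rule U_norm_least[OF f q(1,2)]) (use bd in auto)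
    then have "U_norm q k (\<lambda>x. of_real (e / s) * f x) \<le> (e / s) * B"
      using U_norm_scale[OF f q(1,2), of k "of_real (e / s)"] s q mult_left_mono[of "U_norm q k f" B "e / s"]
      by (simp add: norm_divide)
    also have "\<dots> < e" using s q B by (simp add: field_simps)
    finally have "(\<lambda>x. of_real (e / s) * f x) \<in> U_ball (\<lambda>x. 0) q k e"
      using U_space_scale[OF f, of "of_real (e / s)"] by (simp add: U_ball_def)
    then have "norm (S (\<lambda>x. of_real (e / s) * f x)) < 1" using ball by auto
    then have "(e / s) * norm (S f) < 1"
      using linear_on_U_scale[OF lin f, of "of_real (e / s)"] s q by (simp add: norm_mult norm_divide)
    then have "norm (S f) < s / e" using s q by (simp add: field_simps)
    then show "norm (S f) \<le> (1 / e) * B + d" using q by (simp add: s_def field_simps)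
  qed
  then have "bounded_by S q k (1 / e)" using q unfolding bounded_by_def by auto
  then show "\<exists>q k C. bounded_by S q k C" by blast
qed

text \<open>
  A point outside the closed subspace has positive distance from it in some semi-norm.
\<close>
lemma annihilator_separates:
  assumes W: "D_invariant_subspace \<omega> a c W" and f0: "f0 \<in> \<U>" "f0 \<notin> W"
  obtains S where "S \<in> annihilator \<omega> a c W" "S f0 \<noteq> 0"
proof -
  have WU: "W \<subseteq> \<U>" and W0: "(\<lambda>x. 0) \<in> W"
    and Wadd: "\<And>f g. f \<in> W \<Longrightarrow> g \<in> W \<Longrightarrow> (\<lambda>x. f x + g x) \<in> W"
    and Wscale: "\<And>f \<alpha>. f \<in> W \<Longrightarrow> (\<lambda>x. \<alpha> * f x) \<in> W"
    and closed: "closedin (U_topology \<omega> a c) W"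
    using W by (auto simp: D_invariant_subspace_def)
  have "openin (U_topology \<omega> a c) (\<U> - W)"
    using closed by (simp add: closedin_def topspace_U)
  from openin_U_contains_ball[OF this, of f0] f0 obtain q k e where
    q: "0 < q" "q < 1" "0 < e" and ball: "U_ball f0 q k e \<subseteq> \<U> - W" by auto
  have dist: "e \<le> U_norm q k (\<lambda>x. f0 x - w x)" if "w \<in> W" for w
  proof -
    have wU: "w \<in> \<U>" using that WU by auto
    have "w \<notin> U_ball f0 q k e" using ball that by auto
    then have "e \<le> U_norm q k (\<lambda>x. w x - f0 x)" using wU by (simp add: U_ball_def)
    also have "\<dots> = U_norm q k (\<lambda>x. - 1 * (f0 x - w x))" by simp
    also have "\<dots> = norm (- 1 :: complex) * U_norm q k (\<lambda>x. f0 x - w x)"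
      by (rule U_norm_scale[OF U_space_diff[OF f0(1) wU] q(1,2)])
    finally show ?thesis by simp
  qed
  interpret complex_function_space "\<U>"
    by standard (auto intro: U_space_add U_space_scale U_space_zero)
  have ex: "\<exists>S. (\<forall>f\<in>\<U>. \<forall>g\<in>\<U>. S (\<lambda>x. f x + g x) = S f + S g) \<and>
    (\<forall>f\<in>\<U>. \<forall>\<alpha>. S (\<lambda>x. \<alpha> * f x) = \<alpha> * S f) \<and>
    (\<forall>f\<in>\<U>. norm (S f) \<le> U_norm q k f) \<and> (\<forall>w\<in>W. S w = 0) \<and> S f0 \<noteq> (0::complex)"
  proof (rule hahn_banach_separation[of "U_norm q k" W f0 e])
    show "U_norm q k (\<lambda>x. f x + g x) \<le> U_norm q k f + U_norm q k g"
      if "f \<in> \<U>" "g \<in> \<U>" for f g by (rule U_norm_add[OF that q(1,2)])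
    show "U_norm q k (\<lambda>x. \<alpha> * f x) = norm \<alpha> * U_norm q k f" if "f \<in> \<U>" for f \<alpha>
      by (rule U_norm_scale[OF that q(1,2)])
  qed (use WU W0 f0 q dist in \<open>auto intro: Wadd Wscale\<close>)
  obtain S where S: "\<forall>f\<in>\<U>. \<forall>g\<in>\<U>. S (\<lambda>x. f x + g x) = S f + S g"
    "\<forall>f\<in>\<U>. \<forall>\<alpha>. S (\<lambda>x. \<alpha> * f x) = \<alpha> * S f"
    "\<forall>f\<in>\<U>. norm (S f) \<le> U_norm q k f" "\<forall>w\<in>W. S w = 0" "S f0 \<noteq> 0"
    using ex by (elim exE conjE)
  define S' where "S' = restrict S (\<U>)"
  have S'_eq: "S' f = S f" if "f \<in> \<U>" for f using that by (simp add: S'_def)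
  have "continuous_map (U_topology \<omega> a c) euclidean S'"
    unfolding continuous_map_def
  proof (intro conjI allI impI)
    fix X :: "complex set" assume "openin euclidean X"
    then have X: "open X" by simp
    show "openin (U_topology \<omega> a c) {f \<in> topspace (U_topology \<omega> a c). S' f \<in> X}"
    proof (subst openin_subopen, intro ballI)
      fix f assume "f \<in> {f \<in> topspace (U_topology \<omega> a c). S' f \<in> X}"
      then have f: "f \<in> \<U>" "S f \<in> X" by (auto simp: topspace_U S'_eq)
      obtain d where d: "0 < d" "ball (S f) d \<subseteq> X" using X f(2) open_contains_ball by blast
      have "U_ball f q k d \<subseteq> {f \<in> topspace (U_topology \<omega> a c). S' f \<in> X}"
      proof
        fix g assume g: "g \<in> U_ball f q k d"
        then have gU: "g \<in> \<U>" by (simp add: U_ball_def)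
        have "S (\<lambda>x. g x + - 1 * f x) = S g + S (\<lambda>x. - 1 * f x)"
          by (rule S(1)[rule_format, OF gU U_space_scale[OF f(1)]])
        also have "S (\<lambda>x. - 1 * f x) = - 1 * S f" by (rule S(2)[rule_format, OF f(1)])
        finally have "S g - S f = S (\<lambda>x. g x - f x)" by simp
        then have "norm (S g - S f) \<le> U_norm q k (\<lambda>x. g x - f x)"
          using S(3) U_space_diff[OF gU f(1)] by simp
        also have "\<dots> < d" using g by (simp add: U_ball_def)
        finally have "S g \<in> ball (S f) d" by (simp add: dist_norm norm_minus_commute)
        then show "g \<in> {f \<in> topspace (U_topology \<omega> a c). S' f \<in> X}"
          using d(2) gU by (auto simp: topspace_U S'_eq)
      qed
      then show "\<exists>T. openin (U_topology \<omega> a c) T \<and> f \<in> T \<and> T \<subseteq> {f \<in> topspace (U_topology \<omega> a c). S' f \<in> X}"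
        using openin_U_ball[OF f(1) q(1,2) d(1)] U_ball_center[OF f(1) q(1,2) d(1)] by blast
    qed
  qed simp
  then have "S' \<in> U_dual \<omega> a c"
    unfolding U_dual_def using S(1,2)
    by (simp add: S'_eq U_space_add U_space_scale) (simp add: S'_def)
  then have "S' \<in> annihilator \<omega> a c W" using S(4) WU by (auto simp: annihilator_def S'_eq)
  moreover have "S' f0 \<noteq> 0" using S(5) f0(1) by (simp add: S'_eq)
  ultimately show thesis by (rule that)
qed

section \<open>The residual interval\<close>

lemma segment_interval_rel_closed:
  "rel_closed_interval a {x \<in> sym_interval a. ereal x \<in> {lo..hi}}" (is "rel_closed_interval a ?R")
  unfolding rel_closed_interval_def
proof (intro conjI)
  show "is_interval ?R"
    unfolding is_interval_1
  proof (intro ballI allI impI)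
    fix x z y assume x: "x \<in> ?R" and z: "z \<in> ?R" and y: "x \<le> y \<and> y \<le> z"
    then have "y \<in> sym_interval a" using sym_interval_between[of x a z y] by auto
    moreover have "lo \<le> ereal x" "ereal x \<le> ereal y" "ereal y \<le> ereal z" "ereal z \<le> hi" using x y z by auto
    ultimately show "y \<in> ?R" using order_trans[of lo "ereal x" "ereal y"] order_trans[of "ereal y" "ereal z" hi] by simp
  qed
  have "closed (ereal -` {lo..hi})"
    by (intro closed_vimage continuous_intros)
  from closedin_closed_Int[OF this, of "sym_interval a"]
  have "closedin (top_of_set (sym_interval a)) (sym_interval a \<inter> ereal -` {lo..hi})" .
  moreover have "sym_interval a \<inter> ereal -` {lo..hi} = ?R" by auto
  ultimately show "closedin (top_of_set (sym_interval a)) ?R" by simp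
qed auto

lemma segment_W_interval_subset:
  assumes W: "D_invariant_subspace \<omega> a c W" and J: "J = fourier_laplace a ` annihilator \<omega> a c W"
  shows "W_interval \<omega> a c {x \<in> sym_interval a. ereal x \<in> indicator_segment J} \<subseteq> W"
    (is "W_interval \<omega> a c ?R \<subseteq> W")
proof
  fix f assume f: "f \<in> W_interval \<omega> a c ?R"
  then have fU: "f \<in> \<U>" by (simp add: W_interval_def)
  show "f \<in> W"
  proof (rule ccontr)
    assume "f \<notin> W"
    then obtain S where S: "S \<in> annihilator \<omega> a c W" "S f \<noteq> 0" using annihilator_separates[OF W fU] by metis
    then have Sd: "S \<in> U_dual \<omega> a c" by (simp add: annihilator_def)
    obtain q k C where bd: "bounded_by S q k C" using U_dual_bounded(2)[OF Sd] by auto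
    have rc: "rel_closed_interval a ?R" unfolding indicator_segment_def by (rule segment_interval_rel_closed)
    have "fourier_laplace a S \<in> J" using S J by simp
    then have up: "upper_type S \<le> seg_upper J" and lo: "upper_type (reflect S) \<le> - seg_lower J"
      unfolding seg_upper_def seg_lower_def indicator_fun_upper[of S, symmetric] indicator_fun_lower[of S, symmetric]
        ereal_uminus_uminus by (intro SUP_upper; assumption)+
    have "S f = 0"
    proof (rule annihilates_W_interval[OF U_dual_bounded(1)[OF Sd] bd fU S(2) _ _ _ f])
      show "is_interval ?R" "?R \<subseteq> sym_interval a" using rc by (auto simp: rel_closed_interval_def)
      fix x assume x: "x \<in> sym_interval a" "- upper_type (reflect S) \<le> ereal x" "ereal x \<le> upper_type S"
      have "- (- seg_lower J) \<le> - upper_type (reflect S)" using lo by (simp only: ereal_minus_le_minus)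
      then have "seg_lower J \<le> - upper_type (reflect S)" by simp
      then have "seg_lower J \<le> ereal x" using x(2) by (rule order_trans)
      moreover have "ereal x \<le> seg_upper J" using x(3) up by (rule order_trans)
      ultimately show "x \<in> ?R" using x(1) by (simp add: indicator_segment_def)
    qed
    then show False using S(2) by simp
  qed
qed

text \<open>
  A point \<open>x\<close> of the segment outside \<open>I\<close> has distance \<open>d > 0\<close> from \<open>I\<close>, which lies on one side of it.
  Functions supported beyond half that distance on the side of \<open>x\<close> belong to \<open>W\<close>, so all types stop
  before \<open>x\<close>.
\<close>
lemma segment_subset_of_W_interval_subset:
  assumes W: "D_invariant_subspace \<omega> a c W" and J: "J = fourier_laplace a ` annihilator \<omega> a c W"
    and I: "rel_closed_interval a I" "W_interval \<omega> a c I \<subseteq> W"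
  shows "{x \<in> sym_interval a. ereal x \<in> indicator_segment J} \<subseteq> I"
proof
  fix x assume "x \<in> {x \<in> sym_interval a. ereal x \<in> indicator_segment J}"
  then have x: "x \<in> sym_interval a" "seg_lower J \<le> ereal x" "ereal x \<le> seg_upper J"
    by (auto simp: indicator_segment_def)
  show "x \<in> I"
  proof (rule ccontr)
    assume xI: "x \<notin> I"
    have "openin (top_of_set (sym_interval a)) (sym_interval a - I)"
      using I(1) by (auto simp: rel_closed_interval_def closedin_def)
    then have "open (sym_interval a - I)" using openin_open_trans[OF _ open_sym_interval] by blast
    then obtain d where d: "0 < d" "ball x d \<subseteq> sym_interval a - I"
      using x(1) xI open_contains_ball by blast
    have far: "d \<le> \<bar>i - x\<bar>" if "i \<in> I" for i
      using that d(2) by (auto simp: ball_def dist_real_def subset_eq abs_minus_commute not_less[symmetric])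
    have iv: "is_interval I" using I(1) by (simp add: rel_closed_interval_def)
    have kill: "S g = 0" if "S \<in> annihilator \<omega> a c W" "g \<in> W_interval \<omega> a c I" for S g
      using that I(2) by (auto simp: annihilator_def)
    have dual: "\<exists>q k C. linear_on_U S \<and> bounded_by S q k C" if "S \<in> annihilator \<omega> a c W" for S
      using U_dual_bounded[of S] that by (simp add: annihilator_def)
    consider "\<forall>i\<in>I. i \<le> x" | "\<forall>i\<in>I. x \<le> i"
      using iv xI unfolding is_interval_1 by (meson linear)
    then show False
    proof cases
      case 1
      have left: "i < x - d / 2" if "i \<in> I" for i using far[OF that] 1 that d(1) by fastforce
      have "upper_type S \<le> ereal (x - d / 4)" if S: "S \<in> annihilator \<omega> a c W" for S
      proof -
        obtain q k C where b: "linear_on_U S" "bounded_by S q k C" using dual[OF S] by blast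
        show ?thesis
        proof (rule upper_type_le_of_annihilation[OF b, of "x - d / 2"])
          fix g assume g: "g \<in> \<U>" "\<And>t. t < x - d / 2 \<Longrightarrow> g t = 0"
          show "S g = 0"
            by (rule kill[OF S flat_in_W_interval[OF g(1), of "{..<x - d / 2}"]]) (use left g(2) in auto)
        qed (use d in simp)
      qed
      then have "seg_upper J \<le> ereal (x - d / 4)"
        unfolding seg_upper_def J by (intro SUP_least) (auto simp: indicator_fun_upper)
      then have "ereal x \<le> ereal (x - d / 4)" using x(3) by (rule order_trans[rotated])
      then show False using d(1) by simp
    next
      case 2
      have right: "x + d / 2 < i" if "i \<in> I" for i using far[OF that] 2 that d(1) by fastforce
      have "upper_type (reflect S) \<le> ereal (- (x + d / 4))" if S: "S \<in> annihilator \<omega> a c W" for S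
      proof -
        obtain q k C where b: "linear_on_U S" "bounded_by S q k C" using dual[OF S] by blast
        show ?thesis
        proof (rule upper_type_le_of_annihilation_reflect[OF b, of _ "x + d / 2"])
          fix g assume g: "g \<in> \<U>" "\<And>t. x + d / 2 < t \<Longrightarrow> g t = 0"
          show "S g = 0"
            by (rule kill[OF S flat_in_W_interval[OF g(1), of "{x + d / 2<..}"]]) (use right g(2) in auto)
        qed (use d in simp)
      qed
      then have "(SUP \<phi>\<in>J. indicator_fun \<phi> (- pi / 2)) \<le> ereal (- (x + d / 4))"
        unfolding J image_image by (intro SUP_least) (simp only: indicator_fun_lower)
      then have "- ereal (- (x + d / 4)) \<le> seg_lower J"
        unfolding seg_lower_def by (simp only: ereal_minus_le_minus)
      then have "ereal (x + d / 4) \<le> seg_lower J" by (simp add: add.commute)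
      then have "ereal (x + d / 4) \<le> ereal x" using x(2) by (rule order_trans)
      then show False using d(1) by simp
    qed
  qed
qed

end

theorem proposition2p3:
  fixes \<omega> :: "real \<Rightarrow> real" and a :: ereal and c r :: "nat \<Rightarrow> real"
    and W :: "(real \<Rightarrow> complex) set" and J :: "(complex \<Rightarrow> complex) set"
  assumes "ultradiff_setting \<omega> a c r"
    and "D_invariant_subspace \<omega> a c W"
    and "J = fourier_laplace a ` annihilator \<omega> a c W"
  shows "(\<exists>!R. is_residual_interval \<omega> a c W R) \<and>
    is_residual_interval \<omega> a c W {x \<in> sym_interval a. ereal x \<in> indicator_segment J}"
proof -
  interpret ultradiff \<omega> a c r by standard (rule assms(1))
  let ?R = "{x \<in> sym_interval a. ereal x \<in> indicator_segment J}"
  have closed: "rel_closed_interval a ?R"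
    unfolding indicator_segment_def by (rule segment_interval_rel_closed)
  have sub: "W_interval \<omega> a c ?R \<subseteq> W" by (rule segment_W_interval_subset[OF assms(2,3)])
  have least: "?R \<subseteq> I" if "rel_closed_interval a I" "W_interval \<omega> a c I \<subseteq> W" for I
    by (rule segment_subset_of_W_interval_subset[OF assms(2,3) that])
  have res: "is_residual_interval \<omega> a c W ?R"
    unfolding is_residual_interval_def
  proof (intro conjI allI impI closed sub)
    fix I assume I: "rel_closed_interval a I \<and> I \<subset> ?R"
    then have "\<not> W_interval \<omega> a c I \<subseteq> W" using least by blast
    then show "W_interval \<omega> a c I - W \<noteq> {}" by blast
  qed
  moreover have "R = ?R" if "is_residual_interval \<omega> a c W R" for R
  proof (rule ccontr)
    assume ne: "R \<noteq> ?R"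
    have "?R \<subseteq> R" using that by (intro least) (auto simp: is_residual_interval_def)
    then have "?R \<subset> R" using ne by blast
    then have "W_interval \<omega> a c ?R - W \<noteq> {}" using that closed by (simp add: is_residual_interval_def)
    then show False using sub by blast
  qed
  ultimately show ?thesis by blast
qed

end
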